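(* Let $\beta,\kappa>0$ and let $V$ be as in the context. (i) If there exists $C>0$ such that $V(x)\le \frac{\kappa}{|x|^{2+2\beta}}-\frac{C}{|x|^{2+\beta}}$ for all $x\in\mathbb{R}^d_0$ with $|x|\le1$, then there are no constants $c_1,c_2,c_3>0$ such that $$p(t,x,y)\le c_1\Big(1\wedge\frac{h_{\beta,\kappa}(|x|)}{h_{\beta,\kappa}(\eta_1t^{1/(2+\beta)})}\Big)\Big(1\wedge\frac{h_{\beta,\kappa}(|y|)}{h_{\beta,\kappa}(\eta_1t^{1/(2+\beta)})}\Big)\exp\Big(-\frac{c_2t}{(|x|\vee|y|\vee t^{1/(2+\beta)})^{2+2\beta}}\Big)q(c_3t,x,y)$$ for all $t\in(0,1]$ and $x,y\in\mathbb{R}^d_0$. (ii) If there exists $C>0$ such that $V(x)\ge \frac{\kappa}{|x|^{2+2\beta}}+\frac{C}{|x|^{2+\beta}}$ for all $x\in\mathbb{R}^d_0$ with $|x|\le1$, then there are no constants $c_4,c_5,c_6>0$ such that $$p(t,x,y)\ge c_4\Big(1\wedge\frac{h_{\beta,\kappa}(|x|)}{h_{\beta,\kappa}(\eta_1t^{1/(2+\beta)})}\Big)\Big(1\wedge\frac{h_{\beta,\kappa}(|y|)}{h_{\beta,\kappa}(\eta_1t^{1/(2+\beta)})}\Big)\exp\Big(-\frac{c_5t}{(|x|\vee|y|\vee t^{1/(2+\beta)})^{2+2\beta}}\Big)q(c_6t,x,y)$$ for all $t\in(0,1]$ and all $x,y\in\mathbb{R}^d_0$ (when $d=1$: all $x,y\in\mathbb{R}^1_0$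 with $xy>0$).
   Context: Let $d\ge1$, $\mathbb{R}^d_0:=\mathbb{R}^d\setminus\{0\}$. $V$ is a non-negative locally bounded Borel function on $\mathbb{R}^d_0$ with $\sup_{|x|\ge1}V(x)<\infty$ and $\int_{B(0,1)\setminus\{0\}}V(x)dx=\infty$. $W$ is Brownian motion on $\mathbb{R}^d$ with generator $\Delta$, transition density $q(t,x,y)=(4\pi t)^{-d/2}e^{-|x-y|^2/(4t)}$. $X$ is the process on $\mathbb{R}^d_0$ with semigroup $P_tf(x)=\mathbb{E}_x[e^{-\int_0^tV(W_s)ds}f(W_t);\,t<\tau^W_{\mathbb{R}^d_0}]$ (generator $\Delta-V$), and $p(t,x,y)$ is its transition density ($=\lim_n p^{\overline B(0,1/n)^c}(t,x,y)$, with $p^U$ the transition density of $X$ killed upon exiting $U$). $h_{\beta,\kappa}(r):=(r\wedge 1)^{-(d-2-\beta)/2}\exp\big(-\frac{\sqrt\kappa}{\beta(r\wedge1)^\beta}\big)$; $\eta_0:=(2^{-4-\beta/(2+\beta)}\beta\sqrt\kappa)^{1/(2+\beta)}$, $\eta_1:=2^{-2/(2+\beta)}\eta_0$. *)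

theory Defs
  imports "HOL-Probability.Probability"
begin

text \<open>Gaussian kernel of the Laplacian (generator \<Delta>) on R^d, d = CARD('n).\<close>
definition heat :: "real \<Rightarrow> real^'n \<Rightarrow> real^'n \<Rightarrow> real" where
  "heat t x y = (4 * pi * t) powr (- real CARD('n) / 2) * exp (- (norm (x - y))\<^sup>2 / (4 * t))"

definition paths :: "real^'n \<Rightarrow> (real \<Rightarrow> real^'n) set" where
  "paths x = {w. continuous_on {0..} w \<and> w 0 = x}"

text \<open>M is the law of a Brownian motion with generator \<Delta> started at x, on the space of
  continuous paths with the cylinder sigma-algebra: independent Gaussian increments
  with density q(t-s,0,.).\<close>
definition is_BM :: "real^'n \<Rightarrow> (real \<Rightarrow> real^'n) measure \<Rightarrow> bool" where
  "is_BM x M \<longleftrightarrow> prob_space M \<and>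
     sets M = sets (restrict_space (Pi\<^sub>M UNIV (\<lambda>_. borel)) (paths x)) \<and>
     (\<forall>(ts :: nat \<Rightarrow> real) k. ts 0 = 0 \<and> (\<forall>i<k. ts i < ts (Suc i)) \<longrightarrow>
        prob_space.indep_vars M (\<lambda>_. borel) (\<lambda>i w. w (ts (Suc i)) - w (ts i)) {..<k} \<and>
        (\<forall>i<k. distributed M lborel (\<lambda>w. w (ts (Suc i)) - w (ts i))
                  (\<lambda>z. ennreal (heat (ts (Suc i) - ts i) 0 z))))"

definition Wiener :: "real^'n \<Rightarrow> (real \<Rightarrow> real^'n) measure" where
  "Wiener x = (SOME M. is_BM x M)"

text \<open>Feynman--Kac kernel of X: P_t(x,A) = E_x[exp(-\<integral>_0^t V(W_s) ds) 1_A(W_t); t < \<tau>],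
  where t < \<tau> (exit time of R^d minus 0) means the continuous path does not hit 0 on [0,t].\<close>
definition FK_kernel :: "(real^'n \<Rightarrow> real) \<Rightarrow> real \<Rightarrow> real^'n \<Rightarrow> (real^'n) set \<Rightarrow> ennreal" where
  "FK_kernel V t x A = (\<integral>\<^sup>+ w. ennreal (indicator {w. \<forall>s\<in>{0..t}. w s \<noteq> 0} w *
        exp (- (LINT s:{0..t}|lborel. V (w s))) * indicator A (w t)) \<partial>Wiener x)"

text \<open>Transition density p(t,x,.) of X: a (Borel) density of P_t(x,.) w.r.t. Lebesgue measure.
  It is determined up to Lebesgue-null sets; statements below are made Lebesgue-a.e. in y.\<close>
definition FK_density :: "(real^'n \<Rightarrow> real) \<Rightarrow> real \<Rightarrow> real^'n \<Rightarrow> real^'n \<Rightarrow> real" where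
  "FK_density V t x = (SOME f. f \<in> borel_measurable borel \<and> (\<forall>y. f y \<ge> 0) \<and>
       (\<forall>A\<in>sets borel. FK_kernel V t x A = (\<integral>\<^sup>+ y\<in>A. ennreal (f y) \<partial>lborel)))"

definition hfun :: "'n itself \<Rightarrow> real \<Rightarrow> real \<Rightarrow> real \<Rightarrow> real" where
  "hfun _ \<beta> \<kappa> r = (min r 1) powr (- (real CARD('n) - 2 - \<beta>) / 2) *
       exp (- sqrt \<kappa> / (\<beta> * (min r 1) powr \<beta>))"

definition eta0 :: "real \<Rightarrow> real \<Rightarrow> real" where
  "eta0 \<beta> \<kappa> = (2 powr (-4 - \<beta> / (2 + \<beta>)) * \<beta> * sqrt \<kappa>) powr (1 / (2 + \<beta>))"

definition eta1 :: "real \<Rightarrow> real \<Rightarrow> real" where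
  "eta1 \<beta> \<kappa> = 2 powr (- 2 / (2 + \<beta>)) * eta0 \<beta> \<kappa>"

definition bound :: "real \<Rightarrow> real \<Rightarrow> real \<Rightarrow> real \<Rightarrow> real \<Rightarrow> real \<Rightarrow> real^'n \<Rightarrow> real^'n \<Rightarrow> real" where
  "bound \<beta> \<kappa> c c' c'' t x y =
     (let h = hfun TYPE('n) \<beta> \<kappa>; r = eta1 \<beta> \<kappa> * t powr (1 / (2 + \<beta>)) in
      c * min 1 (h (norm x) / h r) * min 1 (h (norm y) / h r) *
      exp (- c' * t / (max (max (norm x) (norm y)) (t powr (1 / (2 + \<beta>)))) powr (2 + 2 * \<beta>)) *
      heat (c'' * t) x y)"

end

theory Submission
  imports Defs
begin

text \<open>
Time \<open>t = 1\<close> already suffices. For a radial function \<open>u(x) = |x|\<^sup>2\<^sup>a exp (- c |x| powr (- \<beta>))\<close> with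
\<open>c = sqrt \<kappa> / \<beta>\<close>, the quotient \<open>\<Delta>u / u\<close> equals \<open>\<kappa> / |x| powr (2 + 2\<beta>)\<close> plus a term of order
\<open>|x| powr (- 2 - \<beta>)\<close> whose coefficient is increasing in \<open>a\<close> and vanishes exactly for the exponent of
\<open>h\<close>. The perturbation \<open>C / |x| powr (2 + \<beta>)\<close> of the potential therefore leaves room for a
subsolution with a smaller exponent in part (i) and for a supersolution with a larger exponent in
part (ii). The Feynman--Kac functional transfers this to \<open>p(1, x, \<cdot>)\<close>: as \<open>x\<close> tends to \<open>0\<close> it decays more
slowly, respectively faster, than \<open>h(|x|)\<close> by a power of \<open>|x|\<close>, which the bounds do not allow.

Instead of stochastic calculus, the Feynman--Kac weight is replaced by its Riemann sums along an
equidistant time grid. The resulting expectations are iterates of \<open>f \<mapsto> w \<cdot> (f * q\<^sub>\<delta>)\<close>, and a Taylor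
expansion shows that one iteration preserves sub- and supersolutions up to an error of order
\<open>\<delta> powr (3/2)\<close>, controlled by an exponential eigenfunction of the heat semigroup.

Brownian motion itself is obtained from Levy's construction with dyadic increments.
\<close>

section \<open>The Gaussian kernel\<close>

text \<open>The potential \<open>V\<close> is only Borel, so Riemann sums of it along a path need
  not converge. It is therefore compared with a continuous model potential having the prescribed
  singular terms; outside the unit ball the two compare up to an additive constant, which costs a
  constant factor at time 1. The two directions are not symmetric. A supersolution survives
  discretisation because \<open>1 + t \<le> exp t\<close> holds without restriction, so a lower
  bound on the potential is enough. The reverse estimate \<open>exp t \<le> 1 + t + O(t^2)\<close>
  needs a bounded potential, so the subsolution has to vanish near the origin. It is cut off at
  \<open>|x|^2 = \<epsilon>\<close> with \<open>\<epsilon>\<close> depending on the starting point.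
  This is harmless because the rate \<open>l\<close> in the lower bound is independent of
  \<open>\<epsilon>\<close>; whatever depends on \<open>\<epsilon>\<close> sits in the
  discretisation error, which vanishes as the grid is refined. A contradiction arises by integrating
  the hypothetical bound on \<open>p\<close> against the comparison function in \<open>y\<close>.
  \<open>Wiener\<close> and \<open>FK_density\<close> are defined by choice, so the existence of
  Brownian motion and of a density belongs to the proof.\<close>

definition gauss :: "real \<Rightarrow> (real^'n) measure" where
  "gauss s = density lborel (\<lambda>z. ennreal (heat s 0 z))"

lemma heat_nonneg [simp]: "0 \<le> heat s x y"
  by (simp add: heat_def)

lemma heat_diff: "heat s x y = heat s 0 (y - x)"
  by (simp add: heat_def norm_minus_commute)

lemma heat_measurable2 [measurable (raw)]:
  fixes f g :: "'a \<Rightarrow> real^'n"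
  assumes f: "f \<in> borel_measurable M" and g: "g \<in> borel_measurable M"
  shows "(\<lambda>w. heat s (f w) (g w)) \<in> borel_measurable M"
proof -
  have "(\<lambda>w. (norm (f w - g w))\<^sup>2) \<in> borel_measurable M"
    by (intro borel_measurable_power measurable_compose[OF borel_measurable_diff[OF f g] borel_measurable_norm])
  then show ?thesis
    unfolding heat_def
    by (intro borel_measurable_times borel_measurable_const measurable_compose[OF _ borel_measurable_exp]
      borel_measurable_divide borel_measurable_uminus)
qed

lemma heat_measurable [measurable]: "heat s x \<in> borel_measurable borel"
  by (rule heat_measurable2) auto

text \<open>The generator is Delta and not Delta/2, so each coordinate has variance
  \<open>2 * s\<close>.\<close>

lemma heat_eq_prod_normal_density:
  assumes "s > 0"
  shows "heat s 0 (z::real^'n) = (\<Prod>b\<in>Basis. normal_density 0 (sqrt (2 * s)) (z \<bullet> b))"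
proof -
  have "(\<Prod>b\<in>Basis. normal_density 0 (sqrt (2 * s)) (z \<bullet> b))
      = (\<Prod>b\<in>(Basis::(real^'n) set). 1 / sqrt (4 * pi * s)) * exp (\<Sum>b\<in>Basis. - (z \<bullet> b)\<^sup>2 / (4 * s))"
    using assms by (simp add: normal_density_def prod.distrib exp_sum algebra_simps prod_dividef power2_eq_square power_divide)
  also have "(\<Sum>b\<in>Basis. - (z \<bullet> b)\<^sup>2 / (4 * s)) = - (norm z)\<^sup>2 / (4 * s)"
    unfolding power2_norm_eq_inner
    by (subst euclidean_inner[of z z]) (simp add: sum_negf sum_divide_distrib power2_eq_square)
  also have "(\<Prod>b\<in>(Basis::(real^'n) set). 1 / sqrt (4 * pi * s)) = (4 * pi * s) powr (- real CARD('n) / 2)"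
    using assms by (simp add: powr_minus_divide powr_half_sqrt[symmetric] powr_powr powr_realpow[symmetric] power_one_over field_simps del: powr_half_sqrt)
  finally show ?thesis by (simp add: heat_def)
qed

section \<open>Product integrals and Gaussian moments\<close>

lemma has_bochner_integral_lborel_prod:
  fixes k :: "'a::euclidean_space \<Rightarrow> real \<Rightarrow> real"
  assumes k: "\<And>b. b \<in> Basis \<Longrightarrow> integrable lborel (k b)"
  shows "has_bochner_integral lborel (\<lambda>z::'a. \<Prod>b\<in>Basis. k b (z \<bullet> b)) (\<Prod>b\<in>Basis. \<integral>x. k b x \<partial>lborel)"
proof -
  interpret product_sigma_finite "\<lambda>_::'a. lborel :: real measure"
    by standard
  have m: "(\<lambda>z::'a. \<Prod>b\<in>Basis. k b (z \<bullet> b)) \<in> borel_measurable borel"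
  proof (rule borel_measurable_prod)
    fix b :: 'a assume b: "b \<in> Basis"
    have "k b \<in> borel_measurable borel" using k[OF b] by auto
    then show "(\<lambda>z. k b (z \<bullet> b)) \<in> borel_measurable borel"
      by (rule measurable_compose[rotated]) simp
  qed
  have eq: "(\<Prod>b\<in>Basis. k b ((\<Sum>b\<in>Basis. f b *\<^sub>R b) \<bullet> b)) = (\<Prod>b\<in>Basis. k b (f b))" for f
    by (intro prod.cong refl) simp
  show ?thesis
    unfolding has_bochner_integral_iff
    using product_integrable_prod[OF finite_Basis k] product_integral_prod[OF finite_Basis k]
    by (subst (1 2) lborel_eq) (simp add: integrable_distr_eq integral_distr m eq)
qed

text \<open>The one computation behind the polynomial moments below: with the factors
  \<open>k b\<close> chosen as \<open>1\<close>, \<open>x\<close> or \<open>x * x\<close> it yields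
  the normalisation, the means and the covariances.\<close>

lemma gauss_integral_prod:
  fixes k :: "real^'n \<Rightarrow> real \<Rightarrow> real"
  assumes s: "s > 0" and k: "\<And>b. b \<in> Basis \<Longrightarrow> integrable lborel (\<lambda>x. normal_density 0 (sqrt (2 * s)) x * k b x)"
    and m: "\<And>b. b \<in> Basis \<Longrightarrow> k b \<in> borel_measurable borel"
  shows "has_bochner_integral (gauss s) (\<lambda>z::real^'n. \<Prod>b\<in>Basis. k b (z \<bullet> b))
     (\<Prod>b\<in>Basis. \<integral>x. normal_density 0 (sqrt (2 * s)) x * k b x \<partial>lborel)"
proof -
  have m': "(\<lambda>z::real^'n. \<Prod>b\<in>Basis. k b (z \<bullet> b)) \<in> borel_measurable borel"
    by (intro borel_measurable_prod measurable_compose[OF _ m]) simp_all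
  show ?thesis
    unfolding gauss_def using has_bochner_integral_lborel_prod[OF k]
    by (intro has_bochner_integral_density) (auto simp: m' heat_eq_prod_normal_density[OF s] prod.distrib prod_nonneg)
qed

lemma sets_gauss [simp, measurable_cong]: "sets (gauss s) = sets borel"
  and space_gauss [simp]: "space (gauss s) = UNIV"
  by (simp_all add: gauss_def)

lemma prob_space_gauss: "s > 0 \<Longrightarrow> prob_space (gauss s :: (real^'n) measure)"
proof -
  assume s: "s > 0"
  have "has_bochner_integral (gauss s) (\<lambda>z::real^'n. 1::real) 1"
    using gauss_integral_prod[OF s, of "\<lambda>(_::real^'n) _. 1"] s by simp
  then have "(\<integral>\<^sup>+z. ennreal ((\<lambda>_. 1) z) \<partial>(gauss s :: (real^'n) measure)) = ennreal 1"
    by (subst nn_integral_eq_integral) (auto simp only: has_bochner_integral_iff)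
  then show ?thesis by (intro prob_spaceI) simp
qed

lemma gauss_moment1:
  assumes s: "s > 0"
  shows "has_bochner_integral (gauss s) (\<lambda>z::real^'n. x \<bullet> z) 0"
proof -
  have 1: "has_bochner_integral (gauss s) (\<lambda>z::real^'n. z \<bullet> b) 0" if b: "b \<in> Basis" for b
  proof -
    let ?k = "\<lambda>(c::real^'n) x. if c = b then x else (1::real)"
    have i: "integrable lborel (\<lambda>x. normal_density 0 (sqrt (2 * s)) x * ?k c x)" for c
      using s integrable_normal_moment_nz_1[of "sqrt (2 * s)" 0] by (cases "c = b") simp_all
    have "(\<Prod>c\<in>Basis. \<integral>x. normal_density 0 (sqrt (2 * s)) x * ?k c x \<partial>lborel) = 0"
      using s b integral_normal_moment_nz_1[of "sqrt (2 * s)" 0]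
      by (intro prod_zero bexI[of _ b]) auto
    with gauss_integral_prod[OF s, of ?k, OF i] b show ?thesis
      by (simp add: prod.delta)
  qed
  have "has_bochner_integral (gauss s) (\<lambda>z::real^'n. \<Sum>b\<in>Basis. (x \<bullet> b) * (z \<bullet> b)) (\<Sum>b\<in>Basis. (x \<bullet> b) * 0)"
    by (intro has_bochner_integral_sum has_bochner_integral_mult_right 1)
  then show ?thesis by (subst euclidean_inner) simp
qed

lemma gauss_moment2_Basis:
  assumes s: "s > 0" and b: "b \<in> Basis" and b': "b' \<in> Basis"
  shows "has_bochner_integral (gauss s) (\<lambda>z::real^'n. (z \<bullet> b) * (z \<bullet> b')) (if b = b' then 2 * s else 0)"
proof -
  let ?k = "\<lambda>(c::real^'n) x. (if c = b then x else (1::real)) * (if c = b' then x else (1::real))"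
  have m2: "has_bochner_integral lborel (\<lambda>x. normal_density 0 (sqrt (2 * s)) x * x^2) (2 * s)"
    using normal_moment_even[of "sqrt (2 * s)" 0 1] s by (simp add: eval_nat_numeral)
  have i: "integrable lborel (\<lambda>x. normal_density 0 (sqrt (2 * s)) x * ?k c x)" for c
    using s integrable_normal_moment_nz_1[of "sqrt (2 * s)" 0] m2
    by (cases "c = b"; cases "c = b'") (auto simp: power2_eq_square has_bochner_integral_iff mult.assoc)
  have I: "(\<integral>x. normal_density 0 (sqrt (2 * s)) x * ?k c x \<partial>lborel) =
     (if c = b \<and> c = b' then 2 * s else if c = b \<or> c = b' then 0 else 1)" for c
    using s integral_normal_moment_nz_1[of "sqrt (2 * s)" 0] m2
    by (cases "c = b"; cases "c = b'") (auto simp: power2_eq_square has_bochner_integral_iff mult.assoc)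
  have "(\<Prod>c\<in>Basis. \<integral>x. normal_density 0 (sqrt (2 * s)) x * ?k c x \<partial>lborel) = (if b = b' then 2 * s else 0)"
  proof (cases "b = b'")
    case True
    then have "(\<Prod>c\<in>Basis. if c = b \<and> c = b' then 2 * s else if c = b \<or> c = b' then 0 else 1) = (\<Prod>c\<in>Basis. if c = b then 2 * s else 1)"
      by (intro prod.cong) auto
    with True show ?thesis unfolding I using b by simp
  next
    case False
    then show ?thesis unfolding I using b by (simp, intro prod_zero bexI[of _ b]) auto
  qed
  with gauss_integral_prod[OF s, of ?k, OF i] b b' show ?thesis
    by (simp add: prod.distrib prod.delta)
qed

lemma gauss_moment2:
  assumes s: "s > 0"
  shows "has_bochner_integral (gauss s) (\<lambda>z::real^'n. (x \<bullet> z)\<^sup>2) (2 * s * (norm x)\<^sup>2)"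
proof -
  have eq: "(x \<bullet> z)\<^sup>2 = (\<Sum>b\<in>Basis. \<Sum>c\<in>Basis. ((x \<bullet> b) * (x \<bullet> c)) * ((z \<bullet> b) * (z \<bullet> c)))" for z :: "real^'n"
    by (simp add: euclidean_inner[of x z] power2_eq_square sum_product ac_simps)
  have "has_bochner_integral (gauss s) (\<lambda>z::real^'n. (x \<bullet> z)\<^sup>2)
     (\<Sum>b\<in>Basis. \<Sum>c\<in>Basis. ((x \<bullet> b) * (x \<bullet> c)) * (if b = c then 2 * s else 0))"
    unfolding eq by (intro has_bochner_integral_sum has_bochner_integral_mult_right gauss_moment2_Basis s)
  moreover have "(\<Sum>b\<in>Basis. \<Sum>c\<in>Basis. ((x \<bullet> b) * (x \<bullet> c)) * (if b = c then 2 * s else 0)) = 2 * s * (norm x)\<^sup>2"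
    by (simp add: power2_norm_eq_inner euclidean_inner[of x x] sum_distrib_left ac_simps if_distrib[where f="\<lambda>y. _ * y"] sum.delta cong: if_cong sum.cong)
  ultimately show ?thesis by simp
qed

lemma gauss_moment_norm2:
  assumes s: "s > 0"
  shows "has_bochner_integral (gauss s) (\<lambda>z::real^'n. (norm z)\<^sup>2) (2 * s * real CARD('n))"
proof -
  have "has_bochner_integral (gauss s) (\<lambda>z::real^'n. \<Sum>b\<in>Basis. (b \<bullet> z)\<^sup>2) (\<Sum>b\<in>(Basis::(real^'n) set). 2 * s * (norm b)\<^sup>2)"
    by (intro has_bochner_integral_sum gauss_moment2 s)
  moreover have "(\<Sum>b\<in>Basis. (b \<bullet> z)\<^sup>2) = (norm z)\<^sup>2" for z :: "real^'n"
    by (simp only: power2_norm_eq_inner) (subst euclidean_inner[of z z], simp add: power2_eq_square inner_commute)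
  ultimately show ?thesis by (simp add: ac_simps)
qed

section \<open>Translation, tilting, scaling, convolution and rotation of Gaussian laws\<close>

lemma nn_integral_lborel_translate:
  fixes f :: "'a::euclidean_space \<Rightarrow> ennreal"
  assumes "f \<in> borel_measurable borel"
  shows "(\<integral>\<^sup>+z. f (z + a) \<partial>lborel) = (\<integral>\<^sup>+z. f z \<partial>lborel)"
  using assms by (subst (2) lborel_distr_plus[of a, symmetric]) (simp add: nn_integral_distr add.commute)

lemma nn_integral_gauss: "f \<in> borel_measurable borel \<Longrightarrow>
    (\<integral>\<^sup>+z. f z \<partial>gauss s) = (\<integral>\<^sup>+z. ennreal (heat s 0 z) * f z \<partial>lborel)"
  unfolding gauss_def by (subst nn_integral_density) auto

lemma nn_integral_heat: "s > 0 \<Longrightarrow> (\<integral>\<^sup>+z. ennreal (heat s x z) \<partial>lborel) = 1" for x :: "real^'n"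
proof -
  assume s: "s > 0"
  have "(\<integral>\<^sup>+z. ennreal (heat s x z) \<partial>lborel) = (\<integral>\<^sup>+(z::real^'n). ennreal (heat s 0 (z + (- x))) \<partial>lborel)"
    by (subst heat_diff) simp
  also have "\<dots> = (\<integral>\<^sup>+(z::real^'n). ennreal (heat s 0 z) * 1 \<partial>lborel)"
    by (subst nn_integral_lborel_translate[where f="\<lambda>z. ennreal (heat s 0 z)"]) auto
  also have "\<dots> = 1"
    using prob_space.emeasure_space_1[OF prob_space_gauss[OF s, where 'n='n]]
    by (subst nn_integral_gauss[symmetric]) auto
  finally show ?thesis .
qed

lemma nn_integral_gauss_translate:
  assumes [measurable]: "f \<in> borel_measurable borel"
  shows "(\<integral>\<^sup>+z. f (x + z) \<partial>gauss s) = (\<integral>\<^sup>+z. ennreal (heat s x z) * f z \<partial>lborel)"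
proof -
  have "(\<integral>\<^sup>+z. ennreal (heat s x z) * f z \<partial>lborel) = (\<integral>\<^sup>+z. ennreal (heat s x (z + x)) * f (z + x) \<partial>lborel)"
    by (subst nn_integral_lborel_translate) auto
  also have "\<dots> = (\<integral>\<^sup>+z. ennreal (heat s 0 z) * f (x + z) \<partial>lborel)"
    by (subst heat_diff) (simp add: add.commute)
  finally show ?thesis by (subst nn_integral_gauss) auto
qed

text \<open>Completing the square: tilting by \<open>exp (a \<bullet> z)\<close> moves the centre of
  the kernel to \<open>(2 * s) *\<^sub>R a\<close> and multiplies its mass by
  \<open>exp (s * (norm a)^2)\<close>.\<close>

lemma gauss_exp_moment:
  assumes s: "s > 0"
  shows "(\<integral>\<^sup>+z. ennreal (exp (a \<bullet> z)) \<partial>gauss s) = ennreal (exp (s * (norm a)\<^sup>2))"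
    and "has_bochner_integral (gauss s) (\<lambda>z. exp (a \<bullet> z)) (exp (s * (norm a)\<^sup>2))"
proof -
  have eq: "heat s 0 z * exp (a \<bullet> z) = exp (s * (norm a)\<^sup>2) * heat s ((2 * s) *\<^sub>R a) z" for z
  proof -
    have "(norm ((2 * s) *\<^sub>R a - z))\<^sup>2 = 4 * s\<^sup>2 * (norm a)\<^sup>2 - 4 * s * (a \<bullet> z) + (norm z)\<^sup>2"
      unfolding power2_norm_eq_inner by (simp add: inner_diff_left inner_diff_right inner_commute power2_eq_square algebra_simps)
    then have "- (norm z)\<^sup>2 / (4 * s) + a \<bullet> z = s * (norm a)\<^sup>2 + - (norm ((2 * s) *\<^sub>R a - z))\<^sup>2 / (4 * s)"
      using s by (simp add: field_simps power2_eq_square)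
    then show ?thesis
      by (simp add: heat_def flip: exp_add)
  qed
  show 1: "(\<integral>\<^sup>+z. ennreal (exp (a \<bullet> z)) \<partial>gauss s) = ennreal (exp (s * (norm a)\<^sup>2))"
  proof -
    have "(\<integral>\<^sup>+z. ennreal (exp (a \<bullet> z)) \<partial>gauss s) = (\<integral>\<^sup>+z. ennreal (heat s 0 z * exp (a \<bullet> z)) \<partial>lborel)"
      by (subst nn_integral_gauss) (auto simp: ennreal_mult)
    also have "\<dots> = (\<integral>\<^sup>+z. ennreal (exp (s * (norm a)\<^sup>2)) * ennreal (heat s ((2 * s) *\<^sub>R a) z) \<partial>lborel)"
      by (simp only: eq) (simp add: ennreal_mult)
    also have "\<dots> = ennreal (exp (s * (norm a)\<^sup>2))"
      by (subst nn_integral_cmult) (auto simp: nn_integral_heat s)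
    finally show ?thesis .
  qed
  show "has_bochner_integral (gauss s) (\<lambda>z. exp (a \<bullet> z)) (exp (s * (norm a)\<^sup>2))"
    by (rule has_bochner_integral_nn_integral) (auto simp: 1)
qed

text \<open>Reduces the dependence on \<open>s\<close> to the fixed law \<open>gauss 1\<close>. This
  gives the power \<open>s powr (3/2)\<close> of the cubic moments, continuity in \<open>s\<close>,
  and the scale of the noise in the dyadic construction.\<close>

lemma gauss_scale:
  assumes s: "s > 0"
  shows "gauss s = distr (gauss 1) borel (\<lambda>z::real^'n. sqrt s *\<^sub>R z)"
proof (rule measure_eqI)
  fix A assume "A \<in> sets (gauss s :: (real^'n) measure)"
  then have [measurable]: "A \<in> sets borel" by simp
  have eq: "heat s 0 (sqrt s *\<^sub>R z) * sqrt s ^ CARD('n) = heat 1 0 z" for z :: "real^'n"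
  proof -
    have "(4 * pi * s) powr (- real CARD('n) / 2) * sqrt s ^ CARD('n) = (4 * pi) powr (- real CARD('n) / 2)"
    proof -
      have "sqrt s ^ CARD('n) = s powr (real CARD('n) / 2)"
        using s by (simp add: powr_half_sqrt[symmetric] powr_realpow[symmetric] powr_powr)
      then show ?thesis
        using s by (simp add: powr_mult powr_minus field_simps)
    qed
    then show ?thesis using s by (simp add: heat_def power_mult_distrib ac_simps)
  qed
  have "emeasure (gauss s) A = (\<integral>\<^sup>+z. ennreal (heat s 0 z) * indicator A z \<partial>lborel)"
    unfolding gauss_def by (subst emeasure_density) auto
  also have "\<dots> = (\<integral>\<^sup>+z. ennreal (sqrt s ^ CARD('n)) * (ennreal (heat s 0 (sqrt s *\<^sub>R z)) * indicator A (sqrt s *\<^sub>R z)) \<partial>lborel)"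
    using s by (subst lborel_affine[of "sqrt s" 0]) (auto simp: nn_integral_density nn_integral_distr)
  also have "\<dots> = (\<integral>\<^sup>+z. ennreal (heat 1 0 z) * indicator A (sqrt s *\<^sub>R z) \<partial>lborel)"
    using s by (intro nn_integral_cong) (simp add: eq[symmetric] ennreal_mult ac_simps)
  also have "\<dots> = (\<integral>\<^sup>+z. indicator A (sqrt s *\<^sub>R z) \<partial>gauss 1)"
    by (subst nn_integral_gauss) auto
  also have "\<dots> = (\<integral>\<^sup>+z. indicator A z \<partial>distr (gauss 1) borel (\<lambda>z::real^'n. sqrt s *\<^sub>R z))"
    by (subst nn_integral_distr) auto
  finally show "emeasure (gauss s) A = emeasure (distr (gauss 1) borel (\<lambda>z::real^'n. sqrt s *\<^sub>R z)) A"
    by simp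
qed simp

lemma gauss_convolution:
  assumes s: "s > 0" and t: "t > 0" and [measurable]: "f \<in> borel_measurable borel"
  shows "(\<integral>\<^sup>+x. \<integral>\<^sup>+y. f (x + y) \<partial>gauss t \<partial>gauss s) = (\<integral>\<^sup>+z. f (z::real^'n) \<partial>gauss (s + t))"
proof -
  \<comment> \<open>The joint density of the positions at times \<open>s\<close> and
    \<open>s + t\<close>, factored into the law of the end point and the conditional law of the
    intermediate point, a Brownian bridge with mean \<open>(s / (s + t)) *\<^sub>R z\<close>. The
    latter integrates to 1 in \<open>x\<close>.\<close>
  have eq: "heat s 0 x * heat t x z = heat (s + t) 0 z * heat (s * t / (s + t)) ((s / (s + t)) *\<^sub>R z) x"
    for x z :: "real^'n"
  proof -
    have pw: "(4 * pi * s) powr a * (4 * pi * t) powr a = (4 * pi * (s + t)) powr a * (4 * pi * (s * t / (s + t))) powr a" for a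
      using s t by (subst (1 2) powr_mult[symmetric]) (auto intro!: arg_cong2[where f="(powr)"] simp: field_simps)
    have "(norm ((s / (s + t)) *\<^sub>R z - x))\<^sup>2 = (s / (s + t))\<^sup>2 * (norm z)\<^sup>2 - 2 * (s / (s + t)) * (z \<bullet> x) + (norm x)\<^sup>2"
      unfolding power2_norm_eq_inner by (simp add: inner_diff_left inner_diff_right inner_commute power2_eq_square)
    moreover have "(norm (x - z))\<^sup>2 = (norm z)\<^sup>2 - 2 * (z \<bullet> x) + (norm x)\<^sup>2"
      unfolding power2_norm_eq_inner by (simp add: inner_diff_left inner_diff_right inner_commute power2_eq_square)
    moreover have "- X / (4 * s) + - (Z - 2 * w + X) / (4 * t) =
        - Z / (4 * (s + t)) + - ((s / (s + t))\<^sup>2 * Z - 2 * (s / (s + t)) * w + X) / (4 * (s * t / (s + t)))" for X Z w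
    proof -
      have p: "s + t \<noteq> 0" using s t by simp
      have "((s / (s + t))\<^sup>2 * Z - 2 * (s / (s + t)) * w + X) / (4 * (s * t / (s + t)))
         = (s * Z / (s + t) - 2 * w) / (4 * t) + X * (s + t) / (4 * s * t)"
        using s t p by (simp add: divide_simps power2_eq_square) (simp add: algebra_simps)
      moreover have "Z / (4 * (s + t)) + s * Z / (s + t) / (4 * t) = Z / (4 * t)"
        using s t p by (simp add: divide_simps) (simp add: algebra_simps)
      moreover have "X * (s + t) / (4 * s * t) = X / (4 * s) + X / (4 * t)"
        using s t by (simp add: divide_simps) (simp add: algebra_simps)
      moreover have "(Z - 2 * w + X) / (4 * t) = Z / (4 * t) - 2 * w / (4 * t) + X / (4 * t)"
        "(s * Z / (s + t) - 2 * w) / (4 * t) = s * Z / (s + t) / (4 * t) - 2 * w / (4 * t)"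
        by (simp_all add: diff_divide_distrib add_divide_distrib)
      ultimately show ?thesis
        unfolding minus_divide_left[symmetric] by linarith
    qed
    ultimately have ex: "exp (- (norm x)\<^sup>2 / (4 * s)) * exp (- (norm (x - z))\<^sup>2 / (4 * t)) =
       exp (- (norm z)\<^sup>2 / (4 * (s + t))) * exp (- (norm ((s / (s + t)) *\<^sub>R z - x))\<^sup>2 / (4 * (s * t / (s + t))))"
      unfolding exp_add[symmetric] by metis
    from arg_cong2[where f="(*)", OF pw[of "- real CARD('n) / 2"] ex] show ?thesis
      unfolding heat_def diff_0 norm_minus_cancel by (simp only: ac_simps)
  qed
  have st: "s * t / (s + t) > 0" using s t by simp
  have "(\<integral>\<^sup>+x. \<integral>\<^sup>+y. f (x + y) \<partial>gauss t \<partial>gauss s) =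
      (\<integral>\<^sup>+x. \<integral>\<^sup>+z. ennreal (heat t x z) * f z \<partial>lborel \<partial>gauss s)"
    by (simp add: nn_integral_gauss_translate)
  also have "\<dots> = (\<integral>\<^sup>+x. \<integral>\<^sup>+z. ennreal (heat s 0 x * heat t x z) * f z \<partial>lborel \<partial>lborel)"
    by (subst nn_integral_gauss) (auto simp: nn_integral_cmult[symmetric] ennreal_mult mult.assoc)
  also have "\<dots> = (\<integral>\<^sup>+z. \<integral>\<^sup>+x. ennreal (heat s 0 x * heat t x z) * f z \<partial>lborel \<partial>lborel)"
    by (rule lborel_pair.Fubini') measurable
  also have "\<dots> = (\<integral>\<^sup>+z. \<integral>\<^sup>+x. (ennreal (heat (s + t) 0 z) * f z) * ennreal (heat (s * t / (s + t)) ((s / (s + t)) *\<^sub>R z) x) \<partial>lborel \<partial>lborel)"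
    unfolding eq by (simp add: ennreal_mult ac_simps)
  also have "\<dots> = (\<integral>\<^sup>+z. ennreal (heat (s + t) 0 z) * f z \<partial>lborel)"
    by (subst nn_integral_cmult) (auto simp: nn_integral_heat[OF st])
  also have "\<dots> = (\<integral>\<^sup>+z. f z \<partial>gauss (s + t))"
    by (rule nn_integral_gauss[symmetric]) measurable
  finally show ?thesis .
qed

text \<open>Half sum and half difference of two i.i.d. Gaussian vectors are independent, each with
  half the variance. With \<open>x\<close> an increment and \<open>y\<close> fresh noise, this
  splits the increment over an interval into those over its two halves.\<close>

lemma gauss_rotation:
  assumes s: "s > 0" and [measurable]: "case_prod G \<in> borel_measurable (borel \<Otimes>\<^sub>M borel)"
  shows "(\<integral>\<^sup>+x. \<integral>\<^sup>+y. G ((1/2) *\<^sub>R (x + y)) ((1/2) *\<^sub>R (x - y)) \<partial>gauss s \<partial>gauss s)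
    = (\<integral>\<^sup>+u. \<integral>\<^sup>+v. G u (v::real^'n) \<partial>gauss (s/2) \<partial>gauss (s/2))"
proof -
  let ?d = "CARD('n)"
  \<comment> \<open>\<open>2 ^ CARD('n)\<close> is the Jacobian of the substitution
    \<open>w = 2 u\<close> made below; the exponents match by the parallelogram law.\<close>
  have eq: "heat s 0 (u + v) * heat s 0 (u - v) * 2 ^ ?d = heat (s/2) 0 u * heat (s/2) 0 v" for u v :: "real^'n"
  proof -
    have "(2::real) ^ ?d = 2 powr (real ?d / 2) * 2 powr (real ?d / 2)"
      by (simp add: powr_realpow[symmetric] powr_add[symmetric])
    moreover have "(4 * pi * (s/2)) powr (- real ?d / 2) = (4 * pi * s) powr (- real ?d / 2) * 2 powr (real ?d / 2)"
    proof -
      have "(4 * pi * (s/2)) powr (- real ?d / 2) = (4 * pi * s) powr (- real ?d / 2) / 2 powr (- real ?d / 2)"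
        using s by (subst powr_divide[symmetric]) auto
      moreover have "2 powr (- real ?d / 2) = inverse (2 powr (real ?d / 2))"
        using powr_minus[of 2 "real ?d / 2"] by simp
      ultimately show ?thesis
        unfolding divide_inverse by (simp only: inverse_inverse_eq)
    qed
    ultimately have pw: "(4 * pi * s) powr (- real ?d / 2) * (4 * pi * s) powr (- real ?d / 2) * 2 ^ ?d
      = (4 * pi * (s/2)) powr (- real ?d / 2) * (4 * pi * (s/2)) powr (- real ?d / 2)"
      by simp
    have "(norm (u + v))\<^sup>2 + (norm (u - v))\<^sup>2 = 2 * (norm u)\<^sup>2 + 2 * (norm v)\<^sup>2"
      unfolding power2_norm_eq_inner by (simp add: inner_diff_left inner_diff_right inner_add_left inner_add_right inner_commute)
    then have "- ((norm (u + v))\<^sup>2 + (norm (u - v))\<^sup>2) / (4 * s) = - (2 * (norm u)\<^sup>2 + 2 * (norm v)\<^sup>2) / (4 * s)"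
      by simp
    then have "- (norm (u + v))\<^sup>2 / (4 * s) + - (norm (u - v))\<^sup>2 / (4 * s) = - (norm u)\<^sup>2 / (4 * (s/2)) + - (norm v)\<^sup>2 / (4 * (s/2))"
      using s by (simp add: add_divide_distrib diff_divide_distrib)
    then have ex: "exp (- (norm (u + v))\<^sup>2 / (4 * s)) * exp (- (norm (u - v))\<^sup>2 / (4 * s))
       = exp (- (norm u)\<^sup>2 / (4 * (s/2))) * exp (- (norm v)\<^sup>2 / (4 * (s/2)))"
      unfolding exp_add[symmetric] by simp
    from arg_cong2[where f="(*)", OF pw ex] show ?thesis
      unfolding heat_def diff_0 norm_minus_cancel by (simp only: ac_simps)
  qed
  have "(\<integral>\<^sup>+x. \<integral>\<^sup>+y. G ((1/2) *\<^sub>R (x + y)) ((1/2) *\<^sub>R (x - y)) \<partial>gauss s \<partial>gauss s)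
    = (\<integral>\<^sup>+x. \<integral>\<^sup>+y. ennreal (heat s 0 x * heat s 0 y) * G ((1/2) *\<^sub>R (x + y)) ((1/2) *\<^sub>R (x - y)) \<partial>lborel \<partial>lborel)"
    by (simp add: nn_integral_gauss nn_integral_cmult[symmetric] ennreal_mult mult.assoc)
  also have "\<dots> = (\<integral>\<^sup>+x. \<integral>\<^sup>+w. ennreal (heat s 0 x * heat s 0 (w - x)) * G ((1/2) *\<^sub>R w) ((1/2) *\<^sub>R (2 *\<^sub>R x - w)) \<partial>lborel \<partial>lborel)"
  proof (rule nn_integral_cong)
    fix x :: "real^'n"
    show "(\<integral>\<^sup>+y. ennreal (heat s 0 x * heat s 0 y) * G ((1/2) *\<^sub>R (x + y)) ((1/2) *\<^sub>R (x - y)) \<partial>lborel)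
      = (\<integral>\<^sup>+w. ennreal (heat s 0 x * heat s 0 (w - x)) * G ((1/2) *\<^sub>R w) ((1/2) *\<^sub>R (2 *\<^sub>R x - w)) \<partial>lborel)"
      by (subst nn_integral_lborel_translate[where a=x and f="\<lambda>w. ennreal (heat s 0 x * heat s 0 (w - x)) * G ((1/2) *\<^sub>R w) ((1/2) *\<^sub>R (2 *\<^sub>R x - w))", symmetric])
         (auto simp: algebra_simps scaleR_2)
  qed
  also have "\<dots> = (\<integral>\<^sup>+w. \<integral>\<^sup>+x. ennreal (heat s 0 x * heat s 0 (w - x)) * G ((1/2) *\<^sub>R w) ((1/2) *\<^sub>R (2 *\<^sub>R x - w)) \<partial>lborel \<partial>lborel)"
    by (rule lborel_pair.Fubini') measurable
  also have "\<dots> = (\<integral>\<^sup>+w. \<integral>\<^sup>+v. ennreal (heat s 0 ((1/2) *\<^sub>R w + v) * heat s 0 ((1/2) *\<^sub>R w - v)) * G ((1/2) *\<^sub>R w) v \<partial>lborel \<partial>lborel)"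
  proof (rule nn_integral_cong)
    fix w :: "real^'n"
    have "w - (x + (1/2) *\<^sub>R w) = (1/2) *\<^sub>R w - x" "(1/2) *\<^sub>R (2 *\<^sub>R (x + (1/2) *\<^sub>R w) - w) = x" for x :: "real^'n"
      by (simp_all add: vec_eq_iff algebra_simps)
    note wx = this
    show "(\<integral>\<^sup>+x. ennreal (heat s 0 x * heat s 0 (w - x)) * G ((1/2) *\<^sub>R w) ((1/2) *\<^sub>R (2 *\<^sub>R x - w)) \<partial>lborel)
      = (\<integral>\<^sup>+v. ennreal (heat s 0 ((1/2) *\<^sub>R w + v) * heat s 0 ((1/2) *\<^sub>R w - v)) * G ((1/2) *\<^sub>R w) v \<partial>lborel)"
      by (subst nn_integral_lborel_translate[where a="(1/2) *\<^sub>R w", symmetric])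
         (measurable, simp only: wx, simp only: add.commute)
  qed
  also have "\<dots> = (\<integral>\<^sup>+u. ennreal (2 ^ ?d) * (\<integral>\<^sup>+v. ennreal (heat s 0 (u + v) * heat s 0 (u - v)) * G u v \<partial>lborel) \<partial>lborel)"
    by (subst lborel_affine[of 2 "0::real^'n"]) (simp_all add: nn_integral_density nn_integral_distr)
  also have "\<dots> = (\<integral>\<^sup>+u. \<integral>\<^sup>+v. ennreal (heat (s/2) 0 u * heat (s/2) 0 v) * G u v \<partial>lborel \<partial>lborel)"
    by (simp add: nn_integral_cmult[symmetric] eq[symmetric] ennreal_mult ac_simps)
  also have "\<dots> = (\<integral>\<^sup>+u. \<integral>\<^sup>+v. G u (v::real^'n) \<partial>gauss (s/2) \<partial>gauss (s/2))"
    by (simp add: nn_integral_gauss nn_integral_cmult[symmetric] ennreal_mult mult.assoc)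
  finally show ?thesis .
qed

section \<open>Radial WKB functions\<close>

text \<open>The variable is \<open>r = |x|^2\<close> and not \<open>|x|\<close>, so that
  \<open>|x + z|^2 - |x|^2\<close> is a polynomial in \<open>z\<close>. In use are
  \<open>c = sqrt \<kappa> / \<beta>\<close> and \<open>g = \<beta> / 2\<close>. Since
  \<open>0 powr a = 0\<close>, the value at the origin is 0 for every \<open>a\<close>.\<close>

definition wkb :: "real \<Rightarrow> real \<Rightarrow> real \<Rightarrow> real \<Rightarrow> real" where
  "wkb c g a r = r powr a * exp (- c * r powr (- g))"

lemma wkb_nonneg [simp]: "0 \<le> wkb c g a r"
  by (simp add: wkb_def)

lemma wkb_pos: "r > 0 \<Longrightarrow> 0 < wkb c g a r"
  by (simp add: wkb_def)

lemma wkb_measurable [measurable]: "wkb c g a \<in> borel_measurable borel"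
  unfolding wkb_def by measurable

lemma wkb_shift: "r > 0 \<Longrightarrow> wkb c g (a + e) r = r powr e * wkb c g a r"
  by (simp add: wkb_def powr_add)

lemma wkb_deriv:
  assumes "r > 0"
  shows "(wkb c g a has_real_derivative a * wkb c g (a - 1) r + c * g * wkb c g (a - g - 1) r) (at r)"
proof -
  have "(wkb c g a has_real_derivative
      a * r powr (a - 1) * exp (- c * r powr (- g)) + r powr a * (exp (- c * r powr (- g)) * (- c * (- g * r powr (- g - 1))))) (at r)"
    unfolding wkb_def using assms
    by (auto intro!: derivative_eq_intros simp: algebra_simps)
  moreover have pw: "r powr (a - g - 1) = r powr a * r powr (- g - 1)"
    by (subst powr_add[symmetric]) (simp add: algebra_simps)
  have "a * r powr (a - 1) * exp (- c * r powr (- g)) + r powr a * (exp (- c * r powr (- g)) * (- c * (- g * r powr (- g - 1))))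
      = a * wkb c g (a - 1) r + c * g * wkb c g (a - g - 1) r"
    unfolding wkb_def pw by (simp add: algebra_simps)
  ultimately show ?thesis by (simp only:)
qed

text \<open>This is \<open>t \<le> exp t\<close> at \<open>t = c * y / (m + 1)\<close>, raised to
  the power \<open>m + 1\<close>.\<close>

lemma power_le_exp:
  fixes y c :: real
  assumes "y \<ge> 0" "c > 0"
  shows "y ^ Suc m \<le> (real (Suc m) / c) ^ Suc m * exp (c * y)"
proof -
  have "c * y / real (Suc m) \<le> exp (c * y / real (Suc m))"
    using exp_ge_add_one_self[of "c * y / real (Suc m)"] by linarith
  then have "(c * y / real (Suc m)) ^ Suc m \<le> exp (c * y / real (Suc m)) ^ Suc m"
    using assms by (intro power_mono) auto
  also have "exp (c * y / real (Suc m)) ^ Suc m = exp (c * y)"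
    by (simp add: exp_of_nat_mult[symmetric] del: power_Suc of_nat_Suc)
  finally have "(real (Suc m) / c) ^ Suc m * (c * y / real (Suc m)) ^ Suc m \<le> (real (Suc m) / c) ^ Suc m * exp (c * y)"
    using assms by (intro mult_left_mono) auto
  moreover have "(real (Suc m) / c) * (c * y / real (Suc m)) = y"
    using assms by simp
  ultimately show ?thesis
    by (simp only: power_mult_distrib[symmetric])
qed

text \<open>For \<open>r \<ge> 1\<close> only the power matters. Near 0 a negative power of
  \<open>r\<close> is dominated by a power of \<open>r powr (- g)\<close>, which the exponential
  absorbs. The exponent \<open>a\<close> may thus have either sign, so the bound also serves the
  derivatives.\<close>

lemma wkb_poly_bound:
  assumes c: "c > 0" and g: "g > 0"
  obtains C N where "C \<ge> 0" "\<And>r. r > 0 \<Longrightarrow> wkb c g a r \<le> C * (1 + r) ^ N"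
proof -
  obtain m :: nat where m: "real m \<ge> - a / g" using real_arch_simple by blast
  obtain N :: nat where N: "real N \<ge> a" using real_arch_simple by blast
  define C where "C = (real (Suc m) / c) ^ Suc m + 1"
  have C: "C \<ge> 1" using c by (simp add: C_def)
  have "wkb c g a r \<le> C * (1 + r) ^ N" if r: "r > 0" for r
  proof (cases "r \<ge> 1")
    case True
    have "wkb c g a r \<le> r powr a * 1"
      unfolding wkb_def using c by (intro mult_left_mono) auto
    also have "\<dots> \<le> r powr real N" using True N by (simp add: powr_mono)
    also have "\<dots> \<le> (1 + r) ^ N" using r by (simp add: powr_realpow power_mono)
    also have "\<dots> \<le> C * (1 + r) ^ N" using C r mult_right_mono[of 1 C "(1 + r) ^ N"] by simp
    finally show ?thesis .
  next
    case False
    define y where "y = r powr (- g)"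
    have "- (g * real (Suc m)) \<le> a" using m g by (simp add: field_simps)
    then have "r powr a \<le> r powr (- (g * real (Suc m)))"
      using False r by (intro powr_mono') auto
    also have "\<dots> = y ^ Suc m"
      using r by (simp add: y_def powr_realpow[symmetric] powr_powr del: power_Suc of_nat_Suc)
    also have "\<dots> \<le> (real (Suc m) / c) ^ Suc m * exp (c * y)"
      using c by (intro power_le_exp) (auto simp: y_def)
    finally have "wkb c g a r \<le> ((real (Suc m) / c) ^ Suc m * exp (c * y)) * exp (- c * y)"
      unfolding wkb_def y_def by (intro mult_right_mono) auto
    also have "\<dots> = (real (Suc m) / c) ^ Suc m"
      by (simp add: exp_minus field_simps del: power_Suc)
    also have "\<dots> \<le> C" by (simp add: C_def)
    also have "C \<le> C * (1 + r) ^ N"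
      using C r mult_left_mono[of 1 "(1 + r) ^ N" C] by simp
    finally show ?thesis .
  qed
  with C show thesis by (intro that[of C N]) auto
qed

text \<open>What a second order Taylor expansion under a Gaussian integral requires: derivatives are
  demanded only for \<open>r > 0\<close>, but the growth bounds are uniform down to
  \<open>r = 0\<close>, so the remainder stays controlled when \<open>x + z\<close> comes close to
  the origin.\<close>

definition tame :: "(real \<Rightarrow> real) \<Rightarrow> (real \<Rightarrow> real) \<Rightarrow> (real \<Rightarrow> real) \<Rightarrow> bool" where
  "tame F F1 F2 \<longleftrightarrow> F \<in> borel_measurable borel \<and>
     (\<exists>F3 C N. C \<ge> 0 \<and> (\<forall>r>0. (F has_real_derivative F1 r) (at r) \<and> (F1 has_real_derivative F2 r) (at r) \<and>
        (F2 has_real_derivative F3 r) (at r) \<and>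
        \<bar>F r\<bar> \<le> C * (1 + r) ^ N \<and> \<bar>F1 r\<bar> \<le> C * (1 + r) ^ N \<and> \<bar>F2 r\<bar> \<le> C * (1 + r) ^ N \<and> \<bar>F3 r\<bar> \<le> C * (1 + r) ^ N))"

definition poly_bdd :: "(real \<Rightarrow> real) \<Rightarrow> bool" where
  "poly_bdd F \<longleftrightarrow> (\<exists>C N. C \<ge> 0 \<and> (\<forall>r>0. \<bar>F r\<bar> \<le> C * (1 + r) ^ N))"

lemma poly_bdd_wkb: "c > 0 \<Longrightarrow> g > 0 \<Longrightarrow> poly_bdd (wkb c g a)"
  by (rule wkb_poly_bound[of c g a]) (auto simp: poly_bdd_def)

lemma poly_bdd_cmult: "poly_bdd F \<Longrightarrow> poly_bdd (\<lambda>r. k * F r)"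
proof -
  assume "poly_bdd F"
  then obtain C N where C: "C \<ge> 0" "\<And>r. r > 0 \<Longrightarrow> \<bar>F r\<bar> \<le> C * (1 + r) ^ N"
    by (auto simp: poly_bdd_def)
  have "\<bar>k * F r\<bar> \<le> (\<bar>k\<bar> * C) * (1 + r) ^ N" if "r > 0" for r
    using mult_left_mono[OF C(2)[OF that], of "\<bar>k\<bar>"] by (simp add: abs_mult mult.assoc)
  then show ?thesis using C(1) by (auto simp: poly_bdd_def intro!: exI[of _ "\<bar>k\<bar> * C"])
qed

lemma poly_bound_mono:
  fixes r C D :: real
  assumes "r > 0" "N \<le> M" "0 \<le> C" "C \<le> D" "x \<le> C * (1 + r) ^ N"
  shows "x \<le> D * (1 + r) ^ M"
proof -
  have "C * (1 + r) ^ N \<le> D * (1 + r) ^ M"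
    using assms by (intro mult_mono power_increasing) auto
  with assms(5) show ?thesis by linarith
qed

lemma poly_bdd_add:
  assumes "poly_bdd F" "poly_bdd G"
  shows "poly_bdd (\<lambda>r. F r + G r)"
proof -
  obtain C N where C: "C \<ge> 0" "\<And>r. r > 0 \<Longrightarrow> \<bar>F r\<bar> \<le> C * (1 + r) ^ N"
    using assms(1) by (auto simp: poly_bdd_def)
  obtain D M where D: "D \<ge> 0" "\<And>r. r > 0 \<Longrightarrow> \<bar>G r\<bar> \<le> D * (1 + r) ^ M"
    using assms(2) by (auto simp: poly_bdd_def)
  have "\<bar>F r + G r\<bar> \<le> (C + D) * (1 + r) ^ max N M" if "r > 0" for r
    using poly_bound_mono[OF that _ _ _ C(2)[OF that], of "max N M" C]
      poly_bound_mono[OF that _ _ _ D(2)[OF that], of "max N M" D] C(1) D(1)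
    by (simp add: distrib_right)
  then show ?thesis using C(1) D(1) by (auto simp: poly_bdd_def intro!: exI[of _ "C + D"])
qed

lemma tameI:
  assumes "F \<in> borel_measurable borel"
    and d: "\<And>r. r > 0 \<Longrightarrow> (F has_real_derivative F1 r) (at r)"
      "\<And>r. r > 0 \<Longrightarrow> (F1 has_real_derivative F2 r) (at r)"
      "\<And>r. r > 0 \<Longrightarrow> (F2 has_real_derivative F3 r) (at r)"
    and p: "poly_bdd F" "poly_bdd F1" "poly_bdd F2" "poly_bdd F3"
  shows "tame F F1 F2"
proof -
  have "poly_bdd (\<lambda>r. \<bar>H r\<bar>)" if "poly_bdd H" for H using that by (simp add: poly_bdd_def)
  then have "poly_bdd (\<lambda>r. (\<bar>F r\<bar> + \<bar>F1 r\<bar>) + (\<bar>F2 r\<bar> + \<bar>F3 r\<bar>))"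
    by (intro poly_bdd_add p) (auto intro: p)
  then obtain C N where C: "C \<ge> 0" "\<And>r. r > 0 \<Longrightarrow> \<bar>(\<bar>F r\<bar> + \<bar>F1 r\<bar>) + (\<bar>F2 r\<bar> + \<bar>F3 r\<bar>)\<bar> \<le> C * (1 + r) ^ N"
    by (auto simp: poly_bdd_def)
  have "\<bar>F r\<bar> \<le> C * (1 + r) ^ N \<and> \<bar>F1 r\<bar> \<le> C * (1 + r) ^ N \<and> \<bar>F2 r\<bar> \<le> C * (1 + r) ^ N \<and> \<bar>F3 r\<bar> \<le> C * (1 + r) ^ N" if "r > 0" for r
    using C(2)[OF that] by linarith
  with C(1) assms(1) d show ?thesis
    unfolding tame_def by (intro conjI exI[of _ F3] exI[of _ C] exI[of _ N]) auto
qed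

text \<open>Differentiation only shifts exponents within the family \<open>wkb\<close>, so the
  growth bounds of all three derivatives come for free.\<close>

definition wkb1 :: "real \<Rightarrow> real \<Rightarrow> real \<Rightarrow> real \<Rightarrow> real" where
  "wkb1 c g a r = a * wkb c g (a - 1) r + (c * g) * wkb c g (a - g - 1) r"

definition wkb2 :: "real \<Rightarrow> real \<Rightarrow> real \<Rightarrow> real \<Rightarrow> real" where
  "wkb2 c g a r = a * wkb1 c g (a - 1) r + (c * g) * wkb1 c g (a - g - 1) r"

definition wkb3 :: "real \<Rightarrow> real \<Rightarrow> real \<Rightarrow> real \<Rightarrow> real" where
  "wkb3 c g a r = a * wkb2 c g (a - 1) r + (c * g) * wkb2 c g (a - g - 1) r"

lemma tame_wkb_combination:
  assumes c: "c > 0" and g: "g > 0"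
  shows "tame (\<lambda>r. wkb c g a r + k * wkb c g b r)
    (\<lambda>r. wkb1 c g a r + k * wkb1 c g b r) (\<lambda>r. wkb2 c g a r + k * wkb2 c g b r)"
proof (rule tameI[where ?F3.0 = "\<lambda>r. wkb3 c g a r + k * wkb3 c g b r"])
  show "(\<lambda>r. wkb c g a r + k * wkb c g b r) \<in> borel_measurable borel" by measurable
  have 0: "poly_bdd (wkb c g a)" for a using poly_bdd_wkb[OF c g] .
  have 1: "poly_bdd (wkb1 c g a)" for a
    unfolding wkb1_def[abs_def] by (intro poly_bdd_add poly_bdd_cmult 0)
  have 2: "poly_bdd (wkb2 c g a)" for a
    unfolding wkb2_def[abs_def] by (intro poly_bdd_add poly_bdd_cmult 1)
  have 3: "poly_bdd (wkb3 c g a)" for a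
    unfolding wkb3_def[abs_def] by (intro poly_bdd_add poly_bdd_cmult 2)
  show "poly_bdd (\<lambda>r. wkb c g a r + k * wkb c g b r)" "poly_bdd (\<lambda>r. wkb1 c g a r + k * wkb1 c g b r)"
    "poly_bdd (\<lambda>r. wkb2 c g a r + k * wkb2 c g b r)" "poly_bdd (\<lambda>r. wkb3 c g a r + k * wkb3 c g b r)"
    by (intro poly_bdd_add poly_bdd_cmult 0 1 2 3)+
  fix r :: real assume r: "r > 0"
  have d0: "(wkb c g a has_real_derivative wkb1 c g a r) (at r)" for a
    using wkb_deriv[OF r] by (simp add: wkb1_def)
  have d1: "(wkb1 c g a has_real_derivative wkb2 c g a r) (at r)" for a
    unfolding wkb1_def[of c g a, abs_def] wkb2_def by (intro DERIV_add DERIV_cmult d0)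
  have d2: "(wkb2 c g a has_real_derivative wkb3 c g a r) (at r)" for a
    unfolding wkb2_def[of c g a, abs_def] wkb3_def by (intro DERIV_add DERIV_cmult d1)
  show "((\<lambda>r. wkb c g a r + k * wkb c g b r) has_real_derivative wkb1 c g a r + k * wkb1 c g b r) (at r)"
    "((\<lambda>r. wkb1 c g a r + k * wkb1 c g b r) has_real_derivative wkb2 c g a r + k * wkb2 c g b r) (at r)"
    "((\<lambda>r. wkb2 c g a r + k * wkb2 c g b r) has_real_derivative wkb3 c g a r + k * wkb3 c g b r) (at r)"
    by (intro DERIV_add DERIV_cmult d0 d1 d2)+
qed

text \<open>The quotient (Delta u)/u of the radial function u(x) = \<open>wkb c g a r\<close>,
  \<open>r = |x|^2\<close>, in dimension \<open>d\<close>, because Delta F(|x|^2) = 2 d F'(r) + 4 r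
  F''(r). The leading coefficient is independent of \<open>a\<close>; the middle one is affine in
  \<open>a\<close> with slope \<open>8 * c * g\<close>.\<close>

definition wkbQ :: "real \<Rightarrow> real \<Rightarrow> real \<Rightarrow> real \<Rightarrow> real \<Rightarrow> real" where
  "wkbQ d c g a r = 4 * (c * g)\<^sup>2 * r powr (- 2 * g - 1) + c * g * (2 * d + 4 * (2 * a - g - 1)) * r powr (- g - 1)
     + a * (2 * d + 4 * (a - 1)) * r powr (- 1)"

lemma wkb_radial_laplacian:
  assumes r: "r > 0"
  shows "2 * d * wkb1 c g a r + 4 * r * wkb2 c g a r = wkbQ d c g a r * wkb c g a r"
proof -
  have s: "wkb c g (a + e) r = r powr e * wkb c g a r" for e by (rule wkb_shift[OF r])
  have s1: "wkb c g (a - 1) r = r powr (-1) * wkb c g a r"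
    "wkb c g (a - g - 1) r = r powr (- g - 1) * wkb c g a r"
    "wkb c g (a - 1 - 1) r = r powr (-2) * wkb c g a r"
    "wkb c g (a - 1 - g - 1) r = r powr (- g - 2) * wkb c g a r"
    "wkb c g (a - g - 1 - 1) r = r powr (- g - 2) * wkb c g a r"
    "wkb c g (a - g - 1 - g - 1) r = r powr (- 2 * g - 2) * wkb c g a r"
    using s[of "-1"] s[of "- g - 1"] s[of "-2"] s[of "- g - 2"] s[of "- 2 * g - 2"] by (simp_all add: algebra_simps)
  have m: "r * r powr e = r powr f" if "f = e + 1" for e f using r that by (simp add: powr_add)
  have m1: "r * r powr (-2) = r powr (-1)" "r * r powr (- g - 2) = r powr (- g - 1)"
    "r * r powr (- 2 * g - 2) = r powr (- 2 * g - 1)"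
    by (rule m; simp)+
  define p where "p = r powr (-1)"
  define q where "q = r powr (- g - 1)"
  define v where "v = r powr (- 2 * g - 1)"
  have "4 * r * wkb2 c g a r = 4 * (a * ((a - 1) * (r * r powr (-2)) + c * g * (r * r powr (- g - 2)))
     + c * g * ((a - g - 1) * (r * r powr (- g - 2)) + c * g * (r * r powr (- 2 * g - 2)))) * wkb c g a r"
    unfolding wkb2_def wkb1_def s1 by (simp add: algebra_simps)
  then have "4 * r * wkb2 c g a r = 4 * (a * ((a - 1) * p + c * g * q) + c * g * ((a - g - 1) * q + c * g * v)) * wkb c g a r"
    unfolding m1 p_def q_def v_def .
  moreover have "wkb1 c g a r = (a * p + c * g * q) * wkb c g a r"
    unfolding wkb1_def s1(1,2) p_def q_def by (simp only: distrib_right mult.assoc)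
  ultimately show ?thesis
    unfolding wkbQ_def p_def[symmetric] q_def[symmetric] v_def[symmetric] by (simp add: algebra_simps power2_eq_square)
qed

text \<open>Near 0 the power \<open>- g - 1\<close> beats the power \<open>- 1\<close>, and away
  from 0 the sum is at least \<open>- |e| / r0\<close>. The global bound is absorbed into the rate
  of the sub- or supersolution; the sign near 0 serves where the term is multiplied by something not
  dominated by the subsolution.\<close>

lemma singular_lower_bound:
  fixes A e g :: real
  assumes A: "A > 0" and g: "g > 0"
  obtains l r0 where "l \<ge> 0" "r0 > 0" "\<And>r. r > 0 \<Longrightarrow> - l \<le> A * r powr (- g - 1) + e * r powr (- 1)"
    "\<And>r. 0 < r \<Longrightarrow> r \<le> r0 \<Longrightarrow> 0 \<le> A * r powr (- g - 1) + e * r powr (- 1)"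
proof -
  \<comment> \<open>Chosen so that \<open>r0 powr g = A / (|e| + 1)\<close>; the \<open>+ 1\<close>
    covers \<open>e = 0\<close>.\<close>
  define r0 where "r0 = (A / (\<bar>e\<bar> + 1)) powr (1 / g)"
  have r0: "r0 > 0" using A by (simp add: r0_def)
  have r0g: "r0 powr g = A / (\<bar>e\<bar> + 1)"
    using A g by (simp add: r0_def powr_powr)
  have eq: "A * r powr (- g - 1) + e * r powr (- 1) = (A * r powr (- g) + e) / r" if "r > 0" for r
    using that by (simp add: powr_diff powr_minus field_simps)
  have small: "0 \<le> A * r powr (- g - 1) + e * r powr (- 1)" if r: "0 < r" "r \<le> r0" for r
  proof -
    have "r powr g \<le> A / (\<bar>e\<bar> + 1)"
      using r g r0g by (metis less_eq_real_def powr_mono2)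
    then have "r powr g * (\<bar>e\<bar> + 1) \<le> A"
      by (simp add: pos_le_divide_eq)
    then have "(r powr g * (\<bar>e\<bar> + 1)) * r powr (- g) \<le> A * r powr (- g)"
      by (intro mult_right_mono) auto
    moreover have "(r powr g * (\<bar>e\<bar> + 1)) * r powr (- g) = \<bar>e\<bar> + 1"
      using r by (simp add: powr_minus field_simps)
    ultimately have "0 \<le> A * r powr (- g) + e" by linarith
    then show ?thesis unfolding eq[OF r(1)] using r by simp
  qed
  have "- (\<bar>e\<bar> / r0) \<le> A * r powr (- g - 1) + e * r powr (- 1)" if r: "r > 0" for r
  proof (cases "r \<le> r0")
    case True
    have "- (\<bar>e\<bar> / r0) \<le> 0" using r0 by simp
    with small[OF r True] show ?thesis by linarith
  next
    case False
    have "- (\<bar>e\<bar> / r0) \<le> - \<bar>e\<bar> / r" using False r0 by (simp add: frac_le)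
    also have "\<dots> \<le> (A * r powr (- g) + e) / r"
      using A r by (intro divide_right_mono) (auto intro: order_trans[of _ e])
    finally show ?thesis unfolding eq[OF r] .
  qed
  with r0 small show thesis by (intro that[of "\<bar>e\<bar> / r0" r0]) auto
qed

section \<open>Second order expansion of the heat semigroup\<close>

text \<open>An eigenfunction of every heat operator that dominates all powers of the norm.\<close>

definition lyap :: "real^'n \<Rightarrow> real" where
  "lyap x = (\<Sum>b\<in>Basis. exp (b \<bullet> x) + exp (- b \<bullet> x))"

lemma lyap_nonneg [simp]: "0 \<le> lyap x"
  unfolding lyap_def by (intro sum_nonneg) (simp add: add_nonneg_nonneg)

lemma lyap_measurable [measurable]: "lyap \<in> borel_measurable borel"
  unfolding lyap_def by measurable

lemma lyap_gauss:
  assumes s: "s > 0"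
  shows "has_bochner_integral (gauss s) (\<lambda>z. lyap (x + z)) (exp s * lyap x)"
proof -
  have "has_bochner_integral (gauss s) (\<lambda>z. \<Sum>b\<in>Basis. exp (b \<bullet> x) * exp (b \<bullet> z) + exp (- b \<bullet> x) * exp ((- b) \<bullet> z))
      (\<Sum>b\<in>Basis. exp (b \<bullet> x) * exp (s * (norm b)\<^sup>2) + exp (- b \<bullet> x) * exp (s * (norm (- b))\<^sup>2))"
    by (intro has_bochner_integral_sum has_bochner_integral_add has_bochner_integral_mult_right gauss_exp_moment(2) s)
  moreover have "(\<lambda>z. \<Sum>b\<in>Basis. exp (b \<bullet> x) * exp (b \<bullet> z) + exp (- b \<bullet> x) * exp ((- b) \<bullet> z)) = (\<lambda>z. lyap (x + z))"
    unfolding lyap_def by (simp add: exp_add[symmetric] inner_add_right)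
  moreover have "(\<Sum>b\<in>Basis. exp (b \<bullet> x) * exp (s * (norm b)\<^sup>2) + exp (- b \<bullet> x) * exp (s * (norm (- b))\<^sup>2)) = exp s * lyap x"
    unfolding lyap_def sum_distrib_left by (intro sum.cong) (auto simp: algebra_simps)
  ultimately show ?thesis by simp
qed

text \<open>Some coordinate has modulus at least \<open>norm x / d\<close>, so
  \<open>exp (norm x / d)\<close> is below \<open>lyap x\<close>, and an exponential dominates every
  power.\<close>

lemma lyap_poly:
  obtains K where "K > 0" "\<And>x::real^'n. (1 + norm x) ^ m \<le> K * lyap x"
proof -
  define d where "d = real CARD('n)"
  have d: "d \<ge> 1" by (simp add: d_def)
  define K where "K = (real (Suc m) / (1/d)) ^ Suc m * exp (1/d)"
  have K: "K > 0" using d by (simp add: K_def)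
  have "(1 + norm x) ^ m \<le> K * lyap x" for x :: "real^'n"
  proof -
    have "\<exists>b\<in>Basis. norm x / d \<le> \<bar>b \<bullet> x\<bar>"
    proof (rule ccontr)
      assume "\<not> ?thesis"
      then have "(\<Sum>b\<in>Basis. \<bar>x \<bullet> b\<bar>) < (\<Sum>b\<in>(Basis::(real^'n) set). norm x / d)"
        by (intro sum_strict_mono) (auto simp: inner_commute not_le)
      also have "\<dots> = norm x" using d by (simp add: d_def)
      finally show False using norm_le_l1[of x] by simp
    qed
    then obtain b :: "real^'n" where b: "b \<in> Basis" "norm x / d \<le> \<bar>b \<bullet> x\<bar>" by blast
    have "exp (norm x / d) \<le> exp (b \<bullet> x) + exp (- b \<bullet> x)"
      using b(2) by (smt (verit) exp_le_cancel_iff exp_gt_zero inner_minus_left)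
    also have "\<dots> \<le> lyap x"
      unfolding lyap_def by (rule member_le_sum[OF b(1)]) (auto simp: add_nonneg_nonneg)
    finally have l: "exp (norm x / d) \<le> lyap x" .
    have "(1 + norm x) ^ m \<le> (1 + norm x) ^ Suc m" by (intro power_increasing) auto
    also have "\<dots> \<le> (real (Suc m) / (1/d)) ^ Suc m * exp (1/d * (1 + norm x))"
      using d by (intro power_le_exp) auto
    also have "\<dots> = K * exp (norm x / d)"
      by (simp add: K_def exp_add[symmetric] add_divide_distrib del: power_Suc)
    also have "\<dots> \<le> K * lyap x" using l K by (intro mult_left_mono) auto
    finally show ?thesis .
  qed
  with K show thesis by (rule that)
qed

lemma gauss_poly_integrable:
  assumes s: "s > 0"
  shows "integrable (gauss s) (\<lambda>z::real^'n. (1 + norm z) ^ m)"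
proof -
  obtain K where K: "K > 0" "\<And>x::real^'n. (1 + norm x) ^ m \<le> K * lyap x"
    using lyap_poly[of m] by blast
  have "integrable (gauss s) (\<lambda>z::real^'n. K * lyap z)"
    using lyap_gauss[OF s, of 0] by (auto simp: has_bochner_integral_iff)
  then show ?thesis
    by (rule Bochner_Integration.integrable_bound) (use K in \<open>auto intro!: AE_I2 order_trans[OF K(2)]\<close>)
qed

text \<open>Scaling by \<open>sqrt s\<close> extracts \<open>s powr (3/2)\<close> from the cube, and
  for \<open>s \<le> 1\<close> it only decreases the polynomial factor.\<close>

lemma gauss_cubic_moment:
  obtains K where "K \<ge> 0" "\<And>s. 0 < s \<Longrightarrow> s \<le> 1 \<Longrightarrow>
     integrable (gauss s) (\<lambda>z::real^'n. (1 + norm z) ^ m * norm z ^ 3) \<and>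
     (\<integral>z. (1 + norm z) ^ m * norm z ^ 3 \<partial>(gauss s :: (real^'n) measure)) \<le> K * s powr (3/2)"
proof -
  define K where "K = (\<integral>z. (1 + norm z) ^ m * norm z ^ 3 \<partial>(gauss 1 :: (real^'n) measure))"
  have int: "integrable (gauss s) (\<lambda>z::real^'n. (1 + norm z) ^ m * norm z ^ 3)" if s: "s > 0" for s
  proof (rule Bochner_Integration.integrable_bound[OF gauss_poly_integrable[OF s, of "m + 3"]])
    show "AE z in gauss s. norm ((1 + norm (z::real^'n)) ^ m * norm z ^ 3) \<le> norm ((1 + norm z) ^ (m + 3))"
      by (intro AE_I2) (simp add: power_add mult_left_mono power_mono abs_mult)
  qed simp
  have "integrable (gauss s) (\<lambda>z::real^'n. (1 + norm z) ^ m * norm z ^ 3) \<and>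
     (\<integral>z. (1 + norm z) ^ m * norm z ^ 3 \<partial>(gauss s :: (real^'n) measure)) \<le> K * s powr (3/2)"
    if s: "0 < s" "s \<le> 1" for s
  proof (intro conjI int s)
    have ss: "sqrt s ^ 3 = s powr (3/2)"
      using s by (simp add: powr_half_sqrt[symmetric] powr_realpow[symmetric] powr_powr)
    have i1: "integrable (gauss 1) (\<lambda>z::real^'n. (1 + norm (sqrt s *\<^sub>R z)) ^ m * norm (sqrt s *\<^sub>R z) ^ 3)"
      using int[OF s(1)] unfolding gauss_scale[OF s(1)] by (subst (asm) integrable_distr_eq) auto
    have "(\<integral>z. (1 + norm z) ^ m * norm z ^ 3 \<partial>(gauss s :: (real^'n) measure))
       = (\<integral>z. (1 + norm (sqrt s *\<^sub>R z)) ^ m * norm (sqrt s *\<^sub>R z) ^ 3 \<partial>(gauss 1 :: (real^'n) measure))"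
      unfolding gauss_scale[OF s(1)] by (subst integral_distr) auto
    also have "\<dots> \<le> (\<integral>z. s powr (3/2) * ((1 + norm z) ^ m * norm z ^ 3) \<partial>(gauss 1 :: (real^'n) measure))"
    proof (intro integral_mono i1 integrable_mult_right int)
      fix z :: "real^'n"
      have "norm (sqrt s *\<^sub>R z) \<le> norm z" using s by (simp add: mult_left_le_one_le)
      then have le: "(1 + norm (sqrt s *\<^sub>R z)) ^ m * norm (sqrt s *\<^sub>R z) ^ 3 \<le> (1 + norm z) ^ m * norm (sqrt s *\<^sub>R z) ^ 3"
        by (intro mult_right_mono power_mono) auto
      have eq: "norm (sqrt s *\<^sub>R z) ^ 3 = s powr (3/2) * norm z ^ 3"
        using s by (simp add: power_mult_distrib ss)
      show "(1 + norm (sqrt s *\<^sub>R z)) ^ m * norm (sqrt s *\<^sub>R z) ^ 3 \<le> s powr (3/2) * ((1 + norm z) ^ m * norm z ^ 3)"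
        using le unfolding eq by (simp only: ac_simps)
    qed simp
    also have "\<dots> = K * s powr (3/2)" by (simp add: K_def)
    finally show "(\<integral>z. (1 + norm z) ^ m * norm z ^ 3 \<partial>(gauss s :: (real^'n) measure)) \<le> K * s powr (3/2)" .
  qed
  moreover have "K \<ge> 0" unfolding K_def by (intro integral_nonneg_AE) auto
  ultimately show thesis by (rule that[rotated])
qed

text \<open>Valid for either order of \<open>r\<close> and \<open>r'\<close>. The intermediate point
  lies below \<open>r + r'\<close>, which turns the growth of the third derivative into a polynomial
  in the end points; the factor 1/6 is given away.\<close>

lemma taylor3:
  fixes F :: "real \<Rightarrow> real"
  assumes r: "r > 0" "r' > 0"
    and d: "\<And>r. r > 0 \<Longrightarrow> (F has_real_derivative F1 r) (at r)"
      "\<And>r. r > 0 \<Longrightarrow> (F1 has_real_derivative F2 r) (at r)"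
      "\<And>r. r > 0 \<Longrightarrow> (F2 has_real_derivative F3 r) (at r)"
    and b: "\<And>t. t > 0 \<Longrightarrow> \<bar>F3 t\<bar> \<le> C * (1 + t) ^ N" and C: "C \<ge> 0"
  shows "\<bar>F r' - (F r + F1 r * (r' - r) + F2 r / 2 * (r' - r)\<^sup>2)\<bar> \<le> C * (1 + r + r') ^ N * \<bar>r' - r\<bar> ^ 3"
proof (cases "r' = r")
  case False
  let ?diff = "\<lambda>m::nat. if m = 0 then F else if m = 1 then F1 else if m = 2 then F2 else F3"
  have "\<exists>t. (if r' < r then r' < t \<and> t < r else r < t \<and> t < r') \<and>
      F r' = (\<Sum>m<3. ?diff m r / fact m * (r' - r) ^ m) + ?diff 3 t / fact 3 * (r' - r) ^ 3"
    by (rule Taylor[where a="min r r'" and b="max r r'"])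
       (use r d False in \<open>auto simp: less_Suc_eq numeral_3_eq_3\<close>)
  then obtain t where t': "if r' < r then r' < t \<and> t < r else r < t \<and> t < r'"
    and eq: "F r' = (\<Sum>m<3. ?diff m r / fact m * (r' - r) ^ m) + ?diff 3 t / fact 3 * (r' - r) ^ 3"
    by blast
  from t' r have t: "t > 0" "t \<le> r + r'"
    by (auto split: if_splits)
  have "F r' - (F r + F1 r * (r' - r) + F2 r / 2 * (r' - r)\<^sup>2) = F3 t / 6 * (r' - r) ^ 3"
    unfolding eq by (simp add: eval_nat_numeral)
  also have "\<bar>\<dots>\<bar> = \<bar>F3 t\<bar> / 6 * \<bar>r' - r\<bar> ^ 3" by (simp add: abs_mult power_abs)
  also have "\<dots> \<le> C * (1 + r + r') ^ N * \<bar>r' - r\<bar> ^ 3"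
  proof (intro mult_right_mono)
    have "\<bar>F3 t\<bar> / 6 \<le> \<bar>F3 t\<bar>" by simp
    also have "\<dots> \<le> C * (1 + t) ^ N" by (rule b[OF t(1)])
    also have "\<dots> \<le> C * (1 + r + r') ^ N" using t C by (intro mult_left_mono power_mono) auto
    finally show "\<bar>F3 t\<bar> / 6 \<le> C * (1 + r + r') ^ N" .
  qed simp
  finally show ?thesis .
qed (use r C in simp)

text \<open>One Gaussian step acts as the identity plus \<open>s\<close> times the Laplacian, with
  an error whose constant is uniform in \<open>x \<noteq> 0\<close>; its growth in \<open>x\<close>
  is carried by \<open>lyap x\<close>. Uniformity up to the singular point is what allows many steps
  to be chained.\<close>

lemma tame_generator:
  assumes "tame F F1 F2"
  obtains K where "K \<ge> 0"
    "\<And>(x::real^'n) s. x \<noteq> 0 \<Longrightarrow> 0 < s \<Longrightarrow> s \<le> 1 \<Longrightarrow>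
       integrable (gauss s) (\<lambda>z. F ((norm (x + z))\<^sup>2)) \<and>
       \<bar>(\<integral>z. F ((norm (x + z))\<^sup>2) \<partial>gauss s) - (F ((norm x)\<^sup>2) +
          s * (2 * real CARD('n) * F1 ((norm x)\<^sup>2) + 4 * (norm x)\<^sup>2 * F2 ((norm x)\<^sup>2)))\<bar> \<le> K * s powr (3/2) * lyap x"
proof -
  from assms obtain F3 C N where [measurable]: "F \<in> borel_measurable borel" and C: "C \<ge> 0"
    and d: "\<And>r. r > 0 \<Longrightarrow> (F has_real_derivative F1 r) (at r)"
      "\<And>r. r > 0 \<Longrightarrow> (F1 has_real_derivative F2 r) (at r)"
      "\<And>r. r > 0 \<Longrightarrow> (F2 has_real_derivative F3 r) (at r)"
    and b2: "\<And>t. t > 0 \<Longrightarrow> \<bar>F2 t\<bar> \<le> C * (1 + t) ^ N"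
    and b3: "\<And>t. t > 0 \<Longrightarrow> \<bar>F3 t\<bar> \<le> C * (1 + t) ^ N"
    unfolding tame_def by blast
  \<comment> \<open>The remainder below is bounded by
    \<open>(2 * Y^2) ^ N * (2 * Y * norm z) ^ 3\<close>, a total power \<open>2 * N + 3\<close> of
    \<open>Y\<close>.\<close>
  define m where "m = 2 * N + 3"
  obtain K1 where K1: "K1 \<ge> 0" "\<And>s. 0 < s \<Longrightarrow> s \<le> 1 \<Longrightarrow>
     integrable (gauss s) (\<lambda>z::real^'n. (1 + norm z) ^ m * norm z ^ 3) \<and>
     (\<integral>z. (1 + norm z) ^ m * norm z ^ 3 \<partial>(gauss s :: (real^'n) measure)) \<le> K1 * s powr (3/2)"
    using gauss_cubic_moment[of m] by blast
  obtain K2 where K2: "K2 > 0" "\<And>x::real^'n. (1 + norm x) ^ m \<le> K2 * lyap x"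
    using lyap_poly[of m] by blast
  define D where "D = C * 2 ^ N * 8 + C * 2"
  have D: "D \<ge> 0" using C by (simp add: D_def)
  define K where "K = D * K2 * K1"
  have "integrable (gauss s) (\<lambda>z. F ((norm (x + z))\<^sup>2)) \<and>
       \<bar>(\<integral>z. F ((norm (x + z))\<^sup>2) \<partial>gauss s) - (F ((norm x)\<^sup>2) +
          s * (2 * real CARD('n) * F1 ((norm x)\<^sup>2) + 4 * (norm x)\<^sup>2 * F2 ((norm x)\<^sup>2)))\<bar> \<le> K * s powr (3/2) * lyap x"
    if x: "x \<noteq> 0" and s: "0 < s" "s \<le> 1" for x :: "real^'n" and s
  proof -
    interpret prob_space "gauss s :: (real^'n) measure" by (rule prob_space_gauss[OF s(1)])
    have P1: "prob UNIV = 1" using prob_space by simp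
    define r where "r = (norm x)\<^sup>2"
    have r: "r > 0" using x by (simp add: r_def)
    \<comment> \<open>The part of the expansion of degree at most 2 in \<open>z\<close>, with
      \<open>|x + z|^2 - |x|^2 = 2 * (x \<bullet> z) + |z|^2\<close>. Its Gaussian mean is exactly
      the identity plus \<open>s\<close> times the generator, so only the rest \<open>R\<close> has
      to be estimated.\<close>
    define A where "A z = F r + F1 r * (2 * (x \<bullet> z) + (norm z)\<^sup>2) + 2 * F2 r * (x \<bullet> z)\<^sup>2" for z
    define R where "R z = F ((norm (x + z))\<^sup>2) - A z" for z
    have A: "has_bochner_integral (gauss s) A (F r + F1 r * (2 * 0 + 2 * s * real CARD('n)) + 2 * F2 r * (2 * s * (norm x)\<^sup>2))"
      unfolding A_def
      by (intro has_bochner_integral_add has_bochner_integral_mult_right gauss_moment1 gauss_moment2 gauss_moment_norm2 s)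
         (simp add: has_bochner_integral_iff P1)
    let ?X = "1 + norm x"
    have R: "\<bar>R z\<bar> \<le> D * ?X ^ m * ((1 + norm z) ^ m * norm z ^ 3)" if z: "x + z \<noteq> 0" for z
    proof -
      \<comment> \<open>A product on purpose: it dominates both \<open>x\<close> and
        \<open>z\<close>, and its powers split into a factor for \<open>lyap x\<close> and a factor
        to be integrated over \<open>z\<close>.\<close>
      define Y where "Y = ?X * (1 + norm z)"
      have Y: "Y = 1 + norm x + norm z + norm x * norm z" by (simp add: Y_def algebra_simps)
      have Y1: "Y \<ge> 1" unfolding Y by simp
      define r' where "r' = (norm (x + z))\<^sup>2"
      have r': "r' > 0" using z by (simp add: r'_def)
      have w: "r' - r = 2 * (x \<bullet> z) + (norm z)\<^sup>2"
        unfolding r'_def r_def power2_norm_eq_inner by (simp add: inner_add_left inner_add_right inner_commute)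
      have xz: "\<bar>x \<bullet> z\<bar> \<le> norm x * norm z" by (rule Cauchy_Schwarz_ineq2)
      have wY: "\<bar>r' - r\<bar> \<le> 2 * Y * norm z"
      proof -
        have "\<bar>r' - r\<bar> \<le> 2 * (norm x * norm z) + norm z * norm z"
          unfolding w power2_eq_square using xz zero_le_square[of "norm z"] by linarith
        also have "\<dots> = (2 * norm x + norm z) * norm z" by (simp add: algebra_simps)
        also have "\<dots> \<le> 2 * Y * norm z" unfolding Y by (intro mult_right_mono) auto
        finally show ?thesis .
      qed
      have rY: "1 + r + r' \<le> 2 * Y\<^sup>2"
      proof -
        have "r \<le> (Y - 1)\<^sup>2" unfolding r_def Y by (intro power_mono) auto
        moreover have "r' \<le> (Y - 1)\<^sup>2" unfolding r'_def Y
          by (intro power_mono order_trans[OF norm_triangle_ineq]) auto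
        moreover have "1 + (Y - 1)\<^sup>2 \<le> Y\<^sup>2" using Y1 by (simp add: power2_eq_square algebra_simps)
        moreover have "(Y - 1)\<^sup>2 \<le> Y\<^sup>2" using Y1 by (intro power_mono) auto
        ultimately show ?thesis by linarith
      qed
      have t: "\<bar>F r' - (F r + F1 r * (r' - r) + F2 r / 2 * (r' - r)\<^sup>2)\<bar> \<le> C * (2 ^ N * 8) * Y ^ m * norm z ^ 3"
      proof -
        have "\<bar>F r' - (F r + F1 r * (r' - r) + F2 r / 2 * (r' - r)\<^sup>2)\<bar> \<le> C * (1 + r + r') ^ N * \<bar>r' - r\<bar> ^ 3"
          by (rule taylor3[OF r r' d b3 C])
        also have "\<dots> \<le> C * (2 * Y\<^sup>2) ^ N * (2 * Y * norm z) ^ 3"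
          using C rY wY r r' Y1 by (intro mult_mono power_mono) auto
        also have "\<dots> = C * (2 ^ N * 8) * Y ^ m * norm z ^ 3"
          by (simp add: m_def power_mult_distrib power_add power_mult)
        finally show ?thesis .
      qed
      \<comment> \<open>Only \<open>(2 * (x \<bullet> z))^2\<close> is kept from the square of
        \<open>r' - r\<close>; the discarded cross terms are at least cubic in
        \<open>z\<close>.\<close>
      have q: "\<bar>F2 r / 2 * (r' - r)\<^sup>2 - 2 * F2 r * (x \<bullet> z)\<^sup>2\<bar> \<le> C * 2 * Y ^ m * norm z ^ 3"
      proof -
        have e: "F2 r / 2 * (r' - r)\<^sup>2 - 2 * F2 r * (x \<bullet> z)\<^sup>2 = F2 r * ((2 * (x \<bullet> z) + (norm z)\<^sup>2 / 2) * (norm z)\<^sup>2)"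
          unfolding w by (simp add: power2_eq_square algebra_simps)
        have "\<bar>F2 r\<bar> \<le> C * (1 + r) ^ N" by (rule b2[OF r])
        also have "\<dots> \<le> C * (Y\<^sup>2) ^ N"
        proof -
          have "1 + r \<le> Y\<^sup>2"
          proof -
            have "r \<le> (Y - 1)\<^sup>2" unfolding r_def Y by (intro power_mono) auto
            moreover have "1 + (Y - 1)\<^sup>2 \<le> Y\<^sup>2" using Y1 by (simp add: power2_eq_square algebra_simps)
            ultimately show ?thesis by linarith
          qed
          then show ?thesis using C r by (intro mult_left_mono power_mono) auto
        qed
        finally have f: "\<bar>F2 r\<bar> \<le> C * (Y\<^sup>2) ^ N" .
        have "\<bar>2 * (x \<bullet> z) + (norm z)\<^sup>2 / 2\<bar> \<le> 2 * (norm x * norm z) + norm z * norm z / 2"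
          unfolding power2_eq_square using xz zero_le_square[of "norm z"] by linarith
        also have "\<dots> \<le> (2 * norm x + 2 * norm z) * norm z" by (simp add: algebra_simps)
        also have "\<dots> \<le> 2 * Y * norm z" unfolding Y by (intro mult_right_mono) auto
        finally have g: "\<bar>2 * (x \<bullet> z) + (norm z)\<^sup>2 / 2\<bar> \<le> 2 * Y * norm z" .
        have "\<bar>F2 r * ((2 * (x \<bullet> z) + (norm z)\<^sup>2 / 2) * (norm z)\<^sup>2)\<bar> \<le> (C * (Y\<^sup>2) ^ N) * ((2 * Y * norm z) * (norm z)\<^sup>2)"
          unfolding abs_mult using f g C Y1 by (intro mult_mono) auto
        also have "\<dots> = C * 2 * Y ^ (2 * N + 1) * norm z ^ 3"
          by (simp add: power_mult power_add eval_nat_numeral power_mult_distrib)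
        also have "\<dots> \<le> C * 2 * Y ^ m * norm z ^ 3"
          using C Y1 by (intro mult_right_mono mult_left_mono power_increasing) (auto simp: m_def)
        finally show ?thesis unfolding e .
      qed
      have "R z = (F r' - (F r + F1 r * (r' - r) + F2 r / 2 * (r' - r)\<^sup>2)) + (F2 r / 2 * (r' - r)\<^sup>2 - 2 * F2 r * (x \<bullet> z)\<^sup>2)"
        unfolding R_def A_def r'_def[symmetric] w[symmetric] by simp
      then have "\<bar>R z\<bar> \<le> C * (2 ^ N * 8) * Y ^ m * norm z ^ 3 + C * 2 * Y ^ m * norm z ^ 3"
        using t q by linarith
      also have "\<dots> = D * ?X ^ m * ((1 + norm z) ^ m * norm z ^ 3)"
        unfolding D_def Y_def power_mult_distrib by (simp only: distrib_left distrib_right ac_simps)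
      finally show ?thesis .
    qed
    \<comment> \<open>The expansion says nothing when \<open>x + z\<close> hits the origin, which
      happens on a null set only.\<close>
    have ae: "AE z in gauss s. x + z \<noteq> 0"
    proof -
      have "AE z in lborel. z \<noteq> - x" by (rule AE_lborel_singleton)
      then have "AE z in lborel. x + z \<noteq> 0" by eventually_elim (auto simp: add_eq_0_iff)
      then show ?thesis unfolding gauss_def by (subst AE_density) auto
    qed
    have iB: "integrable (gauss s) (\<lambda>z::real^'n. D * ?X ^ m * ((1 + norm z) ^ m * norm z ^ 3))"
      using K1(2)[OF s] by auto
    have mA: "A \<in> borel_measurable borel" unfolding A_def by measurable
    then have mR: "R \<in> borel_measurable borel" unfolding R_def by measurable
    have iR: "integrable (gauss s) R"
      by (rule Bochner_Integration.integrable_bound[OF iB]) (use mR ae R D in \<open>auto elim!: eventually_mono\<close>)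
    have eqF: "(\<lambda>z. F ((norm (x + z))\<^sup>2)) = (\<lambda>z. R z + A z)" by (simp add: R_def)
    have iA: "integrable (gauss s) A" using A by (simp add: has_bochner_integral_iff)
    have "(\<integral>z. F ((norm (x + z))\<^sup>2) \<partial>gauss s) - (F r + s * (2 * real CARD('n) * F1 r + 4 * r * F2 r)) = (\<integral>z. R z \<partial>gauss s)"
      unfolding eqF using iR iA A by (simp add: has_bochner_integral_iff r_def algebra_simps)
    also have "\<bar>\<dots>\<bar> \<le> (\<integral>z. \<bar>R z\<bar> \<partial>gauss s)" by (rule integral_abs_bound)
    also have "\<dots> \<le> (\<integral>z. D * ?X ^ m * ((1 + norm z) ^ m * norm z ^ 3) \<partial>(gauss s :: (real^'n) measure))"
      using iR by (intro integral_mono_AE iB) (use ae R in \<open>auto elim!: eventually_mono\<close>)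
    also have "\<dots> = D * ?X ^ m * (\<integral>z. (1 + norm z) ^ m * norm z ^ 3 \<partial>(gauss s :: (real^'n) measure))" by simp
    also have "\<dots> \<le> D * (K2 * lyap x) * (K1 * s powr (3/2))"
      using K1(1) K1(2)[OF s] K2(2)[of x] K2(1) D by (intro mult_mono) auto
    also have "\<dots> = K * s powr (3/2) * lyap x" by (simp add: K_def)
    finally show ?thesis unfolding eqF r_def[symmetric] using iR iA by simp
  qed
  moreover have "K \<ge> 0" using D K1(1) K2(1) by (simp add: K_def)
  ultimately show thesis by (rule that[rotated])
qed

section \<open>Time discretisation of the Feynman--Kac functional\<close>

text \<open>The weight sits at the left end point of the step, matching left Riemann sums; values in
  \<open>ennreal\<close> make every iterate meaningful without integrability.\<close>

definition step :: "(real^'n \<Rightarrow> ennreal) \<Rightarrow> real \<Rightarrow> (real^'n \<Rightarrow> ennreal) \<Rightarrow> real^'n \<Rightarrow> ennreal" where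
  "step c s f x = c x * (\<integral>\<^sup>+z. f (x + z) \<partial>gauss s)"

lemma step_measurable [measurable]:
  assumes s: "s > 0" and [measurable]: "c \<in> borel_measurable borel" "f \<in> borel_measurable borel"
  shows "step c s f \<in> borel_measurable borel"
proof -
  interpret prob_space "gauss s :: (real^'n) measure" by (rule prob_space_gauss[OF s])
  show ?thesis unfolding step_def[abs_def] by measurable
qed

lemma step_iterate_measurable:
  assumes s: "s > 0" and c: "c \<in> borel_measurable borel" and f: "f \<in> borel_measurable borel"
  shows "(step c s ^^ k) f \<in> borel_measurable borel"
  by (induction k) (auto simp: f intro!: step_measurable s c)

lemma step_mono: "(\<And>x. f x \<le> g x) \<Longrightarrow> step c s f x \<le> step c s g x"
  unfolding step_def by (intro mult_left_mono nn_integral_mono) auto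

lemma step_linear:
  assumes [measurable]: "f \<in> borel_measurable borel" "g \<in> borel_measurable borel"
  shows "step c s (\<lambda>x. a * f x + b * g x) x = a * step c s f x + b * step c s g x"
  unfolding step_def by (simp add: nn_integral_add nn_integral_cmult distrib_left ac_simps)

text \<open>The last increment is integrated out first, replacing \<open>f\<close> by
  \<open>step c s f\<close>; hence the induction generalises over \<open>f\<close>.\<close>

lemma step_iterate_product:
  fixes x :: "real^'n"
  assumes s: "s > 0" and c [measurable]: "c \<in> borel_measurable borel" and "f \<in> borel_measurable borel"
  shows "(\<integral>\<^sup>+w. (\<Prod>i<n. c (x + (\<Sum>j<i. w j))) * f (x + (\<Sum>j<n. w j)) \<partial>PiM {..<n} (\<lambda>_. gauss s))
    = (step c s ^^ n) f x"
  using assms(3)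
proof (induction n arbitrary: f)
  case 0
  interpret product_prob_space "\<lambda>_::nat. gauss s :: (real^'n) measure" "{}"
    by (intro product_prob_spaceI prob_space_gauss s)
  show ?case by (simp add: emeasure_space_1)
next
  case (Suc n)
  note [measurable] = Suc.prems
  interpret product_prob_space "\<lambda>_::nat. gauss s :: (real^'n) measure" "{..<n}"
    by (intro product_prob_spaceI prob_space_gauss s)
  interpret g: prob_space "gauss s :: (real^'n) measure" by (rule prob_space_gauss[OF s])
  have upd: "(\<Sum>j<i. (w(n := y)) j) = (\<Sum>j<i. w j)" if "i \<le> n" for i y and w :: "nat \<Rightarrow> real^'n"
    using that by (intro sum.cong) auto
  have "(\<integral>\<^sup>+w. (\<Prod>i<Suc n. c (x + (\<Sum>j<i. w j))) * f (x + (\<Sum>j<Suc n. w j)) \<partial>PiM {..<Suc n} (\<lambda>_. gauss s))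
    = (\<integral>\<^sup>+w. \<integral>\<^sup>+y. (\<Prod>i<Suc n. c (x + (\<Sum>j<i. (w(n := y)) j))) * f (x + (\<Sum>j<Suc n. (w(n := y)) j)) \<partial>gauss s \<partial>PiM {..<n} (\<lambda>_. gauss s))"
    unfolding lessThan_Suc[of n] by (rule product_nn_integral_insert) auto
  also have "\<dots> = (\<integral>\<^sup>+w. \<integral>\<^sup>+y. (\<Prod>i<Suc n. c (x + (\<Sum>j<i. w j))) * f (x + (\<Sum>j<n. w j) + y) \<partial>gauss s \<partial>PiM {..<n} (\<lambda>_. gauss s))"
    by (intro nn_integral_cong arg_cong2[where f="(*)"] prod.cong refl) (simp_all add: upd less_Suc_eq_le add.assoc)
  also have "\<dots> = (\<integral>\<^sup>+w. (\<Prod>i<Suc n. c (x + (\<Sum>j<i. w j))) * (\<integral>\<^sup>+y. f (x + (\<Sum>j<n. w j) + y) \<partial>gauss s) \<partial>PiM {..<n} (\<lambda>_. gauss s))"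
    by (intro nn_integral_cong nn_integral_cmult) auto
  also have "\<dots> = (\<integral>\<^sup>+w. (\<Prod>i<n. c (x + (\<Sum>j<i. w j))) * step c s f (x + (\<Sum>j<n. w j)) \<partial>PiM {..<n} (\<lambda>_. gauss s))"
    by (simp add: step_def mult.assoc)
  also have "\<dots> = (step c s ^^ n) (step c s f) x"
    by (rule Suc.IH) (intro step_measurable s c Suc.prems)
  finally show ?case by (simp add: funpow_swap1)
qed

text \<open>All later information on the law of the increments passes through this formula: on an
  equidistant grid they are i.i.d. Gaussian, so their joint law is a product measure, and the path
  at grid times is a telescoping sum.\<close>

lemma BM_iterate:
  fixes x :: "real^'n"
  assumes M: "is_BM x M" and s: "s > 0" and n: "n > 0"
    and c [measurable]: "c \<in> borel_measurable borel" and f [measurable]: "f \<in> borel_measurable borel"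
  shows "(\<integral>\<^sup>+w. (\<Prod>i<n. c (w (real i * s))) * f (w (real n * s)) \<partial>M) = (step c s ^^ n) f x"
proof -
  interpret prob_space M using M by (simp add: is_BM_def)
  define X where "X i w = w (real (Suc i) * s) - w (real i * s)" for i and w :: "real \<Rightarrow> real^'n"
  have ts: "indep_vars (\<lambda>_. borel) X {..<n} \<and> (\<forall>i<n. distributed M lborel (X i) (\<lambda>z. ennreal (heat s 0 z)))"
  proof -
    have "indep_vars (\<lambda>_. borel) (\<lambda>i w. w (real (Suc i) * s) - w (real i * s)) {..<n} \<and>
      (\<forall>i<n. distributed M lborel (\<lambda>w. w (real (Suc i) * s) - w (real i * s)) (\<lambda>z. ennreal (heat (real (Suc i) * s - real i * s) 0 z)))"
      using M s unfolding is_BM_def by (elim conjE allE[of _ "\<lambda>i. real i * s"] allE[of _ n]) simp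
    moreover have "real (Suc i) * s - real i * s = s" for i by (simp add: algebra_simps)
    ultimately show ?thesis unfolding X_def[abs_def] by simp
  qed
  have rv: "random_variable borel (X i)" if "i \<in> {..<n}" for i
    using ts that by (auto simp: distributed_def)
  have law: "distr M borel (X i) = gauss s" if "i \<in> {..<n}" for i
  proof -
    have "distr M lborel (X i) = gauss s" using ts that by (auto simp: distributed_def gauss_def)
    then show ?thesis by (metis distr_cong sets_lborel)
  qed
  have PiM: "distr M (PiM {..<n} (\<lambda>_. borel)) (\<lambda>w. \<lambda>i\<in>{..<n}. X i w) = PiM {..<n} (\<lambda>_. gauss s)"
    using n ts by (subst indep_vars_iff_distr_eq_PiM'[THEN iffD1, OF _ rv]) (auto simp: law intro!: PiM_cong)
  have sp: "space M = space (restrict_space (PiM UNIV (\<lambda>_. borel)) (paths x))"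
    using M by (intro sets_eq_imp_space_eq) (simp add: is_BM_def)
  have w0: "w 0 = x" if "w \<in> space M" for w
    using that unfolding sp by (simp add: space_restrict_space paths_def)
  have tele: "w (real k * s) = x + (\<Sum>j<k. X j w)" if "w \<in> space M" for w k
    by (induction k) (auto simp: w0[OF that] X_def)
  have "(step c s ^^ n) f x = (\<integral>\<^sup>+w. (\<Prod>i<n. c (x + (\<Sum>j<i. w j))) * f (x + (\<Sum>j<n. w j)) \<partial>PiM {..<n} (\<lambda>_. gauss s))"
    by (rule step_iterate_product[OF s c f, symmetric])
  also have "\<dots> = (\<integral>\<^sup>+w. (\<Prod>i<n. c (x + (\<Sum>j<i. w j))) * f (x + (\<Sum>j<n. w j)) \<partial>distr M (PiM {..<n} (\<lambda>_. borel)) (\<lambda>w. \<lambda>i\<in>{..<n}. X i w))"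
    unfolding PiM ..
  also have "\<dots> = (\<integral>\<^sup>+w. (\<Prod>i<n. c (x + (\<Sum>j<i. (\<lambda>i\<in>{..<n}. X i w) j))) * f (x + (\<Sum>j<n. (\<lambda>i\<in>{..<n}. X i w) j)) \<partial>M)"
    by (intro nn_integral_distr measurable_restrict rv) measurable
  also have "\<dots> = (\<integral>\<^sup>+w. (\<Prod>i<n. c (w (real i * s))) * f (w (real n * s)) \<partial>M)"
  proof (intro nn_integral_cong arg_cong2[where f="(*)"] prod.cong refl arg_cong[where f=c] arg_cong[where f=f])
    fix w i assume w: "w \<in> space M" and i: "i \<in> {..<n}"
    then show "x + (\<Sum>j<i. (\<lambda>i\<in>{..<n}. X i w) j) = w (real i * s)"
      unfolding tele[OF w] by (intro arg_cong2[where f="(+)"] sum.cong refl) auto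
  next
    fix w assume w: "w \<in> space M"
    then show "x + (\<Sum>j<n. (\<lambda>i\<in>{..<n}. X i w) j) = w (real n * s)"
      unfolding tele[OF w] by (intro arg_cong2[where f="(+)"] sum.cong refl) auto
  qed
  finally show ?thesis ..
qed

lemma riemann_sum_limit:
  fixes g :: "real \<Rightarrow> real"
  assumes g: "continuous_on {0..1} g"
  shows "(\<lambda>n. 1 / real n * (\<Sum>i<n. g (real i / real n))) \<longlonglongrightarrow> (LINT s:{0..1}|lborel. g s)"
proof (rule LIMSEQ_I)
  fix e :: real assume e: "e > 0"
  have "uniformly_continuous_on {0..1} g" by (intro compact_uniformly_continuous g) auto
  then obtain d where d: "d > 0" "\<And>a b. a \<in> {0..1} \<Longrightarrow> b \<in> {0..1} \<Longrightarrow> \<bar>b - a\<bar> < d \<Longrightarrow> \<bar>g b - g a\<bar> < e / 2"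
    unfolding uniformly_continuous_on_def dist_real_def using e by (meson half_gt_zero)
  obtain N :: nat where N: "N > 0" "1 / real N < d"
    using d(1) by (metis nat_approx_posE of_nat_0_less_iff zero_less_Suc)
  have I: "(LINT s:{0..1}|lborel. g s) = integral {0..1} g"
    by (intro set_borel_integral_eq_integral(2) borel_integrable_atLeastAtMost')
       (use g in auto)
  have "\<bar>1 / real n * (\<Sum>i<n. g (real i / real n)) - integral {0..1} g\<bar> < e" if n: "n \<ge> N" for n
  proof -
    have n0: "n > 0" using n N by simp
    have nd: "1 / real n < d" using n N by (smt (verit) frac_le of_nat_0_less_iff of_nat_le_iff)
    \<comment> \<open>Partial sums are compared with the integral up to the same time, with an error
      proportional to the elapsed time; this makes the induction close.\<close>
    have "\<bar>1 / real n * (\<Sum>i<k. g (real i / real n)) - integral {0..real k / real n} g\<bar> \<le> e / 2 * (real k / real n)" if "k \<le> n" for k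
      using that
    proof (induction k)
      case (Suc k)
      let ?a = "real k / real n" and ?b = "real (Suc k) / real n"
      have ab: "0 \<le> ?a" "?a \<le> ?b" "?b \<le> 1" "?b - ?a = 1 / real n"
        using Suc.prems n0 by (auto simp: field_simps)
      have int: "g integrable_on {l..u}" if "0 \<le> l" "u \<le> 1" for l u
        using that by (intro integrable_continuous_interval continuous_on_subset[OF g]) auto
      have "integral {0..?b} g = integral {0..?a} g + integral {?a..?b} g"
        using ab by (intro Henstock_Kurzweil_Integration.integral_combine[symmetric] int) auto
      moreover have "norm (integral {?a..?b} (\<lambda>t. g t - g ?a)) \<le> (e / 2) * (?b - ?a)"
      proof (rule integral_bound)
        show "continuous_on {?a..?b} (\<lambda>t. g t - g ?a)"
          using ab by (intro continuous_intros continuous_on_subset[OF g]) auto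
        show "norm (g t - g ?a) \<le> e / 2" if "t \<in> {?a..?b}" for t
        proof -
          have "0 \<le> t" "t \<le> 1" "0 \<le> ?a" "?a \<le> 1" and td: "\<bar>t - ?a\<bar> < d"
            using that ab nd unfolding atLeastAtMost_iff by linarith+
          then have "?a \<in> {0..1}" "t \<in> {0..1}" by simp_all
          moreover note td
          ultimately show ?thesis using d(2) by (simp add: less_imp_le)
        qed
      qed (use ab in auto)
      moreover have "integral {?a..?b} (\<lambda>t. g t - g ?a) = integral {?a..?b} g - g ?a * (1 / real n)"
        using ab by (subst Henstock_Kurzweil_Integration.integral_diff) (auto intro: int)
      moreover have "1 / real n * (\<Sum>i<Suc k. g (real i / real n)) = 1 / real n * (\<Sum>i<k. g (real i / real n)) + g ?a * (1 / real n)"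
        by (simp add: algebra_simps)
      moreover have "e / 2 * ?b = e / 2 * ?a + (e / 2) * (?b - ?a)" by (simp add: algebra_simps)
      moreover have "\<bar>1 / real n * (\<Sum>i<k. g (real i / real n)) - integral {0..?a} g\<bar> \<le> e / 2 * ?a"
        using Suc by simp
      ultimately show ?case by (simp only: real_norm_def)
    qed simp
    from this[of n] show ?thesis using n0 e by simp
  qed
  then show "\<exists>no. \<forall>n\<ge>no. norm (1 / real n * (\<Sum>i<n. g (real i / real n)) - (LINT s:{0..1}|lborel. g s)) < e"
    unfolding I by auto
qed

section \<open>Discrete Gronwall estimates for iterated steps\<close>

text \<open>Each step adds an error \<open>K * p\<close>. As \<open>p\<close> is itself a
  supersolution with the same rate \<open>L\<close>, old errors are carried along by the common
  exponential factor and accumulate only linearly, to \<open>n * K\<close>.\<close>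

lemma step_super_iterate:
  assumes s: "s > 0" and [measurable]: "c \<in> borel_measurable borel" "u \<in> borel_measurable borel" "p \<in> borel_measurable borel"
    and L: "L \<ge> 0" and k: "K \<ge> 0"
    and u: "\<And>x. step c s u x \<le> ennreal (exp (s * L)) * u x + ennreal K * p x"
    and p: "\<And>x. step c s p x \<le> ennreal (exp (s * L)) * p x"
  shows "(step c s ^^ n) u x \<le> ennreal (exp (real n * s * L)) * (u x + ennreal (real n * K) * p x)"
proof (induction n arbitrary: x)
  case (Suc n)
  let ?E = "ennreal (exp (real n * s * L))" and ?e = "ennreal (exp (s * L))"
  have e1: "1 \<le> ?e" using s L by (simp add: ennreal_1[symmetric] del: ennreal_1)
  have "(step c s ^^ Suc n) u x \<le> step c s (\<lambda>x. ?E * u x + (?E * ennreal (real n * K)) * p x) x"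
    unfolding funpow.simps comp_def
    by (intro step_mono order_trans[OF Suc.IH]) (simp add: distrib_left mult.assoc)
  also have "\<dots> = ?E * step c s u x + (?E * ennreal (real n * K)) * step c s p x"
    by (rule step_linear) measurable
  also have "\<dots> \<le> ?E * (?e * u x + ennreal K * p x) + (?E * ennreal (real n * K)) * (?e * p x)"
    by (intro add_mono mult_left_mono u p) auto
  also have "\<dots> \<le> ?E * (?e * u x + ?e * ennreal K * p x) + (?E * ennreal (real n * K)) * (?e * p x)"
  proof -
    have "1 * (ennreal K * p x) \<le> ?e * (ennreal K * p x)" by (intro mult_right_mono e1) simp
    then show ?thesis by (intro add_mono mult_left_mono order_refl) (auto simp: mult.assoc)
  qed
  also have "\<dots> = (?E * ?e) * (u x + (ennreal K + ennreal (real n * K)) * p x)"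
    by (simp add: algebra_simps)
  also have "ennreal K + ennreal (real n * K) = ennreal (real (Suc n) * K)"
    using k by (simp add: ennreal_plus[symmetric] algebra_simps del: ennreal_plus)
  also have "?E * ?e = ennreal (exp (real (Suc n) * s * L))"
  proof -
    have "real (Suc n) * s * L = real n * s * L + s * L" by (simp add: algebra_simps)
    then show ?thesis by (simp only: exp_add ennreal_mult exp_ge_zero)
  qed
  finally show ?case .
qed simp

text \<open>The error stays on the right-hand side because subtraction in \<open>ennreal\<close>
  truncates. The rate \<open>l\<close> of the subsolution is kept apart from the rate
  \<open>L\<close> of the error: in the application \<open>L\<close> depends on the cut-off and
  \<open>l\<close> must not.\<close>

lemma step_sub_iterate:
  assumes s: "s > 0" and [measurable]: "c \<in> borel_measurable borel" "v \<in> borel_measurable borel" "p \<in> borel_measurable borel"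
    and L: "L \<ge> 0" and l: "l \<ge> 0" and k: "K \<ge> 0"
    and v: "\<And>x. ennreal (exp (- (s * l))) * v x \<le> step c s v x + ennreal K * p x"
    and p: "\<And>x. step c s p x \<le> ennreal (exp (s * L)) * p x"
  shows "ennreal (exp (- (real n * s * l))) * v x \<le> (step c s ^^ n) v x + ennreal (real n * K * exp (real n * s * L)) * p x"
proof (induction n arbitrary: x)
  case (Suc n)
  let ?E = "ennreal (exp (- (real n * s * l)))"
  let ?D = "ennreal (real n * K * exp (real n * s * L))"
  have m: "(step c s ^^ n) v \<in> borel_measurable borel" by (rule step_iterate_measurable[OF s]) measurable
  have "ennreal (exp (- (real (Suc n) * s * l))) * v x = ?E * (ennreal (exp (- (s * l))) * v x)"
  proof -
    have "- (real (Suc n) * s * l) = - (real n * s * l) + - (s * l)" by (simp add: algebra_simps)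
    then show ?thesis by (simp only: exp_add ennreal_mult exp_ge_zero mult.assoc)
  qed
  also have "\<dots> \<le> ?E * (step c s v x + ennreal K * p x)"
    by (intro mult_left_mono v) simp
  also have "\<dots> \<le> ?E * step c s v x + 1 * (ennreal K * p x)"
    unfolding distrib_left using s l
    by (intro add_mono mult_right_mono order_refl) (auto simp: ennreal_1[symmetric] simp del: ennreal_1)
  also have "?E * step c s v x = step c s (\<lambda>x. ?E * v x + 0 * v x) x"
    by (subst step_linear) auto
  also have "\<dots> \<le> step c s (\<lambda>x. 1 * (step c s ^^ n) v x + ?D * p x) x"
    using Suc.IH by (intro step_mono) simp
  also have "\<dots> = (step c s ^^ Suc n) v x + ?D * step c s p x"
    by (subst step_linear) (auto simp: m)
  also have "\<dots> \<le> (step c s ^^ Suc n) v x + ?D * (ennreal (exp (s * L)) * p x)"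
    by (intro add_mono mult_left_mono p) auto
  also have "?D * (ennreal (exp (s * L)) * p x) = ennreal (real n * K * exp (real (Suc n) * s * L)) * p x"
  proof -
    have "real (Suc n) * s * L = real n * s * L + s * L" by (simp add: algebra_simps)
    then have eq: "real n * K * exp (real (Suc n) * s * L) = (real n * K * exp (real n * s * L)) * exp (s * L)"
      by (simp only: exp_add mult.assoc)
    have nn: "0 \<le> real n * K * exp (real n * s * L)" using k by simp
    show ?thesis
      unfolding eq ennreal_mult[OF nn exp_ge_zero] by (rule mult.assoc[symmetric])
  qed
  finally have "ennreal (exp (- (real (Suc n) * s * l))) * v x \<le>
     (step c s ^^ Suc n) v x + ennreal (real n * K * exp (real (Suc n) * s * L)) * p x + 1 * (ennreal K * p x)"
    by (simp add: add_mono)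
  also have "\<dots> \<le> (step c s ^^ Suc n) v x + ennreal (real n * K * exp (real (Suc n) * s * L)) * p x + ennreal (K * exp (real (Suc n) * s * L)) * p x"
  proof (intro add_mono order_refl)
    have "K * 1 \<le> K * exp (real (Suc n) * s * L)" using s L k by (intro mult_left_mono) auto
    then show "1 * (ennreal K * p x) \<le> ennreal (K * exp (real (Suc n) * s * L)) * p x"
      by (simp add: mult_right_mono ennreal_leI)
  qed
  also have "\<dots> = (step c s ^^ Suc n) v x + ennreal (real (Suc n) * K * exp (real (Suc n) * s * L)) * p x"
  proof -
    have "real (Suc n) * K * exp (real (Suc n) * s * L) = real n * K * exp (real (Suc n) * s * L) + K * exp (real (Suc n) * s * L)"
      by (simp only: of_nat_Suc distrib_right)
    then have "ennreal (real (Suc n) * K * exp (real (Suc n) * s * L)) =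
        ennreal (real n * K * exp (real (Suc n) * s * L)) + ennreal (K * exp (real (Suc n) * s * L))"
      using k by (subst ennreal_plus[symmetric]) auto
    then show ?thesis by (simp only: add.assoc distrib_right)
  qed
  finally show ?case .
qed simp

lemma path_component_measurable:
  fixes M :: "(real \<Rightarrow> real^'n) measure"
  assumes "sets M = sets (restrict_space (PiM UNIV (\<lambda>_. borel)) (paths x))"
  shows "(\<lambda>w. w t) \<in> borel_measurable M"
proof -
  have "(\<lambda>w. w t) \<in> borel_measurable (restrict_space (PiM UNIV (\<lambda>_. borel)) (paths x))"
    by (intro measurable_restrict_space1 measurable_component_singleton) simp
  then show ?thesis using assms by (simp cong: measurable_cong_sets)
qed

lemma BM_component_measurable: "is_BM x M \<Longrightarrow> (\<lambda>w. w t) \<in> borel_measurable M"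
  by (rule path_component_measurable) (simp add: is_BM_def)

lemma BM_space:
  assumes "is_BM x M" "w \<in> space M"
  shows "continuous_on {0..} w" "w 0 = x"
proof -
  have "space M = space (restrict_space (PiM UNIV (\<lambda>_. borel)) (paths x))"
    using assms(1) by (intro sets_eq_imp_space_eq) (simp add: is_BM_def)
  with assms(2) show "continuous_on {0..} w" "w 0 = x"
    by (auto simp: space_restrict_space paths_def)
qed

lemma prod_exp_riemann:
  "(\<Prod>i<n. ennreal (exp (- (1 / real n * h i)))) = ennreal (exp (- (1 / real n * (\<Sum>i<n. h i))))"
  by (simp add: prod_ennreal exp_sum[symmetric] sum_negf sum_distrib_left)

lemma prod_mono_ennreal:
  fixes f g :: "nat \<Rightarrow> ennreal"
  assumes "\<And>i. i < n \<Longrightarrow> f i \<le> g i"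
  shows "(\<Prod>i<n. f i) \<le> (\<Prod>i<n. g i)"
  using assms by (induction n) (auto intro!: mult_mono)

text \<open>There are \<open>n\<close> steps of length \<open>1 / n\<close>, each with an error of
  order \<open>n powr (- 3/2)\<close>; what remains is of order
  \<open>n powr (- 1/2)\<close>.\<close>

lemma sqrt_error_tendsto:
  "(\<lambda>n. real (Suc n) * (K * (1 / real (Suc n)) powr (3/2))) \<longlonglongrightarrow> 0"
proof -
  have "real (Suc n) * (K * (1 / real (Suc n)) powr (3/2)) = K * (1 / real (Suc n)) powr (1/2)" for n
  proof -
    have "(1 / real (Suc n)) powr (3/2) = (1 / real (Suc n)) powr 1 * (1 / real (Suc n)) powr (1/2)"
      by (subst powr_add[symmetric]) simp
    then show ?thesis by simp
  qed
  moreover have "(\<lambda>n. K * (1 / real (Suc n)) powr (1/2)) \<longlonglongrightarrow> K * 0 powr (1/2)"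
    by (intro tendsto_intros tendsto_powr') (use LIMSEQ_inverse_real_of_nat in \<open>auto simp: inverse_eq_divide\<close>)
  then have "(\<lambda>n. K * (1 / real (Suc n)) powr (1/2)) \<longlonglongrightarrow> 0"
    by (simp del: of_nat_Suc)
  ultimately show ?thesis by (simp only:)
qed

lemma floor_grid:
  assumes t: "0 \<le> t"
  shows "(\<lambda>n. real (nat \<lfloor>real (Suc n) * t\<rfloor>) / real (Suc n)) \<longlonglongrightarrow> t"
    and "\<And>n. real (nat \<lfloor>real (Suc n) * t\<rfloor>) / real (Suc n) \<le> t"
proof -
  let ?k = "\<lambda>n. real (nat \<lfloor>real (Suc n) * t\<rfloor>)"
  have k: "?k n = of_int \<lfloor>real (Suc n) * t\<rfloor>" for n using t by (simp del: of_nat_Suc)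
  show up: "?k n / real (Suc n) \<le> t" for n
  proof -
    have "?k n / real (Suc n) \<le> (real (Suc n) * t) / real (Suc n)"
      unfolding k by (intro divide_right_mono of_int_floor_le) simp
    then show ?thesis by (simp del: of_nat_Suc)
  qed
  have lo: "t - inverse (real (Suc n)) \<le> ?k n / real (Suc n)" for n
  proof -
    have "real (Suc n) * t - 1 \<le> ?k n" unfolding k by linarith
    then have "(real (Suc n) * t - 1) / real (Suc n) \<le> ?k n / real (Suc n)"
      by (intro divide_right_mono) auto
    then show ?thesis by (simp add: diff_divide_distrib inverse_eq_divide del: of_nat_Suc)
  qed
  show "(\<lambda>n. ?k n / real (Suc n)) \<longlonglongrightarrow> t"
  proof (rule tendsto_sandwich[where f="\<lambda>n. t - inverse (real (Suc n))" and h="\<lambda>_. t"])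
    show "\<forall>\<^sub>F n in sequentially. t - inverse (real (Suc n)) \<le> ?k n / real (Suc n)"
      "\<forall>\<^sub>F n in sequentially. ?k n / real (Suc n) \<le> t"
      by (intro always_eventually allI lo up)+
    have "(\<lambda>n. t - inverse (real (Suc n))) \<longlonglongrightarrow> t - 0"
      by (intro tendsto_intros LIMSEQ_inverse_real_of_nat)
    then show "(\<lambda>n. t - inverse (real (Suc n))) \<longlonglongrightarrow> t" by simp
  qed simp
qed

section \<open>From discrete to continuous time for super- and subsolutions\<close>

definition nohit :: "(real \<Rightarrow> real^'n) set" where
  "nohit = {w. \<forall>s\<in>{0..1}. w s \<noteq> 0}"

lemma step_lyap:
  assumes s: "s > 0" and c: "\<And>y. c y \<le> ennreal (exp (s * B))" and L: "B + 1 \<le> L"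
  shows "step c s (\<lambda>y. ennreal (lyap y)) x \<le> ennreal (exp (s * L)) * ennreal (lyap x)"
proof -
  have "step c s (\<lambda>y. ennreal (lyap y)) x = c x * ennreal (exp s * lyap x)"
    using lyap_gauss[OF s, of x] unfolding step_def
    by (subst nn_integral_eq_integral) (auto simp: has_bochner_integral_iff)
  also have "\<dots> \<le> ennreal (exp (s * B)) * ennreal (exp s * lyap x)"
    by (intro mult_right_mono c) simp
  also have "\<dots> = ennreal (exp (s * (B + 1)) * lyap x)"
    by (simp add: ennreal_mult[symmetric] distrib_left exp_add mult.assoc)
  also have "\<dots> \<le> ennreal (exp (s * L) * lyap x)"
    using s L by (intro ennreal_leI mult_right_mono) auto
  finally show ?thesis by (simp add: ennreal_mult)
qed

text \<open>On paths avoiding 0 the discretised weights converge, and the left side vanishes on all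
  others, so Fatou's lemma suffices. The summands \<open>B + 1\<close> in the rate come from making
  one common rate also cover the error function \<open>lyap\<close>.\<close>

lemma FK_supersolution:
  fixes x :: "real^'n" and u :: "real^'n \<Rightarrow> real"
  assumes M: "is_BM x M"
    and phi: "continuous_on (- {0}) phi" "phi \<in> borel_measurable borel" and B: "B \<ge> 0" "\<And>y. y \<noteq> 0 \<Longrightarrow> - B \<le> phi y"
    and u: "\<And>y. 0 \<le> u y" "u \<in> borel_measurable borel" and K: "K \<ge> 0" and l: "l \<ge> 0"
    and gen: "\<And>y s. y \<noteq> 0 \<Longrightarrow> 0 < s \<Longrightarrow> s \<le> 1 \<Longrightarrow> integrable (gauss s) (\<lambda>z. u (y + z)) \<and>
       (\<integral>z. u (y + z) \<partial>gauss s) \<le> u y * (1 + s * (phi y + l)) + K * s powr (3/2) * lyap y"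
  shows "(\<integral>\<^sup>+w. ennreal (indicator nohit w * exp (- (LINT s:{0..1}|lborel. phi (w s))) * u (w 1)) \<partial>M)
    \<le> ennreal (exp (l + B + 1) * u x)"
proof -
  note [measurable] = phi(2) u(2) BM_component_measurable[OF M]
  define L where "L = l + B + 1"
  have L: "L \<ge> 0" "B + 1 \<le> L" "l \<le> L" using B l by (auto simp: L_def)
  \<comment> \<open>Weight 0 at the origin, where no generator inequality is available; paths in
    \<open>nohit\<close> never see this value.\<close>
  define c :: "nat \<Rightarrow> real^'n \<Rightarrow> ennreal" where
    "c n y = (if y = 0 then 0 else ennreal (exp (- (1 / real n * phi y))))" for n y
  have c [measurable]: "c n \<in> borel_measurable borel" for n unfolding c_def by measurable
  define f where "f n w = (\<Prod>i<Suc n. c (Suc n) (w (real i * (1 / real (Suc n))))) * ennreal (u (w (real (Suc n) * (1 / real (Suc n)))))"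
    for n and w :: "real \<Rightarrow> real^'n"
  define er where "er n = real (Suc n) * (exp B * K * (1 / real (Suc n)) powr (3/2))" for n
  have bound: "(\<integral>\<^sup>+w. f n w \<partial>M) \<le> ennreal (exp L * (u x + er n * lyap x))" for n
  proof -
    define s where "s = 1 / real (Suc n)"
    have s: "s > 0" "s \<le> 1" "real (Suc n) * s = 1" by (auto simp: s_def field_simps)
    have cB: "c (Suc n) y \<le> ennreal (exp (s * B))" for y
    proof (cases "y = 0")
      case False
      then have "s * - B \<le> s * phi y" using B s by (intro mult_left_mono) auto
      with False show ?thesis by (auto simp: c_def s_def intro!: ennreal_leI)
    qed (simp add: c_def)
    have "step (c (Suc n)) s (\<lambda>y. ennreal (u y)) y \<le> ennreal (exp (s * L)) * ennreal (u y) + ennreal (exp B * K * s powr (3/2)) * ennreal (lyap y)" for y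
    proof (cases "y = 0")
      case False
      note g = gen[OF False s(1,2)]
      have "step (c (Suc n)) s (\<lambda>y. ennreal (u y)) y = ennreal (exp (- (s * phi y)) * (\<integral>z. u (y + z) \<partial>gauss s))"
        using g False u(1) unfolding step_def
        by (subst nn_integral_eq_integral) (auto simp: c_def s_def ennreal_mult integral_nonneg_AE)
      also have "\<dots> \<le> ennreal (exp (s * L) * u y + exp B * K * s powr (3/2) * lyap y)"
      proof (intro ennreal_leI)
        \<comment> \<open>After \<open>1 + t \<le> exp t\<close> the potential cancels:
          \<open>exp (- (s * phi y)) * exp (s * (phi y + l)) = exp (s * l)\<close>, however large
          \<open>phi y\<close> may be. Only the error term uses the lower bound
          \<open>- B\<close>.\<close>
        have "exp (- (s * phi y)) * (\<integral>z. u (y + z) \<partial>gauss s)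
          \<le> exp (- (s * phi y)) * (u y * exp (s * (phi y + l)) + K * s powr (3/2) * lyap y)"
          using g u(1)[of y] exp_ge_add_one_self[of "s * (phi y + l)"]
          by (intro mult_left_mono order_trans[OF conjunct2[OF g]] add_right_mono) auto
        also have "\<dots> = exp (s * l) * u y + exp (- (s * phi y)) * (K * s powr (3/2) * lyap y)"
          by (simp add: distrib_left exp_add exp_minus)
        also have "\<dots> \<le> exp (s * L) * u y + exp B * (K * s powr (3/2) * lyap y)"
        proof (intro add_mono mult_right_mono)
          show "exp (s * l) \<le> exp (s * L)" using s L by simp
          have "- (s * phi y) \<le> s * B" using B(2)[OF False] s mult_left_mono[of "- B" "phi y" s] by simp
          also have "s * B \<le> 1 * B" using s B by (intro mult_right_mono) auto
          finally show "exp (- (s * phi y)) \<le> exp B" by simp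
        qed (use u K in auto)
        finally show "exp (- (s * phi y)) * (\<integral>z. u (y + z) \<partial>gauss s) \<le> exp (s * L) * u y + exp B * K * s powr (3/2) * lyap y"
          by (simp add: mult.assoc)
      qed
      finally show ?thesis using u(1)[of y] K by (simp add: ennreal_mult)
    qed (simp add: step_def c_def)
    then have "(step (c (Suc n)) s ^^ Suc n) (\<lambda>y. ennreal (u y)) x
       \<le> ennreal (exp (real (Suc n) * s * L)) * (ennreal (u x) + ennreal (real (Suc n) * (exp B * K * s powr (3/2))) * ennreal (lyap x))"
      by (intro step_super_iterate s step_lyap[OF s(1) cB L(2)] L) (use K in auto)
    also have "\<dots> = ennreal (exp L * (u x + er n * lyap x))"
      using K u(1)[of x] by (simp add: s(3) er_def s_def[symmetric] ennreal_mult del: of_nat_Suc)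
    finally show ?thesis
      unfolding f_def s_def[symmetric] by (subst BM_iterate[OF M s(1)]) auto
  qed
  have meas: "f n \<in> borel_measurable M" for n unfolding f_def by measurable
  \<comment> \<open>Fatou's lemma, applied to the grid functionals \<open>f n\<close>.\<close>
  have "(\<integral>\<^sup>+w. ennreal (indicator nohit w * exp (- (LINT s:{0..1}|lborel. phi (w s))) * u (w 1)) \<partial>M)
     \<le> (\<integral>\<^sup>+w. liminf (\<lambda>n. f n w) \<partial>M)"
  proof (rule nn_integral_mono)
    fix w assume w: "w \<in> space M"
    show "ennreal (indicator nohit w * exp (- (LINT s:{0..1}|lborel. phi (w s))) * u (w 1)) \<le> liminf (\<lambda>n. f n w)"
    proof (cases "w \<in> nohit")
      case True
      have cont: "continuous_on {0..1} (\<lambda>s. phi (w s))"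
        by (rule continuous_on_compose2[OF phi(1) continuous_on_subset[OF BM_space(1)[OF M w]]])
           (use True in \<open>auto simp: nohit_def\<close>)
      have "f n w = ennreal (exp (- (1 / real (Suc n) * (\<Sum>i<Suc n. phi (w (real i / real (Suc n)))))) * u (w 1))" for n
      proof -
        have "(\<Prod>i<Suc n. c (Suc n) (w (real i * (1 / real (Suc n))))) = (\<Prod>i<Suc n. ennreal (exp (- (1 / real (Suc n) * phi (w (real i / real (Suc n)))))))"
          using True by (intro prod.cong refl) (auto simp: c_def nohit_def)
        then show ?thesis unfolding f_def prod_exp_riemann using u(1) by (simp add: ennreal_mult del: of_nat_Suc)
      qed
      moreover have "(\<lambda>n. ennreal (exp (- (1 / real (Suc n) * (\<Sum>i<Suc n. phi (w (real i / real (Suc n)))))) * u (w 1)))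
         \<longlonglongrightarrow> ennreal (exp (- (LINT s:{0..1}|lborel. phi (w s))) * u (w 1))"
        by (intro tendsto_ennrealI tendsto_intros LIMSEQ_Suc[OF riemann_sum_limit[OF cont]])
      ultimately have "(\<lambda>n. f n w) \<longlonglongrightarrow> ennreal (exp (- (LINT s:{0..1}|lborel. phi (w s))) * u (w 1))" by simp
      then show ?thesis using True by (simp add: lim_imp_Liminf)
    qed simp
  qed
  also have "\<dots> \<le> liminf (\<lambda>n. \<integral>\<^sup>+w. f n w \<partial>M)" by (rule nn_integral_liminf[OF meas])
  also have "\<dots> \<le> liminf (\<lambda>n. ennreal (exp L * (u x + er n * lyap x)))"
    by (intro Liminf_mono always_eventually allI bound)
  also have "\<dots> = ennreal (exp L * u x)"
  proof (rule lim_imp_Liminf)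
    have "er \<longlonglongrightarrow> 0" unfolding er_def[abs_def] by (rule sqrt_error_tendsto)
    then have "(\<lambda>n. ennreal (exp L * (u x + er n * lyap x))) \<longlonglongrightarrow> ennreal (exp L * (u x + 0 * lyap x))"
      by (intro tendsto_ennrealI tendsto_intros)
    then show "(\<lambda>n. ennreal (exp L * (u x + er n * lyap x))) \<longlonglongrightarrow> ennreal (exp L * u x)" by simp
  qed simp
  finally show ?thesis by (simp add: L_def)
qed

text \<open>The converse of \<open>1 + t \<le> exp t\<close> up to second order; it is the reason
  why the subsolution needs a bounded potential where it does not vanish.\<close>

lemma exp_le_quadratic:
  fixes t b :: real
  assumes "\<bar>t\<bar> \<le> b"
  shows "exp t \<le> 1 + t + b\<^sup>2 * exp b"
proof -
  obtain r where r: "\<bar>r\<bar> \<le> \<bar>t\<bar>" "exp t = (\<Sum>m<2. t ^ m / fact m) + exp r / fact 2 * t ^ 2"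
    using Maclaurin_exp_le[of t 2] by blast
  have "exp r / 2 * t\<^sup>2 \<le> exp b * b\<^sup>2"
  proof (rule mult_mono)
    have "exp r \<le> exp b" using r(1) assms by simp
    then show "exp r / 2 \<le> exp b" using exp_gt_zero[of r] by linarith
    show "t\<^sup>2 \<le> b\<^sup>2" using assms power_mono[of "\<bar>t\<bar>" b 2] by simp
  qed auto
  then show ?thesis unfolding r(2) by (simp add: eval_nat_numeral mult.commute)
qed

text \<open>The potential need only be bounded off the ball where \<open>v\<close> vanishes, and its
  bound \<open>B\<close> does not enter the conclusion: \<open>B\<close>, \<open>Kp\<close> and
  \<open>K\<close> affect only the discretisation error and the majorant. The limit is taken by the
  reverse Fatou lemma, hence the domination of \<open>v\<close> by \<open>lyap\<close>.\<close>

lemma FK_subsolution: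
  fixes x :: "real^'n" and v :: "real^'n \<Rightarrow> real"
  assumes M: "is_BM x M" and rho: "rho > 0"
    and phi: "continuous_on (- {0}) phi" "phi \<in> borel_measurable borel" and B: "B \<ge> 0" "\<And>y. norm y > rho \<Longrightarrow> \<bar>phi y\<bar> \<le> B"
    and v: "\<And>y. 0 \<le> v y" "v \<in> borel_measurable borel" "\<And>y. norm y \<le> rho \<Longrightarrow> v y = 0"
    and Kp: "Kp \<ge> 0" "\<And>y. v y \<le> Kp * lyap y" and K: "K \<ge> 0" and l: "l \<ge> 0"
    and gen: "\<And>y s. norm y > rho \<Longrightarrow> 0 < s \<Longrightarrow> s \<le> 1 \<Longrightarrow> integrable (gauss s) (\<lambda>z. v (y + z)) \<and>
       v y * (1 + s * (phi y - l)) \<le> (\<integral>z. v (y + z) \<partial>gauss s) + K * s powr (3/2) * lyap y"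
  shows "ennreal (exp (- l) * v x) \<le>
    (\<integral>\<^sup>+w. ennreal (indicator nohit w * exp (- (LINT s:{0..1}|lborel. phi (w s))) * v (w 1)) \<partial>M)"
proof -
  note [measurable] = phi(2) v(2) BM_component_measurable[OF M]
  define L where "L = B + 1"
  have L: "L \<ge> 0" "B + 1 \<le> L" using B by (auto simp: L_def)
  define c :: "nat \<Rightarrow> real^'n \<Rightarrow> ennreal" where
    "c n y = (if norm y \<le> rho then 0 else ennreal (exp (- (1 / real n * phi y))))" for n y
  have c [measurable]: "c n \<in> borel_measurable borel" for n unfolding c_def by measurable
  define f where "f n w = (\<Prod>i<Suc n. c (Suc n) (w (real i * (1 / real (Suc n))))) * ennreal (v (w (real (Suc n) * (1 / real (Suc n)))))"
    for n and w :: "real \<Rightarrow> real^'n"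
  \<comment> \<open>First summand: the error in the generator inequality. Second summand: the
    quadratic error of the exponential, multiplied by \<open>v \<le> Kp * lyap\<close>. Both carry
    \<open>exp B\<close> from the weight.\<close>
  define K1 where "K1 = exp B * K + exp B * (Kp * ((B + l)\<^sup>2 * exp (B + l)))"
  have K1: "K1 \<ge> 0" using K Kp by (simp add: K1_def)
  define er where "er n = real (Suc n) * (K1 * (1 / real (Suc n)) powr (3/2)) * exp L * lyap x" for n
  have cB: "c (Suc n) y \<le> ennreal (exp (1 / real (Suc n) * B))" for n y
  proof (cases "norm y \<le> rho")
    case False
    then have "1 / real (Suc n) * - B \<le> 1 / real (Suc n) * phi y" using B(2)[of y] by (intro mult_left_mono) auto
    with False show ?thesis by (auto simp: c_def intro!: ennreal_leI simp del: of_nat_Suc)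
  qed (simp add: c_def)
  have bound: "ennreal (exp (- l) * v x) \<le> (\<integral>\<^sup>+w. f n w \<partial>M) + ennreal (er n)" for n
  proof -
    define s where "s = 1 / real (Suc n)"
    have s: "s > 0" "s \<le> 1" "real (Suc n) * s = 1" by (auto simp: s_def field_simps)
    \<comment> \<open>The quadratic error of the exponential is thereby merged with the error of
      order \<open>s powr (3/2)\<close>.\<close>
    have s32: "s\<^sup>2 \<le> s powr (3/2)"
      using s powr_mono'[of "3/2" 2 s] by (simp add: powr_realpow)
    have "ennreal (exp (- (s * l))) * ennreal (v y) \<le> step (c (Suc n)) s (\<lambda>y. ennreal (v y)) y + ennreal (K1 * s powr (3/2)) * ennreal (lyap y)" for y
    proof (cases "norm y \<le> rho")
      case False
      then have y: "norm y > rho" by simp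
      note g = gen[OF y s(1,2)]
      have ep: "exp (- (s * phi y)) \<le> exp B"
      proof -
        have "- B \<le> phi y" using B(2)[OF y] by linarith
        then have "- (s * phi y) \<le> s * B" using s mult_left_mono[of "- B" "phi y" s] by simp
        also have "s * B \<le> 1 * B" using s B by (intro mult_right_mono) auto
        finally show ?thesis by simp
      qed
      define t where "t = s * (phi y - l)"
      have t: "\<bar>t\<bar> \<le> s * (B + l)"
        unfolding t_def abs_mult using s B(2)[OF y] l by (intro mult_mono) auto
      have e: "exp t \<le> 1 + t + s powr (3/2) * ((B + l)\<^sup>2 * exp (B + l))"
      proof -
        have "exp t \<le> 1 + t + (s * (B + l))\<^sup>2 * exp (s * (B + l))" by (rule exp_le_quadratic[OF t])
        also have "(s * (B + l))\<^sup>2 * exp (s * (B + l)) = s\<^sup>2 * ((B + l)\<^sup>2 * exp (s * (B + l)))"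
          by (simp add: power_mult_distrib)
        also have "\<dots> \<le> s powr (3/2) * ((B + l)\<^sup>2 * exp (B + l))"
          using s s32 B l by (intro mult_mono) (auto simp: mult_left_le_one_le)
        finally show ?thesis by simp
      qed
      have "exp (- (s * l)) * v y = exp (- (s * phi y)) * (v y * exp t)"
        by (simp add: t_def exp_add[symmetric] algebra_simps mult_exp_exp)
      also have "\<dots> \<le> exp (- (s * phi y)) * (v y * (1 + t + s powr (3/2) * ((B + l)\<^sup>2 * exp (B + l))))"
        using v(1)[of y] e by (intro mult_left_mono) auto
      also have "\<dots> = exp (- (s * phi y)) * (v y * (1 + t)) + exp (- (s * phi y)) * (v y * (s powr (3/2) * ((B + l)\<^sup>2 * exp (B + l))))"
        by (simp only: distrib_left)
      also have "\<dots> \<le> exp (- (s * phi y)) * ((\<integral>z. v (y + z) \<partial>gauss s) + K * s powr (3/2) * lyap y)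
           + exp B * ((Kp * lyap y) * (s powr (3/2) * ((B + l)\<^sup>2 * exp (B + l))))"
        using g v(1)[of y] Kp ep by (intro add_mono mult_left_mono mult_mono) (auto simp: t_def)
      also have "\<dots> \<le> exp (- (s * phi y)) * (\<integral>z. v (y + z) \<partial>gauss s) + exp B * (K * s powr (3/2) * lyap y)
           + exp B * ((Kp * lyap y) * (s powr (3/2) * ((B + l)\<^sup>2 * exp (B + l))))"
        unfolding distrib_left using ep K by (intro add_mono mult_right_mono order_refl) auto
      also have "\<dots> = exp (- (s * phi y)) * (\<integral>z. v (y + z) \<partial>gauss s) + K1 * s powr (3/2) * lyap y"
        unfolding K1_def by (simp only: distrib_left distrib_right ac_simps)
      finally have "ennreal (exp (- (s * l)) * v y) \<le> ennreal (exp (- (s * phi y)) * (\<integral>z. v (y + z) \<partial>gauss s) + K1 * s powr (3/2) * lyap y)"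
        by (rule ennreal_leI)
      also have "\<dots> = ennreal (exp (- (s * phi y)) * (\<integral>z. v (y + z) \<partial>gauss s)) + ennreal (K1 * s powr (3/2)) * ennreal (lyap y)"
        using K1 v(1) by (subst ennreal_plus) (auto simp: ennreal_mult integral_nonneg_AE)
      also have "ennreal (exp (- (s * phi y)) * (\<integral>z. v (y + z) \<partial>gauss s)) = step (c (Suc n)) s (\<lambda>y. ennreal (v y)) y"
        using g y v(1) unfolding step_def
        by (subst nn_integral_eq_integral) (auto simp: c_def s_def ennreal_mult integral_nonneg_AE)
      finally show ?thesis using v(1)[of y] by (simp add: ennreal_mult)
    qed (simp add: v(3))
    then have "ennreal (exp (- (real (Suc n) * s * l))) * ennreal (v x) \<le> (step (c (Suc n)) s ^^ Suc n) (\<lambda>y. ennreal (v y)) x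
        + ennreal (real (Suc n) * (K1 * s powr (3/2)) * exp (real (Suc n) * s * L)) * ennreal (lyap x)"
      by (intro step_sub_iterate s step_lyap[OF s(1) cB[of n, folded s_def] L(2)] L l) (use K1 in auto)
    also have "(step (c (Suc n)) s ^^ Suc n) (\<lambda>y. ennreal (v y)) x = (\<integral>\<^sup>+w. f n w \<partial>M)"
      unfolding f_def s_def[symmetric] by (subst BM_iterate[OF M s(1)]) auto
    finally show ?thesis
      using K1 v(1)[of x] by (simp add: s(3) er_def s_def[symmetric] ennreal_mult del: of_nat_Suc)
  qed
  have meas: "f n \<in> borel_measurable M" for n unfolding f_def by measurable
  have w1: "real (Suc n) * (1 / real (Suc n)) = 1" for n by (simp del: of_nat_Suc)
  \<comment> \<open>The weights multiply to at most \<open>exp B\<close> because the total time is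
    1; the result is the integrable majorant for the reverse Fatou lemma.\<close>
  have dom: "f n w \<le> ennreal (exp B * Kp * lyap (w 1))" for n w
  proof -
    have "(\<Prod>i<Suc n. c (Suc n) (w (real i * (1 / real (Suc n))))) \<le> (\<Prod>i<Suc n. ennreal (exp (1 / real (Suc n) * B)))"
      by (intro prod_mono_ennreal cB)
    also have "\<dots> = ennreal (exp B)"
      by (simp add: prod_ennreal ennreal_power exp_of_nat_mult[symmetric] del: of_nat_Suc prod.lessThan_Suc power_Suc)
    finally have "f n w \<le> ennreal (exp B) * ennreal (Kp * lyap (w 1))"
      unfolding f_def w1 by (intro mult_mono ennreal_leI Kp) auto
    then show ?thesis using Kp by (simp add: ennreal_mult[symmetric] mult.assoc)
  qed
  have fin: "(\<integral>\<^sup>+w. ennreal (exp B * Kp * lyap (w 1)) \<partial>M) < \<infinity>"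
  proof -
    have "(\<integral>\<^sup>+w. ennreal (lyap (w 1)) \<partial>M) = step (\<lambda>_. 1) 1 (\<lambda>y. ennreal (lyap y)) x"
      using BM_iterate[OF M, of 1 1 "\<lambda>_. 1" "\<lambda>y. ennreal (lyap y)"] by simp
    also have "\<dots> \<le> ennreal (exp (1 * 1)) * ennreal (lyap x)"
      by (rule step_lyap[where B=0]) auto
    also have "\<dots> < \<infinity>" by (simp add: ennreal_mult[symmetric])
    finally have "(\<integral>\<^sup>+w. ennreal (lyap (w 1)) \<partial>M) < \<infinity>" .
    moreover have "(\<integral>\<^sup>+w. ennreal (exp B * Kp * lyap (w 1)) \<partial>M) = ennreal (exp B * Kp) * (\<integral>\<^sup>+w. ennreal (lyap (w 1)) \<partial>M)"
      using Kp by (subst nn_integral_cmult[symmetric]) (auto simp: ennreal_mult)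
    ultimately show ?thesis by (simp add: ennreal_mult_less_top)
  qed
  have "ennreal (exp (- l) * v x) \<le> limsup (\<lambda>n. \<integral>\<^sup>+w. f n w \<partial>M)"
  proof -
    have "(\<lambda>n. ennreal (exp (- l) * v x) - ennreal (er n)) \<longlonglongrightarrow> ennreal (exp (- l) * v x) - ennreal 0"
    proof (intro tendsto_diff_ennreal tendsto_const tendsto_ennrealI)
      have "(\<lambda>n. real (Suc n) * (K1 * (1 / real (Suc n)) powr (3/2)) * exp L * lyap x) \<longlonglongrightarrow> 0 * exp L * lyap x"
        by (intro tendsto_intros sqrt_error_tendsto)
      then show "er \<longlonglongrightarrow> 0" by (simp add: er_def[abs_def] del: of_nat_Suc)
    qed auto
    then have "ennreal (exp (- l) * v x) = limsup (\<lambda>n. ennreal (exp (- l) * v x) - ennreal (er n))"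
      by (simp add: lim_imp_Limsup)
    also have "\<dots> \<le> limsup (\<lambda>n. \<integral>\<^sup>+w. f n w \<partial>M)"
      using bound by (intro Limsup_mono always_eventually allI) (simp add: ennreal_minus_le_iff add.commute)
    finally show ?thesis .
  qed
  also have "\<dots> \<le> (\<integral>\<^sup>+w. limsup (\<lambda>n. f n w) \<partial>M)"
    by (intro nn_integral_limsup[where w="\<lambda>w. ennreal (exp B * Kp * lyap (w 1))"] meas AE_I2 dom fin) measurable
  also have "\<dots> \<le> (\<integral>\<^sup>+w. ennreal (indicator nohit w * exp (- (LINT s:{0..1}|lborel. phi (w s))) * v (w 1)) \<partial>M)"
  proof (rule nn_integral_mono)
    fix w assume w: "w \<in> space M"
    note cw = BM_space(1)[OF M w]
    show "limsup (\<lambda>n. f n w) \<le> ennreal (indicator nohit w * exp (- (LINT s:{0..1}|lborel. phi (w s))) * v (w 1))"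
    \<comment> \<open>A visit to the open ball persists for a short time, so fine grids notice it
      and the weight becomes 0. Time 1 is left out because the weights are evaluated only at earlier
      grid times. Paths that merely touch the sphere may or may not be killed; for an upper bound on
      the limsup this is irrelevant.\<close>
    proof (cases "\<exists>s\<in>{0..<1}. norm (w s) < rho")
      case True
      then obtain t where t: "0 \<le> t" "t < 1" "norm (w t) < rho" by auto
      define k where "k n = nat \<lfloor>real (Suc n) * t\<rfloor>" for n
      have k: "real (k n) = of_int \<lfloor>real (Suc n) * t\<rfloor>" for n using t(1) by (simp add: k_def)
      have kn: "k n < Suc n" for n
      proof -
        have "real (k n) \<le> real (Suc n) * t" unfolding k by (rule of_int_floor_le)
        also have "\<dots> < real (Suc n) * 1" using t(2) by (intro mult_strict_left_mono) auto
        finally show ?thesis by simp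
      qed
      have "(\<lambda>n. real (k n) * (1 / real (Suc n))) \<longlonglongrightarrow> t"
        using floor_grid(1)[OF t(1)] by (simp add: k_def)
      then have "(\<lambda>n. w (real (k n) * (1 / real (Suc n)))) \<longlonglongrightarrow> w t"
        using continuous_on_tendsto_compose[OF cw, of _ t sequentially] t(1) by simp
      then have "(\<lambda>n. norm (w (real (k n) * (1 / real (Suc n))))) \<longlonglongrightarrow> norm (w t)" by (rule tendsto_norm)
      then have ev: "\<forall>\<^sub>F n in sequentially. norm (w (real (k n) * (1 / real (Suc n)))) < rho"
        using t(3) by (rule order_tendstoD(2))
      have "\<forall>\<^sub>F n in sequentially. f n w = 0"
        using ev
      proof eventually_elim
        case (elim n)
        have "(\<Prod>i<Suc n. c (Suc n) (w (real i * (1 / real (Suc n))))) = 0"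
          by (rule prod_zero) (use kn[of n] elim in \<open>auto intro!: bexI[of _ "k n"] simp: c_def\<close>)
        then show ?case unfolding f_def by simp
      qed
      then have "(\<lambda>n. f n w) \<longlonglongrightarrow> 0" by (rule tendsto_eventually)
      then show ?thesis by (simp add: lim_imp_Limsup)
    next
      case False
      have ge: "norm (w s) \<ge> rho" if "s \<in> {0..1}" for s
      proof (cases "s = 1")
        case True
        have "(\<lambda>n. w (1 - inverse (real (Suc n)))) \<longlonglongrightarrow> w 1"
        proof (rule continuous_on_tendsto_compose[OF cw])
          have "(\<lambda>n. 1 - inverse (real (Suc n))) \<longlonglongrightarrow> 1 - 0"
            by (intro tendsto_intros LIMSEQ_inverse_real_of_nat)
          then show "(\<lambda>n. 1 - inverse (real (Suc n))) \<longlonglongrightarrow> 1" by simp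
        qed (auto intro!: always_eventually simp: field_simps)
        then have "(\<lambda>n. norm (w (1 - inverse (real (Suc n))))) \<longlonglongrightarrow> norm (w 1)" by (rule tendsto_norm)
        moreover have "norm (w (1 - inverse (real (Suc n)))) \<ge> rho" for n
        proof -
          have "inverse (real (Suc n)) \<le> 1" by (simp add: field_simps)
          then show ?thesis using False by (force simp: not_less)
        qed
        ultimately show ?thesis unfolding True by (intro LIMSEQ_le_const) auto
      qed (use that False in force)
      then have nh: "w \<in> nohit" using rho by (force simp: nohit_def)
      have cont: "continuous_on {0..1} (\<lambda>s. phi (w s))"
        by (rule continuous_on_compose2[OF phi(1) continuous_on_subset[OF cw]])
           (use nh in \<open>auto simp: nohit_def\<close>)
      have "f n w \<le> ennreal (exp (- (1 / real (Suc n) * (\<Sum>i<Suc n. phi (w (real i / real (Suc n)))))) * v (w 1))" for n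
      proof -
        have "(\<Prod>i<Suc n. c (Suc n) (w (real i * (1 / real (Suc n))))) \<le> (\<Prod>i<Suc n. ennreal (exp (- (1 / real (Suc n) * phi (w (real i / real (Suc n)))))))"
          by (intro prod_mono_ennreal) (auto simp: c_def)
        then have "f n w \<le> ennreal (exp (- (1 / real (Suc n) * (\<Sum>i<Suc n. phi (w (real i / real (Suc n))))))) * ennreal (v (w 1))"
          unfolding f_def prod_exp_riemann w1 by (intro mult_right_mono) auto
        then show ?thesis using v(1) by (simp add: ennreal_mult del: of_nat_Suc)
      qed
      then have "limsup (\<lambda>n. f n w) \<le> limsup (\<lambda>n. ennreal (exp (- (1 / real (Suc n) * (\<Sum>i<Suc n. phi (w (real i / real (Suc n)))))) * v (w 1)))"
        by (intro Limsup_mono always_eventually allI)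
      also have "\<dots> = ennreal (exp (- (LINT s:{0..1}|lborel. phi (w s))) * v (w 1))"
        by (intro lim_imp_Limsup tendsto_ennrealI tendsto_intros LIMSEQ_Suc[OF riemann_sum_limit[OF cont]]) simp
      finally show ?thesis using nh by simp
    qed
  qed
  finally show ?thesis .
qed

section \<open>Measurability and comparison of Feynman-Kac functionals\<close>

text \<open>A continuous path is the limit of its values at grid points, and each approximation
  takes countably many coordinates. Time is clamped to the unit interval since continuity is known
  only for nonnegative times.\<close>

lemma BM_joint_measurable:
  fixes x :: "real^'n"
  assumes M: "is_BM x M"
  shows "(\<lambda>(w, s::real). w (max 0 (min 1 s))) \<in> borel_measurable (M \<Otimes>\<^sub>M lborel)"
proof (rule borel_measurable_LIMSEQ_metric)
  note [measurable] = BM_component_measurable[OF M]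
  define k where "k n s = nat \<lfloor>real (Suc n) * max 0 (min 1 s)\<rfloor>" for n and s :: real
  have [measurable]: "k n \<in> measurable lborel (count_space UNIV)" for n
    unfolding k_def by measurable
  show "(\<lambda>(w, s). w (real (k n s) / real (Suc n))) \<in> borel_measurable (M \<Otimes>\<^sub>M lborel)" for n
  proof -
    have "(\<lambda>p. (\<lambda>i p. (fst p) (real i / real (Suc n))) (k n (snd p)) p) \<in> borel_measurable (M \<Otimes>\<^sub>M lborel)"
      by (rule measurable_compose_countable) measurable
    then show ?thesis by (simp add: case_prod_beta)
  qed
  fix p :: "(real \<Rightarrow> real^'n) \<times> real" assume "p \<in> space (M \<Otimes>\<^sub>M lborel)"
  then obtain w and s :: real where p: "p = (w, s)" and w: "w \<in> space M" by (auto simp: space_pair_measure)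
  let ?t = "max 0 (min 1 s)"
  have "(\<lambda>n. real (k n s) / real (Suc n)) \<longlonglongrightarrow> ?t"
    unfolding k_def by (rule floor_grid) simp
  then have "(\<lambda>n. w (real (k n s) / real (Suc n))) \<longlonglongrightarrow> w ?t"
    by (rule continuous_on_tendsto_compose[OF BM_space(1)[OF M w]]) auto
  then show "(\<lambda>n. (\<lambda>(w, s). w (real (k n s) / real (Suc n))) p) \<longlonglongrightarrow> (\<lambda>(w, s). w (max 0 (min 1 s))) p"
    by (simp add: p)
qed

text \<open>By compactness a path avoiding 0 stays at a positive distance from it, and by continuity
  rational times detect that distance; this leaves countable operations only.\<close>

lemma nohit_measurable:
  fixes x :: "real^'n"
  assumes M: "is_BM x M"
  shows "(indicator nohit :: _ \<Rightarrow> real) \<in> borel_measurable M"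
proof -
  note [measurable] = BM_component_measurable[OF M]
  have "w \<in> nohit \<longleftrightarrow> (\<exists>m::nat. \<forall>q\<in>\<rat> \<inter> {0..1}. 1 / real (Suc m) \<le> norm (w q))" if w: "w \<in> space M" for w
  proof
    assume nh: "w \<in> nohit"
    have "continuous_on {0..1} (\<lambda>s. norm (w s))"
      by (intro continuous_intros continuous_on_subset[OF BM_space(1)[OF M w]]) auto
    then obtain t where t: "t \<in> {0..1}" "\<And>s. s \<in> {0..1} \<Longrightarrow> norm (w t) \<le> norm (w s)"
      using continuous_attains_inf[of "{0..1::real}" "\<lambda>s. norm (w s)"] by auto
    have "norm (w t) > 0" using t(1) nh by (auto simp: nohit_def)
    then obtain m :: nat where m: "1 / real (Suc m) < norm (w t)" using nat_approx_posE by metis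
    show "\<exists>m::nat. \<forall>q\<in>\<rat> \<inter> {0..1}. 1 / real (Suc m) \<le> norm (w q)"
    proof (intro exI[of _ m] ballI)
      fix q :: real assume "q \<in> \<rat> \<inter> {0..1}"
      then have "norm (w t) \<le> norm (w q)" using t(2) by blast
      with m show "1 / real (Suc m) \<le> norm (w q)" by linarith
    qed
  next
    assume "\<exists>m::nat. \<forall>q\<in>\<rat> \<inter> {0..1}. 1 / real (Suc m) \<le> norm (w q)"
    then obtain m :: nat where m: "\<And>q. q \<in> \<rat> \<inter> {0..1} \<Longrightarrow> 1 / real (Suc m) \<le> norm (w q)" by blast
    show "w \<in> nohit"
    proof (unfold nohit_def, intro CollectI ballI notI)
      fix s :: real assume s: "s \<in> {0..1}" "w s = 0"
      define k where "k n = real (nat \<lfloor>real (Suc n) * s\<rfloor>) / real (Suc n)" for n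
      have kQ: "k n \<in> \<rat> \<inter> {0..1}" for n
      proof -
        have "k n \<le> s" unfolding k_def by (rule floor_grid) (use s in simp)
        then have "k n \<le> 1" using s by simp
        moreover have "0 \<le> k n" unfolding k_def by (intro divide_nonneg_nonneg) auto
        moreover have "k n \<in> \<rat>" unfolding k_def by (intro Rats_divide) auto
        ultimately show ?thesis by auto
      qed
      have "k \<longlonglongrightarrow> s"
        unfolding k_def[abs_def] by (rule floor_grid) (use s in simp)
      then have "(\<lambda>n. w (k n)) \<longlonglongrightarrow> w s"
        by (rule continuous_on_tendsto_compose[OF BM_space(1)[OF M w]]) (use s kQ in auto)
      then have "(\<lambda>n. norm (w (k n))) \<longlonglongrightarrow> 0" using s(2) tendsto_norm_zero by auto
      then have "1 / real (Suc m) \<le> 0" by (rule LIMSEQ_le_const) (use m kQ in auto)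
      then show False by simp
    qed
  qed
  then have "nohit \<inter> space M = {w \<in> space M. \<exists>m::nat. \<forall>q\<in>\<rat> \<inter> {0..1}. 1 / real (Suc m) \<le> norm (w q)}" by blast
  also have "\<dots> \<in> sets M"
  proof -
    have 1: "Measurable.pred M (\<lambda>w. 1 / real (Suc m) \<le> norm (w q))" for m q
      by measurable
    have c: "countable (\<rat> \<inter> {0..1::real})" by (intro countable_Int1 countable_rat)
    show ?thesis
      by (intro sets.sets_Collect_countable_Ex sets.sets_Collect_countable_All'[OF _ c]) (use 1 in \<open>simp add: pred_def\<close>)
  qed
  finally show ?thesis by (simp add: borel_measurable_indicator_iff)
qed

text \<open>For a merely Borel \<open>V\<close> the time integral is not a limit of Riemann sums;
  its measurability comes from joint measurability in path and time.\<close>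

lemma FK_functional_measurable:
  fixes x :: "real^'n" and V :: "real^'n \<Rightarrow> real"
  assumes M: "is_BM x M" and V [measurable]: "V \<in> borel_measurable borel"
  shows "(\<lambda>w. indicator nohit w * exp (- (LINT s:{0..1}|lborel. V (w s)))) \<in> borel_measurable M"
proof -
  note [measurable] = nohit_measurable[OF M] BM_joint_measurable[OF M]
  have eq: "(LINT s:{0..1}|lborel. V (w s)) = (\<integral>s. indicator {0..1} s * V (w (max 0 (min 1 s))) \<partial>lborel)" for w :: "real \<Rightarrow> real^'n"
    unfolding set_lebesgue_integral_def by (intro Bochner_Integration.integral_cong refl) (auto simp: indicator_def)
  have "(\<lambda>p. V ((\<lambda>(w, s). w (max 0 (min 1 s))) p)) \<in> borel_measurable (M \<Otimes>\<^sub>M lborel)"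
    by measurable
  then have [measurable]: "(\<lambda>(w, s). V (w (max 0 (min 1 s)))) \<in> borel_measurable (M \<Otimes>\<^sub>M lborel)"
    by (simp add: case_prod_beta)
  have "(\<lambda>w. \<integral>s. indicator {0..1} s * V (w (max 0 (min 1 s))) \<partial>lborel) \<in> borel_measurable M"
    by (intro lborel.borel_measurable_lebesgue_integral) measurable
  note m = this
  have e: "(exp :: real \<Rightarrow> real) \<in> borel_measurable borel" by simp
  show ?thesis
    unfolding eq by (rule borel_measurable_times[OF nohit_measurable[OF M] measurable_compose[OF borel_measurable_uminus[OF m] e]])
qed

text \<open>The trace of a path avoiding 0 is compact and misses 0, so \<open>V\<close> is bounded
  along it. Without integrability the Lebesgue integral would default to 0 and comparison of
  potentials would fail.\<close>

lemma path_potential_integrable: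
  fixes x :: "real^'n"
  assumes M: "is_BM x M" and w: "w \<in> space M" "w \<in> nohit" and V [measurable]: "V \<in> borel_measurable borel"
    and b: "\<And>K. compact K \<Longrightarrow> 0 \<notin> K \<Longrightarrow> bounded (V ` K)"
  shows "set_integrable lborel {0..1} (\<lambda>s. V (w s) :: real)"
proof -
  have c: "continuous_on {0..1} w" using BM_space(1)[OF M w(1)] by (rule continuous_on_subset) auto
  have "bounded (V ` (w ` {0..1}))"
    by (intro b compact_continuous_image c) (use w(2) in \<open>auto simp: nohit_def\<close>)
  then obtain C where C: "\<And>s. s \<in> {0..1} \<Longrightarrow> \<bar>V (w s)\<bar> \<le> C"
    by (force simp: bounded_iff)
  have "continuous_on UNIV (\<lambda>s. w (max 0 (min 1 s)))"
    by (rule continuous_on_compose2[OF c]) (auto intro!: continuous_intros)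
  then have [measurable]: "(\<lambda>s. w (max 0 (min 1 s))) \<in> borel_measurable borel"
    by (rule borel_measurable_continuous_onI)
  have eq: "(\<lambda>s. indicator {0..1} s *\<^sub>R V (w s)) = (\<lambda>s. indicator {0..1} s *\<^sub>R V (w (max 0 (min 1 s))))"
    by (auto simp: indicator_def)
  show ?thesis
    unfolding set_integrable_def
  proof (rule Bochner_Integration.integrable_bound)
    show "integrable lborel (\<lambda>s. C * indicator {0..1::real} s)" by simp
    show "(\<lambda>s. indicator {0..1} s *\<^sub>R V (w s)) \<in> borel_measurable lborel" unfolding eq by measurable
    show "AE s in lborel. norm (indicator {0..1} s *\<^sub>R V (w s)) \<le> norm (C * indicator {0..1::real} s)"
      using C by (intro AE_I2) (auto simp: indicator_def intro: order_trans[OF C])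
  qed
qed

lemma FK_functional_mono:
  fixes x :: "real^'n" and V U :: "real^'n \<Rightarrow> real"
  assumes M: "is_BM x M" and w: "w \<in> space M"
    and V: "V \<in> borel_measurable borel" "\<And>K. compact K \<Longrightarrow> 0 \<notin> K \<Longrightarrow> bounded (V ` K)"
    and U: "U \<in> borel_measurable borel" "\<And>K. compact K \<Longrightarrow> 0 \<notin> K \<Longrightarrow> bounded (U ` K)"
    and le: "\<And>y. y \<noteq> 0 \<Longrightarrow> V y \<le> U y + C"
  shows "indicator nohit w * exp (- (LINT s:{0..1}|lborel. U (w s)))
    \<le> exp C * (indicator nohit w * exp (- (LINT s:{0..1}|lborel. V (w s))))"
proof (cases "w \<in> nohit")
  case True
  note iV = path_potential_integrable[OF M w True V] and iU = path_potential_integrable[OF M w True U]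
  have iC: "set_integrable lborel {0..1::real} (\<lambda>_. C)" by (simp add: set_integrable_def)
  have "(LINT s:{0..1}|lborel. V (w s)) \<le> (LINT s:{0..1}|lborel. U (w s) + C)"
    by (rule set_integral_mono) (use iV iU iC le True in \<open>auto simp: nohit_def intro!: set_integral_add\<close>)
  also have "\<dots> = (LINT s:{0..1}|lborel. U (w s)) + C"
    using iU iC by (subst set_integral_add) (auto simp: set_lebesgue_integral_def)
  finally show ?thesis using True by (simp flip: exp_add)
qed simp

section \<open>The transition density at time 1\<close>

lemma BM_marginal_1:
  fixes x :: "real^'n"
  assumes M: "is_BM x M" and f: "f \<in> borel_measurable borel"
  shows "(\<integral>\<^sup>+w. f (w 1) \<partial>M) = (\<integral>\<^sup>+z. ennreal (heat 1 x z) * f z \<partial>lborel)"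
  using BM_iterate[OF M, of 1 1 "\<lambda>_. 1" f] f by (simp add: step_def nn_integral_gauss_translate)

text \<open>\<open>FK_density\<close> is obtained by choice, so its defining property is available
  only once some density is exhibited. Radon-Nikodym provides one: the kernel is dominated by the
  law of the path at time 1, which has a Gaussian density. The third claim extends the property from
  sets to nonnegative functions.\<close>

lemma FK_density_1:
  fixes x :: "real^'n" and V :: "real^'n \<Rightarrow> real"
  assumes M: "is_BM x (Wiener x)" and V [measurable]: "V \<in> borel_measurable borel"
    and nn: "\<And>y. y \<noteq> 0 \<Longrightarrow> 0 \<le> V y"
  shows "FK_density V 1 x \<in> borel_measurable borel" "\<And>y. 0 \<le> FK_density V 1 x y"
    and "\<And>u. u \<in> borel_measurable borel \<Longrightarrow>
      (\<integral>\<^sup>+w. ennreal (indicator nohit w * exp (- (LINT s:{0..1}|lborel. V (w s)))) * u (w 1) \<partial>Wiener x)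
      = (\<integral>\<^sup>+y. ennreal (FK_density V 1 x y) * u y \<partial>lborel)"
proof -
  let ?M = "Wiener x"
  interpret M: prob_space ?M using M by (simp add: is_BM_def)
  define Z where "Z w = indicator nohit w * exp (- (LINT s:{0..1}|lborel. V (w s)))" for w :: "real \<Rightarrow> real^'n"
  have Z0: "Z w \<ge> 0" for w by (simp add: Z_def)
  note [measurable] = BM_component_measurable[OF M]
  have Z [measurable]: "Z \<in> borel_measurable ?M" unfolding Z_def[abs_def] by (rule FK_functional_measurable[OF M V])
  define N where "N = distr (density ?M (\<lambda>w. ennreal (Z w))) borel (\<lambda>w. w 1)"
  have N: "(\<integral>\<^sup>+y. u y \<partial>N) = (\<integral>\<^sup>+w. ennreal (Z w) * u (w 1) \<partial>?M)" if [measurable]: "u \<in> borel_measurable borel" for u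
    unfolding N_def by (simp add: nn_integral_distr nn_integral_density)
  have FK: "FK_kernel V 1 x A = emeasure N A" if [measurable]: "A \<in> sets borel" for A
  proof -
    have "emeasure N A = (\<integral>\<^sup>+w. ennreal (Z w) * indicator A (w 1) \<partial>?M)"
      using that by (subst nn_integral_indicator[symmetric]) (auto simp: N_def[symmetric] N, simp add: N_def)
    also have "\<dots> = FK_kernel V 1 x A"
      unfolding FK_kernel_def Z_def nohit_def by (intro nn_integral_cong) (auto simp: indicator_def)
    finally show ?thesis ..
  qed
  have ac: "absolutely_continuous lborel N"
  proof (unfold absolutely_continuous_def, rule subsetI)
    fix A :: "(real^'n) set" assume "A \<in> null_sets lborel"
    then have A [measurable]: "A \<in> sets borel" and A0: "AE z in lborel. z \<notin> A"
      by (auto intro: AE_not_in)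
    have "(\<integral>\<^sup>+w. indicator A (w 1) \<partial>?M) = (\<integral>\<^sup>+z. ennreal (heat 1 x z) * indicator A z \<partial>lborel)"
      by (rule BM_marginal_1[OF M]) measurable
    also have "\<dots> = (\<integral>\<^sup>+z. 0 \<partial>(lborel :: (real^'n) measure))"
      by (rule nn_integral_cong_AE) (use A0 in eventually_elim, simp)
    finally have "(\<integral>\<^sup>+w. indicator A (w 1) \<partial>?M) = 0" by simp
    then have aeA: "AE w in ?M. indicator A (w 1) = (0::ennreal)"
      by (subst (asm) nn_integral_0_iff_AE) auto
    have "(\<integral>\<^sup>+w. ennreal (Z w) * indicator A (w 1) \<partial>?M) = (\<integral>\<^sup>+w. 0 \<partial>?M)"
      by (rule nn_integral_cong_AE) (use aeA in eventually_elim, simp)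
    then have "emeasure N A = 0"
      using N[of "indicator A"] A by (simp add: N_def)
    then show "A \<in> null_sets N" by (intro null_setsI) (auto simp: N_def)
  qed
  then obtain h where h [measurable]: "h \<in> borel_measurable lborel" and hN: "density lborel h = N"
    using sigma_finite_measure.Radon_Nikodym[OF sigma_finite_lborel ac] by (auto simp: N_def)
  \<comment> \<open>The weight is at most 1 since \<open>V \<ge> 0\<close> along paths avoiding 0.
    The total mass is then finite, so \<open>h\<close> is finite almost everywhere and may be
    replaced by a real function.\<close>
  have "(\<integral>\<^sup>+y. h y \<partial>lborel) = (\<integral>\<^sup>+y. 1 \<partial>N)"
    unfolding hN[symmetric] by (subst nn_integral_density) auto
  also have "\<dots> = (\<integral>\<^sup>+w. ennreal (Z w) * 1 \<partial>?M)" by (rule N) simp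
  also have "\<dots> \<le> (\<integral>\<^sup>+w. 1 \<partial>?M)"
  proof (rule nn_integral_mono)
    fix w
    have "Z w \<le> 1"
    proof (cases "w \<in> nohit")
      case True
      then have "0 \<le> (LINT s:{0..1}|lborel. V (w s))"
        unfolding set_lebesgue_integral_def
        by (intro integral_nonneg_AE AE_I2) (auto simp: nohit_def indicator_def intro!: nn)
      then show ?thesis using True by (simp add: Z_def)
    qed (simp add: Z_def)
    then show "ennreal (Z w) * 1 \<le> 1" by (simp add: ennreal_le_1)
  qed
  also have "\<dots> = 1" by (simp add: M.emeasure_space_1)
  finally have hfin: "(\<integral>\<^sup>+y. h y \<partial>lborel) \<noteq> \<infinity>" by (auto simp: top_unique)
  have "AE y in lborel. h y \<noteq> \<infinity>"
    by (rule nn_integral_PInf_AE[OF h hfin])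
  then have hr: "AE y in lborel. ennreal (enn2real (h y)) = h y"
    by eventually_elim (auto simp: less_top)
  define P where "P f \<longleftrightarrow> f \<in> borel_measurable borel \<and> (\<forall>y. f y \<ge> 0) \<and>
       (\<forall>A\<in>sets borel. FK_kernel V 1 x A = (\<integral>\<^sup>+ y\<in>A. ennreal (f y) \<partial>lborel))" for f
  have "P (\<lambda>y. enn2real (h y))"
    unfolding P_def
  proof (intro conjI ballI allI)
    show "(\<lambda>y. enn2real (h y)) \<in> borel_measurable borel" using h by simp
    fix A :: "(real^'n) set" assume A: "A \<in> sets borel"
    have "FK_kernel V 1 x A = (\<integral>\<^sup>+ y\<in>A. h y \<partial>lborel)"
      unfolding FK[OF A] hN[symmetric] using A by (subst emeasure_density) auto
    also have "\<dots> = (\<integral>\<^sup>+ y\<in>A. ennreal (enn2real (h y)) \<partial>lborel)"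
      by (rule nn_integral_cong_AE) (use hr in eventually_elim, simp)
    finally show "FK_kernel V 1 x A = (\<integral>\<^sup>+ y\<in>A. ennreal (enn2real (h y)) \<partial>lborel)" .
  qed simp
  then have P: "P (FK_density V 1 x)"
    unfolding FK_density_def P_def[symmetric] by (rule someI[of P])
  then show m [measurable]: "FK_density V 1 x \<in> borel_measurable borel" and "\<And>y. 0 \<le> FK_density V 1 x y"
    by (auto simp: P_def)
  have "density lborel (\<lambda>y. ennreal (FK_density V 1 x y)) = N"
  proof (rule measure_eqI)
    fix A assume "A \<in> sets (density lborel (\<lambda>y. ennreal (FK_density V 1 x y)))"
    then have A: "A \<in> sets borel" by simp
    then show "emeasure (density lborel (\<lambda>y. ennreal (FK_density V 1 x y))) A = emeasure N A"
      using P by (subst emeasure_density) (auto simp: P_def FK)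
  qed (simp add: N_def)
  note Nd = this
  fix u :: "real^'n \<Rightarrow> ennreal" assume u [measurable]: "u \<in> borel_measurable borel"
  show "(\<integral>\<^sup>+w. ennreal (indicator nohit w * exp (- (LINT s:{0..1}|lborel. V (w s)))) * u (w 1) \<partial>?M)
      = (\<integral>\<^sup>+y. ennreal (FK_density V 1 x y) * u y \<partial>lborel)"
    unfolding Z_def[symmetric] N[OF u, symmetric] Nd[symmetric] by (subst nn_integral_density) auto
qed

section \<open>Existence of Brownian motion\<close>

lemma open_indicator_limit:
  fixes U :: "'a::metric_space set"
  assumes "open U"
  obtains g :: "nat \<Rightarrow> 'a \<Rightarrow> real" where "\<And>n. continuous_on UNIV (g n)" "\<And>n z. 0 \<le> g n z \<and> g n z \<le> 1"
    "\<And>z. (\<lambda>n. g n z) \<longlonglongrightarrow> indicator U z"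
proof (cases "U = UNIV")
  case True
  \<comment> \<open>The whole space is treated apart because \<open>infdist\<close> to the empty set
    is 0 by convention.\<close>
  then show thesis by (intro that[of "\<lambda>_ _. 1"]) auto
next
  case False
  define g where "g n z = min 1 (real n * infdist z (- U))" for n and z :: 'a
  have "(\<lambda>n. g n z) \<longlonglongrightarrow> indicator U z" for z
  proof (cases "z \<in> U")
    case True
    have "closed (- U)" "- U \<noteq> {}" using assms False by auto
    then have i: "infdist z (- U) > 0" using True in_closed_iff_infdist_zero[of "- U" z] infdist_nonneg[of z "- U"] by force
    obtain N :: nat where N: "1 / infdist z (- U) < real N" using reals_Archimedean2 by blast
    have "g n z = 1" if "n \<ge> N" for n
    proof -
      have "1 / infdist z (- U) \<le> real n" using N that by linarith
      then have "1 \<le> real n * infdist z (- U)" using i by (simp add: pos_divide_le_eq)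
      then show ?thesis by (simp add: g_def)
    qed
    then have "\<forall>\<^sub>F n in sequentially. g n z = 1" by (auto simp: eventually_sequentially)
    then show ?thesis using True by (simp add: tendsto_eventually)
  qed (simp add: g_def)
  moreover have "continuous_on UNIV (g n)" for n
    unfolding g_def by (intro continuous_intros)
  ultimately show thesis by (intro that[of g]) (auto simp: g_def infdist_nonneg)
qed

text \<open>Brownian increments arise as pointwise limits, and only continuous test functions pass
  to such limits. They approximate indicators of open sets, and open sets form an
  intersection-stable generator, so factorised integrals determine both independence and the
  marginals.\<close>

lemma (in prob_space) indep_vars_continuous_testI:
  fixes X :: "nat \<Rightarrow> 'a \<Rightarrow> 'b::metric_space" and N :: "nat \<Rightarrow> 'b measure"
  assumes X: "\<And>i. i < k \<Longrightarrow> X i \<in> borel_measurable M"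
    and N: "\<And>i. i < k \<Longrightarrow> prob_space (N i)" "\<And>i. i < k \<Longrightarrow> sets (N i) = sets borel"
    and test: "\<And>g :: nat \<Rightarrow> 'b \<Rightarrow> real. (\<And>i. continuous_on UNIV (g i)) \<Longrightarrow> (\<And>i z. 0 \<le> g i z \<and> g i z \<le> 1) \<Longrightarrow>
      (\<integral>w. (\<Prod>i<k. g i (X i w)) \<partial>M) = (\<Prod>i<k. \<integral>z. g i z \<partial>N i)"
  shows "indep_vars (\<lambda>_. borel) X {..<k}" "\<And>i. i < k \<Longrightarrow> distr M borel (X i) = N i"
proof -
  have spN: "space (N i) = UNIV" if "i < k" for i using N(2)[OF that] sets_eq_imp_space_eq by force
  have ev: "X i -` U \<inter> space M \<in> events" if "i < k" "open U" for i U
    using measurable_sets[OF X[OF that(1)]] that(2) by simp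
  have box: "prob (space M \<inter> (\<Inter>i\<in>{..<k}. X i -` U i)) = (\<Prod>i<k. measure (N i) (U i))" if U: "\<And>i. open (U i)" for U
  proof -
    have "\<forall>i. \<exists>g :: nat \<Rightarrow> 'b \<Rightarrow> real. (\<forall>n. continuous_on UNIV (g n)) \<and> (\<forall>n z. 0 \<le> g n z \<and> g n z \<le> 1) \<and> (\<forall>z. (\<lambda>n. g n z) \<longlonglongrightarrow> indicator (U i) z)"
      using open_indicator_limit[OF U] by metis
    then obtain g :: "nat \<Rightarrow> nat \<Rightarrow> 'b \<Rightarrow> real" where g: "\<And>i n. continuous_on UNIV (g i n)" "\<And>i n z. 0 \<le> g i n z \<and> g i n z \<le> 1"
      "\<And>i z. (\<lambda>n. g i n z) \<longlonglongrightarrow> indicator (U i) z" by metis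
    have gm: "g i n \<in> borel_measurable borel" for i n using g(1) by (intro borel_measurable_continuous_onI)
    have "(\<lambda>n. \<integral>w. (\<Prod>i<k. g i n (X i w)) \<partial>M) \<longlonglongrightarrow> (\<integral>w. (\<Prod>i<k. indicator (U i) (X i w)) \<partial>M)"
    proof (rule integral_dominated_convergence[where w="\<lambda>_. 1"])
      show "(\<lambda>w. \<Prod>i<k. g i n (X i w)) \<in> borel_measurable M" for n
        by (intro borel_measurable_prod measurable_compose[OF X gm]) auto
      show "(\<lambda>w. \<Prod>i<k. indicator (U i) (X i w) :: real) \<in> borel_measurable M"
        using U by (intro borel_measurable_prod measurable_compose[OF X borel_measurable_indicator]) auto
      show "AE w in M. (\<lambda>n. \<Prod>i<k. g i n (X i w)) \<longlonglongrightarrow> (\<Prod>i<k. indicator (U i) (X i w))"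
        by (intro AE_I2 tendsto_prod g)
      show "AE w in M. norm (\<Prod>i<k. g i n (X i w)) \<le> 1" for n
        using g(2) by (intro AE_I2) (simp add: prod_nonneg prod_le_1 abs_of_nonneg)
    qed simp
    moreover have "(\<lambda>n. \<Prod>i<k. \<integral>z. g i n z \<partial>N i) \<longlonglongrightarrow> (\<Prod>i<k. measure (N i) (U i))"
    proof (rule tendsto_prod)
      fix i assume i: "i \<in> {..<k}"
      then interpret Ni: prob_space "N i" using N by simp
      have "(\<lambda>n. \<integral>z. g i n z \<partial>N i) \<longlonglongrightarrow> (\<integral>z. indicator (U i) z \<partial>N i)"
      proof (rule integral_dominated_convergence[where w="\<lambda>_. 1"])
        show "g i n \<in> borel_measurable (N i)" for n using gm N(2) i by (simp cong: measurable_cong_sets)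
        show "indicator (U i) \<in> borel_measurable (N i)" using U N(2) i by (intro borel_measurable_indicator) simp
      qed (use g in auto)
      then show "(\<lambda>n. \<integral>z. g i n z \<partial>N i) \<longlonglongrightarrow> measure (N i) (U i)" using spN i by simp
    qed
    moreover have "(\<integral>w. (\<Prod>i<k. g i n (X i w)) \<partial>M) = (\<Prod>i<k. \<integral>z. g i n z \<partial>N i)" for n
      by (rule test) (use g in auto)
    ultimately have "(\<integral>w. (\<Prod>i<k. indicator (U i) (X i w)) \<partial>M) = (\<Prod>i<k. measure (N i) (U i))"
      using LIMSEQ_unique by simp
    moreover have "(\<Prod>i<k. indicator (U i) (X i w)) = (indicator (\<Inter>i\<in>{..<k}. X i -` U i) w :: real)" for w
    proof (cases "w \<in> (\<Inter>i\<in>{..<k}. X i -` U i)")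
      case False
      then obtain i where "i < k" "X i w \<notin> U i" by auto
      then have "(\<Prod>i<k. indicator (U i) (X i w)) = (0::real)" by (intro prod_zero bexI[of _ i]) auto
      then show ?thesis using False by simp
    qed (simp add: prod.neutral)
    ultimately show ?thesis by (simp add: Int_commute)
  qed
  \<comment> \<open>All other factors are the whole space, which turns the box formula into the
    marginal.\<close>
  have one: "prob (X i -` U \<inter> space M) = measure (N i) U" if i: "i < k" and U: "open U" for i U
  proof -
    have "prob (space M \<inter> (\<Inter>j\<in>{..<k}. X j -` (if j = i then U else UNIV))) = (\<Prod>j<k. measure (N j) (if j = i then U else UNIV))"
      by (rule box) (use U in auto)
    moreover have "space M \<inter> (\<Inter>j\<in>{..<k}. X j -` (if j = i then U else UNIV)) = X i -` U \<inter> space M"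
      using i by (auto split: if_splits)
    moreover have "(\<Prod>j<k. measure (N j) (if j = i then U else UNIV)) = (\<Prod>j<k. if j = i then measure (N i) U else 1)"
      using prob_space.prob_space[OF N(1)] spN by (intro prod.cong) auto
    ultimately show ?thesis using i by simp
  qed
  define G where "G i = {X i -` U \<inter> space M |U. open U}" for i
  have "indep_sets G {..<k}"
  proof (rule indep_setsI)
    show "G i \<subseteq> events" if "i \<in> {..<k}" for i using ev that by (auto simp: G_def)
    fix A J assume J: "J \<noteq> {}" "J \<subseteq> {..<k}" "finite J" "\<forall>j\<in>J. A j \<in> G j"
    then have "\<forall>j\<in>J. \<exists>U. open U \<and> A j = X j -` U \<inter> space M" by (auto simp: G_def)
    then obtain U where U: "\<And>j. j \<in> J \<Longrightarrow> open (U j)" "\<And>j. j \<in> J \<Longrightarrow> A j = X j -` U j \<inter> space M" by metis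
    let ?U = "\<lambda>j. if j \<in> J then U j else UNIV"
    have "prob (\<Inter>j\<in>J. A j) = prob (space M \<inter> (\<Inter>j\<in>{..<k}. X j -` ?U j))"
      using J U(2) by (intro arg_cong[where f=prob]) (auto split: if_splits)
    also have "\<dots> = (\<Prod>j<k. measure (N j) (?U j))" by (rule box) (use U in auto)
    also have "\<dots> = (\<Prod>j<k. if j \<in> J then measure (N j) (U j) else 1)"
      using prob_space.prob_space[OF N(1)] spN by (intro prod.cong) auto
    also have "\<dots> = (\<Prod>j\<in>{..<k} \<inter> J. measure (N j) (U j))"
      by (simp add: prod.If_cases)
    also have "\<dots> = (\<Prod>j\<in>J. measure (N j) (U j))" using J by (intro prod.cong) auto
    also have "\<dots> = (\<Prod>j\<in>J. prob (A j))"
      using J U one by (intro prod.cong refl) (auto simp: subset_iff)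
    finally show "prob (\<Inter>j\<in>J. A j) = (\<Prod>j\<in>J. prob (A j))" .
  qed
  then have "indep_sets (\<lambda>i. sigma_sets (space M) (G i)) {..<k}"
  proof (rule indep_sets_sigma)
    show "Int_stable (G i)" for i
    proof (rule Int_stableI)
      fix a b assume "a \<in> G i" "b \<in> G i"
      then obtain U W where "open U" "open W" "a = X i -` U \<inter> space M" "b = X i -` W \<inter> space M"
        unfolding G_def by blast
      then show "a \<inter> b \<in> G i" unfolding G_def by (intro CollectI exI[of _ "U \<inter> W"]) auto
    qed
  qed
  moreover have "sigma_sets (space M) (G i) = {X i -` A \<inter> space M |A. A \<in> sets borel}" for i
    unfolding G_def sets_borel using sigma_sets_vimage_commute[of "X i" "space M" UNIV "Collect open"] by simp
  ultimately show "indep_vars (\<lambda>_. borel) X {..<k}"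
    unfolding indep_vars_def2 using X by simp
  show "distr M borel (X i) = N i" if i: "i < k" for i
  proof (rule measure_eqI_generator_eq[where E="{S. open S}" and \<Omega>=UNIV and A="\<lambda>_. UNIV"])
    show "Int_stable {S :: 'b set. open S}" by (auto intro: Int_stableI)
    show "emeasure (distr M borel (X i)) U = emeasure (N i) U" if U: "U \<in> {S. open S}" for U
    proof -
      interpret Ni: prob_space "N i" using N i by simp
      have "emeasure (distr M borel (X i)) U = emeasure M (X i -` U \<inter> space M)"
        using X[OF i] U by (intro emeasure_distr) auto
      then show ?thesis using one[OF i] U by (simp add: emeasure_eq_measure Ni.emeasure_eq_measure)
    qed
    interpret D: prob_space "distr M borel (X i)" by (rule prob_space_distr) (rule X[OF i])
    show "emeasure (distr M borel (X i)) UNIV \<noteq> \<infinity>" by simp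
  qed (use N(2)[OF i] in \<open>auto simp: sets_borel\<close>)
qed

lemma is_BM_I:
  fixes M :: "(real \<Rightarrow> real^'n) measure"
  assumes M: "prob_space M" and s: "sets M = sets (restrict_space (PiM UNIV (\<lambda>_. borel)) (paths x))"
    and test: "\<And>ts k g. ts 0 = 0 \<Longrightarrow> (\<And>i. i < k \<Longrightarrow> ts i < ts (Suc i)) \<Longrightarrow>
      (\<And>i. continuous_on UNIV (g i)) \<Longrightarrow> (\<And>i z. 0 \<le> g i z \<and> g i z \<le> (1::real)) \<Longrightarrow>
      (\<integral>w. (\<Prod>i<k. g i (w (ts (Suc i)) - w (ts i))) \<partial>M) = (\<Prod>i<k. \<integral>z. g i z \<partial>gauss (ts (Suc i) - ts i))"
  shows "is_BM x M"
proof -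
  interpret prob_space M by (rule M)
  have c: "(\<lambda>w. w t) \<in> borel_measurable M" for t
    by (rule path_component_measurable[OF s])
  note [measurable] = c
  have "indep_vars (\<lambda>_. borel) (\<lambda>i w. w (ts (Suc i)) - w (ts i)) {..<k} \<and>
        (\<forall>i<k. distributed M lborel (\<lambda>w. w (ts (Suc i)) - w (ts i)) (\<lambda>z. ennreal (heat (ts (Suc i) - ts i) 0 z)))"
    if ts: "ts 0 = 0" "\<forall>i<k. ts i < ts (Suc i)" for ts :: "nat \<Rightarrow> real" and k
  proof -
    let ?X = "\<lambda>i w. w (ts (Suc i)) - w (ts i)"
    have X: "?X i \<in> borel_measurable M" for i by measurable
    have N: "prob_space (gauss (ts (Suc i) - ts i) :: (real^'n) measure)" if "i < k" for i
      using ts(2) that by (intro prob_space_gauss) simp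
    have T: "(\<integral>w. (\<Prod>i<k. g i (?X i w)) \<partial>M) = (\<Prod>i<k. \<integral>z. g i z \<partial>gauss (ts (Suc i) - ts i))"
      if "\<And>i. continuous_on UNIV (g i)" "\<And>i z. 0 \<le> g i z \<and> g i z \<le> (1::real)" for g
      by (rule test) (use ts that in auto)
    note r = indep_vars_continuous_testI[where X="?X" and N="\<lambda>i. gauss (ts (Suc i) - ts i)" and k=k, OF X N sets_gauss T]
    have 1: "indep_vars (\<lambda>_. borel) ?X {..<k}" by (rule r(1)) (use ts in auto)
    have 2: "distr M borel (?X i) = gauss (ts (Suc i) - ts i)" if "i < k" for i
      by (rule r(2)) (use ts that in auto)
    have "distributed M lborel (?X i) (\<lambda>z. ennreal (heat (ts (Suc i) - ts i) 0 z))" if "i < k" for i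
      unfolding distributed_def
    proof (intro conjI)
      have "distr M lborel (?X i) = distr M borel (?X i)" by (rule distr_cong) auto
      then show "distr M lborel (?X i) = density lborel (\<lambda>z. ennreal (heat (ts (Suc i) - ts i) 0 z))"
        using 2[OF that] by (simp add: gauss_def)
      show "?X i \<in> measurable M lborel" using X[of i] by simp
    qed simp
    with 1 show ?thesis by blast
  qed
  then show ?thesis unfolding is_BM_def using M s by blast
qed

text \<open>Independence in two stages: blocks are independent because each is a function of its own
  \<open>U l\<close>, and inside a block independence is checked by hand. In the dyadic construction
  a block is a pair of siblings computed from one parent and one noise variable.\<close>

lemma (in prob_space) indep_vars_refine:
  assumes U: "indep_vars M' U L" and b: "\<And>i. i \<in> I \<Longrightarrow> b i \<in> L"
    and f: "\<And>i. i \<in> I \<Longrightarrow> f i \<in> measurable (M' (b i)) (N i)"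
    and X: "\<And>i w. i \<in> I \<Longrightarrow> w \<in> space M \<Longrightarrow> X i w = f i (U (b i) w)"
    and inner: "\<And>l J B. l \<in> L \<Longrightarrow> J \<subseteq> {i\<in>I. b i = l} \<Longrightarrow> finite J \<Longrightarrow> J \<noteq> {} \<Longrightarrow> (\<And>j. j \<in> J \<Longrightarrow> B j \<in> sets (N j)) \<Longrightarrow>
       prob (\<Inter>j\<in>J. X j -` B j \<inter> space M) = (\<Prod>j\<in>J. prob (X j -` B j \<inter> space M))"
  shows "indep_vars N X I"
proof -
  have Um: "U l \<in> measurable M (M' l)" if "l \<in> L" for l using U that by (auto simp: indep_vars_def)
  have Xm: "X i \<in> measurable M (N i)" if "i \<in> I" for i
  proof -
    have "(\<lambda>w. f i (U (b i) w)) \<in> measurable M (N i)"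
      by (rule measurable_compose[OF Um[OF b[OF that]] f[OF that]])
    then show ?thesis using X[OF that] by (simp cong: measurable_cong)
  qed
  show ?thesis
    unfolding indep_vars_def2
  proof (intro conjI ballI indep_setsI)
    fix i assume "i \<in> I" then show "X i \<in> measurable M (N i)" by (rule Xm)
  next
    fix i assume "i \<in> I" then show "{X i -` A \<inter> space M |A. A \<in> sets (N i)} \<subseteq> events"
      using measurable_sets[OF Xm] by auto
  next
    fix A J assume J: "J \<noteq> {}" "J \<subseteq> I" "finite J" "\<forall>j\<in>J. A j \<in> {X j -` A \<inter> space M |A. A \<in> sets (N j)}"
    then have "\<forall>j\<in>J. \<exists>B. B \<in> sets (N j) \<and> A j = X j -` B \<inter> space M" by blast
    then obtain B where B: "\<And>j. j \<in> J \<Longrightarrow> B j \<in> sets (N j)" "\<And>j. j \<in> J \<Longrightarrow> A j = X j -` B j \<inter> space M" by metis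
    define S where "S l = (\<Inter>j\<in>{j\<in>J. b j = l}. f j -` B j \<inter> space (M' l))" for l
    have ne: "{j\<in>J. b j = l} \<noteq> {}" if "l \<in> b ` J" for l using that by auto
    have S: "S l \<in> sets (M' l)" if "l \<in> b ` J" for l
      unfolding S_def
    proof (rule sets.finite_INT)
      fix j assume "j \<in> {j\<in>J. b j = l}"
      then have j: "j \<in> J" "b j = l" "j \<in> I" using J by auto
      from measurable_sets[OF f[OF j(3)] B(1)[OF j(1)]] show "f j -` B j \<inter> space (M' l) \<in> sets (M' l)"
        unfolding j(2) .
    qed (use J ne[OF that] in auto)
    have SA: "U l -` S l \<inter> space M = (\<Inter>j\<in>{j\<in>J. b j = l}. X j -` B j \<inter> space M)" if l: "l \<in> b ` J" for l
    proof -
      have "l \<in> L" using l J b by auto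
      then have "U l w \<in> space (M' l)" if "w \<in> space M" for w using Um that by (auto dest: measurable_space)
      then show ?thesis unfolding S_def using ne[OF l] X J(2) by (auto simp: subset_iff)
    qed
    have "(\<Inter>j\<in>J. A j) = (\<Inter>l\<in>b ` J. U l -` S l \<inter> space M)"
    proof -
      have "(\<Inter>l\<in>b ` J. U l -` S l \<inter> space M) = (\<Inter>l\<in>b ` J. \<Inter>j\<in>{j\<in>J. b j = l}. X j -` B j \<inter> space M)"
        by (rule INF_cong[OF refl SA])
      also have "\<dots> = (\<Inter>j\<in>J. X j -` B j \<inter> space M)" by blast
      also have "\<dots> = (\<Inter>j\<in>J. A j)" by (rule INF_cong[OF refl B(2)[symmetric]])
      finally show ?thesis ..
    qed
    moreover have "prob (\<Inter>l\<in>b ` J. U l -` S l \<inter> space M) = (\<Prod>l\<in>b ` J. prob (U l -` S l \<inter> space M))"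
    proof (rule indep_varsD[OF U _ _ _ S])
      show "b ` J \<subseteq> L" using b J(2) by (auto simp: subset_iff)
    qed (use J in auto)
    ultimately have "prob (\<Inter>j\<in>J. A j) = (\<Prod>l\<in>b ` J. prob (U l -` S l \<inter> space M))" by (simp only:)
    also have "\<dots> = (\<Prod>l\<in>b ` J. \<Prod>j\<in>{j\<in>J. b j = l}. prob (A j))"
    proof (rule prod.cong[OF refl])
      fix l assume l: "l \<in> b ` J"
      then have "prob (\<Inter>j\<in>{j\<in>J. b j = l}. X j -` B j \<inter> space M) = (\<Prod>j\<in>{j\<in>J. b j = l}. prob (X j -` B j \<inter> space M))"
        using J b B(1) by (intro inner[of l]) auto
      then show "prob (U l -` S l \<inter> space M) = (\<Prod>j\<in>{j\<in>J. b j = l}. prob (A j))"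
        unfolding SA[OF l] using B(2) by simp
    qed
    also have "\<dots> = (\<Prod>j\<in>J. prob (A j))"
      by (rule prod.image_gen[OF J(3), symmetric])
    finally show "prob (\<Inter>j\<in>J. A j) = (\<Prod>j\<in>J. prob (A j))" .
  qed
qed

lemma (in prob_space) indep_vars_imp_indep_var:
  assumes X: "indep_vars M' X I" and ij: "i \<in> I" "j \<in> I" "i \<noteq> j"
  shows "indep_var (M' i) (X i) (M' j) (X j)"
proof -
  have rv: "random_variable (M' l) (X l)" if "l \<in> I" for l using X that by (auto simp: indep_vars_def)
  have st: "Int_stable {X l -` A \<inter> space M |A. A \<in> sets (M' l)}" for l
  proof (rule Int_stableI)
    fix a b assume "a \<in> {X l -` A \<inter> space M |A. A \<in> sets (M' l)}" "b \<in> {X l -` A \<inter> space M |A. A \<in> sets (M' l)}"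
    then obtain A B where "A \<in> sets (M' l)" "B \<in> sets (M' l)" "a = X l -` A \<inter> space M" "b = X l -` B \<inter> space M" by blast
    then show "a \<inter> b \<in> {X l -` A \<inter> space M |A. A \<in> sets (M' l)}"
      by (intro CollectI exI[of _ "A \<inter> B"]) auto
  qed
  have "indep_set {X i -` A \<inter> space M |A. A \<in> sets (M' i)} {X j -` A \<inter> space M |A. A \<in> sets (M' j)}"
  proof (rule indep_setI)
    show "{X i -` A \<inter> space M |A. A \<in> sets (M' i)} \<subseteq> events" "{X j -` A \<inter> space M |A. A \<in> sets (M' j)} \<subseteq> events"
      using measurable_sets[OF rv[OF ij(1)]] measurable_sets[OF rv[OF ij(2)]] by auto
    fix a b assume "a \<in> {X i -` A \<inter> space M |A. A \<in> sets (M' i)}" "b \<in> {X j -` A \<inter> space M |A. A \<in> sets (M' j)}"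
    then obtain A B where AB: "A \<in> sets (M' i)" "B \<in> sets (M' j)" "a = X i -` A \<inter> space M" "b = X j -` B \<inter> space M" by blast
    have "prob (\<Inter>l\<in>{i, j}. X l -` (if l = i then A else B) \<inter> space M) = (\<Prod>l\<in>{i, j}. prob (X l -` (if l = i then A else B) \<inter> space M))"
      by (rule indep_varsD[OF X]) (use ij AB in auto)
    then show "prob (a \<inter> b) = prob a * prob b" using ij AB by simp
  qed
  then show ?thesis unfolding indep_var_eq using rv ij st by (intro conjI indep_set_sigma_sets) auto
qed

lemma gauss_sum_PiM:
  fixes f :: "real^'n \<Rightarrow> ennreal"
  assumes s: "s > 0" and J: "finite J" "J \<noteq> {}" and "f \<in> borel_measurable borel"
  shows "(\<integral>\<^sup>+w. f (\<Sum>j\<in>J. w j) \<partial>PiM J (\<lambda>_. gauss s)) = (\<integral>\<^sup>+z. f z \<partial>gauss (real (card J) * s))"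
  using J assms(4)
proof (induction J arbitrary: f rule: finite_ne_induct)
  case (singleton i)
  interpret product_prob_space "\<lambda>_. gauss s :: (real^'n) measure" "{i}"
    by (intro product_prob_spaceI prob_space_gauss s)
  show ?case using product_nn_integral_singleton[of f i] singleton by simp
next
  case (insert i J)
  note [measurable] = insert.prems
  interpret product_prob_space "\<lambda>_. gauss s :: (real^'n) measure" J
    by (intro product_prob_spaceI prob_space_gauss s)
  interpret g: prob_space "gauss s :: (real^'n) measure" by (rule prob_space_gauss[OF s])
  have upd: "(\<Sum>j\<in>J. (w(i := y)) j) = (\<Sum>j\<in>J. w j)" for w and y :: "real^'n"
    using insert by (intro sum.cong) auto
  have c: "real (card J) * s > 0" using insert s by (simp add: card_gt_0_iff)
  have "(\<integral>\<^sup>+w. f (\<Sum>j\<in>insert i J. w j) \<partial>PiM (insert i J) (\<lambda>_. gauss s))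
    = (\<integral>\<^sup>+w. \<integral>\<^sup>+y. f (\<Sum>j\<in>insert i J. (w(i := y)) j) \<partial>gauss s \<partial>PiM J (\<lambda>_. gauss s))"
    using insert by (intro product_nn_integral_insert) auto
  also have "\<dots> = (\<integral>\<^sup>+w. (\<lambda>v. \<integral>\<^sup>+y. f (v + y) \<partial>gauss s) (\<Sum>j\<in>J. w j) \<partial>PiM J (\<lambda>_. gauss s))"
    using insert by (simp only: sum.insert upd fun_upd_same add.commute not_False_eq_True)
  also have "\<dots> = (\<integral>\<^sup>+v. \<integral>\<^sup>+y. f (v + y) \<partial>gauss s \<partial>gauss (real (card J) * s))"
    by (rule insert.IH) measurable
  also have "\<dots> = (\<integral>\<^sup>+z. f z \<partial>gauss (real (card J) * s + s))"
    by (rule gauss_convolution[OF c s]) measurable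
  also have "real (card J) * s + s = real (card (insert i J)) * s"
    using insert by (simp add: algebra_simps)
  finally show ?case .
qed

section \<open>Dyadic increments and their joint law\<close>

text \<open>Levy's midpoint displacement. At level \<open>n\<close> the interval \<open>k\<close>
  has length \<open>(1/2) ^ n\<close>; its halves \<open>2 * k\<close> and \<open>2 * k + 1\<close>
  receive half the parent increment plus or minus half a fresh Gaussian vector of the parent's
  variance.\<close>

fun dyadic_increment :: "nat \<Rightarrow> (nat \<times> nat \<Rightarrow> real^'n) \<Rightarrow> nat \<Rightarrow> real^'n" where
  "dyadic_increment 0 \<omega> k = \<omega> (0, k)"
| "dyadic_increment (Suc n) \<omega> k = (1/2) *\<^sub>R (dyadic_increment n \<omega> (k div 2)
     + (if even k then 1 else - 1) *\<^sub>R sqrt ((1/2) ^ n) *\<^sub>R \<omega> (Suc n, k div 2))"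

text \<open>Row \<open>0\<close> carries the increments on the grid of width \<open>(1/2) ^ n\<close>, the later rows the noise not yet
  consumed at level \<open>n\<close>; joint independence of all rows is what makes the induction on \<open>n\<close> work.\<close>

definition noise_row :: "nat \<Rightarrow> nat \<times> nat \<Rightarrow> (nat \<times> nat \<Rightarrow> real^'n) \<Rightarrow> real^'n" where
  "noise_row n p \<omega> = (case p of (0, k) \<Rightarrow> dyadic_increment n \<omega> k | (Suc i, k) \<Rightarrow> \<omega> (n + Suc i, k))"

abbreviation noise :: "(nat \<times> nat \<Rightarrow> real^'n) measure" where
  "noise \<equiv> PiM UNIV (\<lambda>_. gauss 1)"

lemma prob_space_noise: "prob_space noise"
  by (intro prob_space_PiM prob_space_gauss) simp

lemma noise_component: "distr noise borel (\<lambda>\<omega>. \<omega> p) = (gauss 1 :: (real^'n) measure)"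
proof -
  have "distr noise (gauss 1) (\<lambda>\<omega>. \<omega> p) = (gauss 1 :: (real^'n) measure)"
    by (rule distr_PiM_component) (auto intro: prob_space_gauss)
  moreover have "distr noise borel (\<lambda>\<omega>. \<omega> p) = distr noise (gauss 1 :: (real^'n) measure) (\<lambda>\<omega>. \<omega> p)"
    by (rule distr_cong) auto
  ultimately show ?thesis by (simp only:)
qed

lemma noise_component_measurable [measurable]: "(\<lambda>\<omega>. \<omega> p) \<in> borel_measurable noise"
proof -
  have "(\<lambda>\<omega>. \<omega> p) \<in> measurable noise (gauss 1)" by (rule measurable_component_singleton) simp
  then show ?thesis by (simp cong: measurable_cong_sets)
qed

lemma dyadic_increment_measurable [measurable]: "(\<lambda>\<omega>. dyadic_increment n \<omega> k) \<in> borel_measurable noise"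
  by (induction n arbitrary: k) simp_all

lemma noise_row_measurable [measurable]: "noise_row n p \<in> borel_measurable noise"
  unfolding noise_row_def by (cases p; cases "fst p") auto

text \<open>Passing to level \<open>n + 1\<close>, the parents in row 0 and the noise in row 1 are
  merged into the siblings of the new row 0 by a Gaussian rotation; all later rows move up by one
  unchanged.\<close>

lemma noise_row_indep:
  "prob_space.indep_vars noise (\<lambda>_. borel) (noise_row n :: _ \<Rightarrow> _ \<Rightarrow> real^'n) UNIV
   \<and> (\<forall>k. distr noise borel (\<lambda>\<omega>. dyadic_increment n \<omega> k) = (gauss ((1/2) ^ n) :: (real^'n) measure))"
proof (induction n)
  interpret prob_space "noise :: (nat \<times> nat \<Rightarrow> real^'n) measure" by (rule prob_space_noise)
  case 0
  have eq: "noise_row 0 p \<omega> = \<omega> p" for p and \<omega> :: "nat \<times> nat \<Rightarrow> real^'n"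
    by (cases p; cases "fst p") (auto simp: noise_row_def)
  have "indep_vars (\<lambda>_. borel) (\<lambda>p \<omega>. \<omega> p :: real^'n) (UNIV :: (nat \<times> nat) set)"
  proof (subst indep_vars_iff_distr_eq_PiM)
    show "distr noise (PiM UNIV (\<lambda>_. borel)) (\<lambda>\<omega>. \<lambda>i\<in>UNIV. \<omega> i :: real^'n) = PiM UNIV (\<lambda>p::nat\<times>nat. distr noise borel (\<lambda>\<omega>. \<omega> p))"
      unfolding noise_component
      by (simp add: restrict_UNIV, rule distr_id2) (rule sets_PiM_cong, auto)
  qed auto
  then show ?case by (simp add: eq noise_component eta_contract_eq)
next
  interpret prob_space "noise :: (nat \<times> nat \<Rightarrow> real^'n) measure" by (rule prob_space_noise)
  case (Suc n)
  define \<sigma> :: real where "\<sigma> = (1/2) ^ n"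
  have \<sigma>: "\<sigma> > 0" by (simp add: \<sigma>_def)
  \<comment> \<open>The variables of level \<open>n\<close> from which block \<open>l\<close> of
    level \<open>n + 1\<close> is computed: a parent with its noise, or a single untouched noise
    variable. \<open>bl\<close> sends a new index to its block, and \<open>f\<close> recomputes the
    new variable from the block.\<close>
  define K where "K l = (case l of (0::nat, k::nat) \<Rightarrow> {(0, k), (1, k)} | (Suc j, k) \<Rightarrow> {(Suc (Suc j), k)})" for l
  define bl where "bl p = (case p of (0::nat, k::nat) \<Rightarrow> (0, k div 2) | (Suc j, k) \<Rightarrow> (Suc j, k))" for p
  define f where "f p u = (case p of (0, k) \<Rightarrow> (1/2) *\<^sub>R (u (0::nat, k div 2) + (if even k then 1 else - 1) *\<^sub>R sqrt \<sigma> *\<^sub>R u (1::nat, k div 2))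
      | (Suc j, k) \<Rightarrow> u (Suc (Suc j), k))" for p :: "nat \<times> nat" and u :: "nat \<times> nat \<Rightarrow> real^'n"
  note IH = Suc.IH[THEN conjunct1] and IHd = Suc.IH[THEN conjunct2, rule_format]
  have disj: "disjoint_family_on K UNIV"
    by (auto simp: disjoint_family_on_def K_def split: prod.splits nat.splits)
  have U: "indep_vars (\<lambda>l. PiM (K l) (\<lambda>_. borel)) (\<lambda>l \<omega>. restrict (\<lambda>i. noise_row n i \<omega>) (K l)) UNIV"
    by (rule indep_vars_restrict[OF IH _ disj]) auto
  have pair: "(\<integral>\<^sup>+\<omega>. G (dyadic_increment (Suc n) \<omega> (2 * m)) (dyadic_increment (Suc n) \<omega> (2 * m + 1)) \<partial>noise)
      = (\<integral>\<^sup>+u. \<integral>\<^sup>+v. G u v \<partial>gauss (\<sigma>/2) \<partial>gauss (\<sigma>/2))"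
    if [measurable]: "case_prod G \<in> borel_measurable (borel \<Otimes>\<^sub>M borel)" for G :: "real^'n \<Rightarrow> real^'n \<Rightarrow> ennreal" and m
  proof -
    interpret g: prob_space "gauss \<sigma> :: (real^'n) measure" by (rule prob_space_gauss[OF \<sigma>])
    have "indep_var borel (noise_row n (0, m)) borel (noise_row n (1, m) :: _ \<Rightarrow> real^'n)"
      by (rule indep_vars_imp_indep_var[OF IH]) auto
    then have "indep_var borel (noise_row n (0, m)) borel ((\<lambda>z. sqrt \<sigma> *\<^sub>R z) \<circ> (noise_row n (1, m) :: _ \<Rightarrow> real^'n))"
      using indep_var_compose[where ?Y1.0=id and ?Y2.0="\<lambda>z. sqrt \<sigma> *\<^sub>R z" and ?N1.0=borel and ?N2.0=borel] by fastforce
    then have "indep_var borel (\<lambda>\<omega>. dyadic_increment n \<omega> m) borel (\<lambda>\<omega>. sqrt \<sigma> *\<^sub>R \<omega> (Suc n, m) :: real^'n)"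
      by (simp add: noise_row_def[abs_def] comp_def)
    then have J: "distr noise (borel \<Otimes>\<^sub>M borel) (\<lambda>\<omega>. (dyadic_increment n \<omega> m, sqrt \<sigma> *\<^sub>R \<omega> (Suc n, m) :: real^'n)) =
       distr noise borel (\<lambda>\<omega>. dyadic_increment n \<omega> m) \<Otimes>\<^sub>M distr noise borel (\<lambda>\<omega>. sqrt \<sigma> *\<^sub>R \<omega> (Suc n, m))"
      by (simp add: indep_var_distribution_eq)
    have "distr noise borel (\<lambda>\<omega>. sqrt \<sigma> *\<^sub>R \<omega> (Suc n, m)) = (gauss \<sigma> :: (real^'n) measure)"
    proof -
      have "distr noise borel (\<lambda>\<omega>. sqrt \<sigma> *\<^sub>R \<omega> (Suc n, m) :: real^'n) = distr (distr noise borel (\<lambda>\<omega>. \<omega> (Suc n, m))) borel (\<lambda>z. sqrt \<sigma> *\<^sub>R z)"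
        by (subst distr_distr) (auto simp: comp_def)
      also have "\<dots> = gauss \<sigma>"
        by (simp only: noise_component gauss_scale[OF \<sigma>])
      finally show ?thesis .
    qed
    with J IHd[of m] have J': "distr noise (borel \<Otimes>\<^sub>M borel) (\<lambda>\<omega>. (dyadic_increment n \<omega> m, sqrt \<sigma> *\<^sub>R \<omega> (Suc n, m) :: real^'n)) = gauss \<sigma> \<Otimes>\<^sub>M gauss \<sigma>"
      by (simp add: \<sigma>_def)
    have "(\<integral>\<^sup>+\<omega>. G (dyadic_increment (Suc n) \<omega> (2 * m)) (dyadic_increment (Suc n) \<omega> (2 * m + 1)) \<partial>noise)
      = (\<integral>\<^sup>+\<omega>. (\<lambda>(x, y). G ((1/2) *\<^sub>R (x + y)) ((1/2) *\<^sub>R (x - y))) (dyadic_increment n \<omega> m, sqrt \<sigma> *\<^sub>R \<omega> (Suc n, m)) \<partial>noise)"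
      by (simp add: \<sigma>_def)
    also have "\<dots> = (\<integral>\<^sup>+p. (\<lambda>(x, y). G ((1/2) *\<^sub>R (x + y)) ((1/2) *\<^sub>R (x - y))) p \<partial>distr noise (borel \<Otimes>\<^sub>M borel) (\<lambda>\<omega>. (dyadic_increment n \<omega> m, sqrt \<sigma> *\<^sub>R \<omega> (Suc n, m))))"
      by (rule nn_integral_distr[symmetric]) measurable
    also have "\<dots> = (\<integral>\<^sup>+x. \<integral>\<^sup>+y. G ((1/2) *\<^sub>R (x + y)) ((1/2) *\<^sub>R (x - y)) \<partial>gauss \<sigma> \<partial>gauss \<sigma>)"
      unfolding J' by (subst g.nn_integral_fst[symmetric]) auto
    also have "\<dots> = (\<integral>\<^sup>+u. \<integral>\<^sup>+v. G u v \<partial>gauss (\<sigma>/2) \<partial>gauss (\<sigma>/2))"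
      by (rule gauss_rotation[OF \<sigma>]) measurable
    finally show ?thesis .
  qed
  interpret g2: prob_space "gauss (\<sigma>/2) :: (real^'n) measure" by (rule prob_space_gauss) (use \<sigma> in simp)
  let ?d = "dyadic_increment (Suc n) :: _ \<Rightarrow> _ \<Rightarrow> real^'n"
  have pairP: "prob (((\<lambda>\<omega>. ?d \<omega> (2 * m)) -` A \<inter> space noise) \<inter> ((\<lambda>\<omega>. ?d \<omega> (2 * m + 1)) -` B \<inter> space noise))
      = measure (gauss (\<sigma>/2)) A * measure (gauss (\<sigma>/2)) B"
    if [measurable]: "A \<in> sets borel" "B \<in> sets borel" for A B :: "(real^'n) set" and m
  proof -
    let ?S = "((\<lambda>\<omega>. ?d \<omega> (2 * m)) -` A \<inter> space noise) \<inter> ((\<lambda>\<omega>. ?d \<omega> (2 * m + 1)) -` B \<inter> space noise)"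
    have "?S \<in> sets noise"
      by (intro sets.Int measurable_sets[OF dyadic_increment_measurable] that)
    then have "emeasure noise ?S = (\<integral>\<^sup>+\<omega>. indicator ?S \<omega> \<partial>noise)"
      by (rule nn_integral_indicator[symmetric])
    also have "\<dots> = (\<integral>\<^sup>+\<omega>. indicator A (?d \<omega> (2 * m)) * indicator B (?d \<omega> (2 * m + 1)) \<partial>noise)"
      by (rule nn_integral_cong) (auto simp: indicator_def simp del: dyadic_increment.simps)
    also have "\<dots> = (\<integral>\<^sup>+u. \<integral>\<^sup>+v. indicator A u * indicator B v \<partial>gauss (\<sigma>/2) \<partial>gauss (\<sigma>/2))"
      by (rule pair) measurable
    also have "\<dots> = emeasure (gauss (\<sigma>/2)) A * emeasure (gauss (\<sigma>/2)) B"
    proof -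
      have AB: "A \<in> sets (gauss (\<sigma>/2))" "B \<in> sets (gauss (\<sigma>/2))" using that by auto
      have "(\<integral>\<^sup>+v. indicator A u * indicator B v \<partial>gauss (\<sigma>/2)) = indicator A u * emeasure (gauss (\<sigma>/2)) B" for u
        by (subst nn_integral_cmult[OF borel_measurable_indicator[OF AB(2)]]) (simp only: nn_integral_indicator[OF AB(2)])
      then have "(\<integral>\<^sup>+u. \<integral>\<^sup>+v. indicator A u * indicator B v \<partial>gauss (\<sigma>/2) \<partial>gauss (\<sigma>/2)) = (\<integral>\<^sup>+u. indicator A u * emeasure (gauss (\<sigma>/2)) B \<partial>gauss (\<sigma>/2))"
        by (simp only:)
      also have "\<dots> = emeasure (gauss (\<sigma>/2)) A * emeasure (gauss (\<sigma>/2)) B"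
        by (subst nn_integral_multc[OF borel_measurable_indicator[OF AB(1)]]) (simp only: nn_integral_indicator[OF AB(1)])
      finally show ?thesis .
    qed
    finally show ?thesis
      by (simp add: emeasure_eq_measure g2.emeasure_eq_measure ennreal_mult[symmetric])
  qed
  have marg: "distr noise borel (\<lambda>\<omega>. ?d \<omega> k) = gauss (\<sigma>/2)" for k
  proof (rule measure_eqI)
    fix A assume "A \<in> sets (distr noise borel (\<lambda>\<omega>. ?d \<omega> k))"
    then have A: "A \<in> sets borel" by simp
    have "prob ((\<lambda>\<omega>. ?d \<omega> k) -` A \<inter> space noise) = measure (gauss (\<sigma>/2)) A"
    proof (cases "even k")
      case True
      then show ?thesis using pairP[OF A, of UNIV "k div 2"] g2.prob_space by (auto simp: Int_ac simp del: dyadic_increment.simps)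
    next
      case False
      then have "2 * (k div 2) + 1 = k" by presburger
      then show ?thesis using pairP[OF _ A, of UNIV "k div 2"] g2.prob_space by (auto simp: Int_ac simp del: dyadic_increment.simps)
    qed
    then show "emeasure (distr noise borel (\<lambda>\<omega>. ?d \<omega> k)) A = emeasure (gauss (\<sigma>/2)) A"
      using A by (simp add: emeasure_distr emeasure_eq_measure g2.emeasure_eq_measure del: dyadic_increment.simps)
  qed simp
  have "indep_vars (\<lambda>_. borel) (noise_row (Suc n) :: _ \<Rightarrow> _ \<Rightarrow> real^'n) UNIV"
  proof (rule indep_vars_refine[OF U, where b=bl and f=f])
    show "f p \<in> measurable (PiM (K (bl p)) (\<lambda>_. borel)) borel" for p
    proof (cases p)
      case (Pair i k)
      show ?thesis
      proof (cases i)
        case 0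
        have [measurable]: "(\<lambda>u. u (0, k div 2)) \<in> borel_measurable (PiM {(0, k div 2), (1, k div 2)} (\<lambda>_. borel :: (real^'n) measure))"
          "(\<lambda>u. u (1, k div 2)) \<in> borel_measurable (PiM {(0, k div 2), (1, k div 2)} (\<lambda>_. borel :: (real^'n) measure))"
          by (auto intro: measurable_component_singleton)
        show ?thesis unfolding Pair 0 f_def K_def bl_def by simp
      next
        case (Suc j)
        then show ?thesis unfolding Pair Suc f_def K_def bl_def by (auto intro: measurable_component_singleton)
      qed
    qed
    show "noise_row (Suc n) p \<omega> = f p (restrict (\<lambda>i. noise_row n i \<omega>) (K (bl p)))" for p and \<omega> :: "nat \<times> nat \<Rightarrow> real^'n"
      by (cases p; cases "fst p") (auto simp: noise_row_def f_def K_def bl_def \<sigma>_def)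
  next
    fix l J and B :: "nat \<times> nat \<Rightarrow> (real^'n) set"
    assume J: "J \<subseteq> {i \<in> UNIV. bl i = l}" "finite J" "J \<noteq> {}" and B: "\<And>j. j \<in> J \<Longrightarrow> B j \<in> sets borel"
    obtain i m where l: "l = (i, m)" by force
    show "prob (\<Inter>j\<in>J. noise_row (Suc n) j -` B j \<inter> space noise) = (\<Prod>j\<in>J. prob (noise_row (Suc n) j -` B j \<inter> space noise))"
    \<comment> \<open>A single index is trivial, and the only block with more than one index is a
      pair of siblings, covered by \<open>pairP\<close>.\<close>
    proof (cases "\<exists>p. J = {p}")
      case False
      have "J \<subseteq> {(0, 2 * m), (0, 2 * m + 1)}"
      proof (cases i)
        case 0
        have "p \<in> {(0, 2 * m), (0, 2 * m + 1)}" if "bl p = (0, m)" for p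
          using that by (cases p; cases "fst p") (auto simp: bl_def)
        then show ?thesis using J(1) l 0 by auto
      next
        case (Suc j)
        have "p = l" if "bl p = l" for p
          using that l Suc by (cases p; cases "fst p") (auto simp: bl_def)
        then have "J \<subseteq> {l}" using J(1) by auto
        then show ?thesis using J(3) False by blast
      qed
      then have Jeq: "J = {(0, 2 * m), (0, 2 * m + 1)}" using False J(3) by blast
      have nr: "noise_row (Suc n) (0, k) = (\<lambda>\<omega>. ?d \<omega> k)" for k by (auto simp: noise_row_def)
      have B': "B (0, 2 * m) \<in> sets borel" "B (0, 2 * m + 1) \<in> sets borel" using B Jeq by auto
      have one: "prob ((\<lambda>\<omega>. ?d \<omega> k) -` A \<inter> space noise) = measure (gauss (\<sigma>/2)) A" if "A \<in> sets borel" for k A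
        unfolding marg[of k, symmetric] using that by (subst measure_distr) (auto simp del: dyadic_increment.simps)
      have "prob (\<Inter>j\<in>J. noise_row (Suc n) j -` B j \<inter> space noise) = prob (((\<lambda>\<omega>. ?d \<omega> (2 * m)) -` B (0, 2 * m) \<inter> space noise) \<inter> ((\<lambda>\<omega>. ?d \<omega> (2 * m + 1)) -` B (0, 2 * m + 1) \<inter> space noise))"
        unfolding Jeq by (simp only: nr INT_insert INT_empty Int_UNIV_right)
      also have "\<dots> = (\<Prod>j\<in>J. prob (noise_row (Suc n) j -` B j \<inter> space noise))"
        unfolding Jeq pairP[OF B'] by (simp add: nr one B' B'[simplified] del: dyadic_increment.simps)
      finally show ?thesis .
    qed auto
  qed auto
  then show ?case using marg by (simp add: \<sigma>_def del: dyadic_increment.simps)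
qed

text \<open>The increments over disjoint index blocks are independent, and a sum of
  \<open>p (Suc i) - p i\<close> of them is Gaussian for the total elapsed time. Strict monotonicity
  of \<open>p\<close> keeps the blocks nonempty, since \<open>gauss\<close> is a Gaussian law only
  for positive time.\<close>

lemma dyadic_block_integral:
  fixes g :: "nat \<Rightarrow> real^'n \<Rightarrow> real"
  assumes p: "\<And>i. i < k \<Longrightarrow> p i < p (Suc i)"
    and g: "\<And>i. continuous_on UNIV (g i)" "\<And>i z. 0 \<le> g i z \<and> g i z \<le> 1"
  shows "(\<integral>\<omega>. (\<Prod>i<k. g i (\<Sum>l\<in>{p i..<p (Suc i)}. dyadic_increment n \<omega> l)) \<partial>noise)
    = (\<Prod>i<k. \<integral>z. g i z \<partial>gauss (real (p (Suc i) - p i) * (1/2) ^ n))"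
proof -
  interpret prob_space "noise :: (nat \<times> nat \<Rightarrow> real^'n) measure" by (rule prob_space_noise)
  have gm [measurable]: "g i \<in> borel_measurable borel" for i using g(1) by (intro borel_measurable_continuous_onI)
  have gmg: "g i \<in> borel_measurable (gauss t)" for i t
    by (subst measurable_cong_sets[OF sets_gauss refl]) (rule gm)
  define K where "K i = Pair (0::nat) ` {p i..<p (Suc i)}" for i
  have mono: "p i \<le> p j" if "i \<le> j" "j \<le> k" for i j
    using that
  proof (induction j rule: dec_induct)
    case (step j)
    then show ?case using p[of j] by simp
  qed simp
  have disj: "disjoint_family_on K {..<k}"
    unfolding disjoint_family_on_def
  proof (intro ballI impI)
    fix i j assume "i \<in> {..<k}" "j \<in> {..<k}" "i \<noteq> j"
    then have "p (Suc i) \<le> p j \<or> p (Suc j) \<le> p i" using mono[of "Suc i" j] mono[of "Suc j" i] by force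
    then show "K i \<inter> K j = {}" by (auto simp: K_def)
  qed
  have I: "indep_vars (\<lambda>_. borel) (noise_row n :: _ \<Rightarrow> _ \<Rightarrow> real^'n) UNIV"
    and D: "\<And>l. distr noise borel (\<lambda>\<omega>. dyadic_increment n \<omega> l) = (gauss ((1/2) ^ n) :: (real^'n) measure)"
    using noise_row_indep[of n] by auto
  have sumK: "(\<Sum>q\<in>K i. noise_row n q \<omega>) = (\<Sum>l\<in>{p i..<p (Suc i)}. dyadic_increment n \<omega> l)" for i and \<omega> :: "nat \<times> nat \<Rightarrow> real^'n"
    unfolding K_def by (subst sum.reindex) (auto simp: inj_on_def noise_row_def)
  have "indep_vars (\<lambda>j. PiM (K j) (\<lambda>_. borel)) (\<lambda>j \<omega>. restrict (\<lambda>q. noise_row n q \<omega> :: real^'n) (K j)) {..<k}"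
    by (rule indep_vars_restrict[OF I _ disj]) auto
  then have "indep_vars (\<lambda>_. borel) (\<lambda>j \<omega>. (\<lambda>u. g j (\<Sum>q\<in>K j. u q)) (restrict (\<lambda>q. noise_row n q \<omega>) (K j))) {..<k}"
  proof (rule indep_vars_compose2)
    show "(\<lambda>u. g j (\<Sum>q\<in>K j. u q)) \<in> borel_measurable (PiM (K j) (\<lambda>_. borel))" for j
    proof -
      have "(\<lambda>u. \<Sum>q\<in>K j. u q) \<in> borel_measurable (PiM (K j) (\<lambda>_. borel :: (real^'n) measure))"
        by (intro borel_measurable_sum measurable_component_singleton)
      from measurable_compose[OF this gm] show ?thesis .
    qed
  qed
  then have iv: "indep_vars (\<lambda>_. borel) (\<lambda>j \<omega>. g j (\<Sum>l\<in>{p j..<p (Suc j)}. dyadic_increment n \<omega> l)) {..<k}"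
    by (simp add: sumK)
  have m: "(\<lambda>\<omega>. g i (\<Sum>l\<in>{p i..<p (Suc i)}. dyadic_increment n \<omega> l)) \<in> borel_measurable noise" for i
    by measurable
  have "(\<integral>\<omega>. (\<Prod>i<k. g i (\<Sum>l\<in>{p i..<p (Suc i)}. dyadic_increment n \<omega> l)) \<partial>noise)
     = (\<Prod>i<k. \<integral>\<omega>. g i (\<Sum>l\<in>{p i..<p (Suc i)}. dyadic_increment n \<omega> l) \<partial>noise)"
  proof (rule indep_vars_lebesgue_integral[OF _ iv])
    show "integrable noise (\<lambda>\<omega>. g i (\<Sum>l\<in>{p i..<p (Suc i)}. dyadic_increment n \<omega> l))" for i
      by (rule integrable_const_bound[where B=1, OF AE_I2 m]) (use g(2) in auto)
  qed simp
  also have "\<dots> = (\<Prod>i<k. \<integral>z. g i z \<partial>gauss (real (p (Suc i) - p i) * (1/2) ^ n))"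
  proof (rule prod.cong[OF refl])
    fix i assume "i \<in> {..<k}"
    then have i: "p i < p (Suc i)" using p by simp
    have K: "finite (K i)" "K i \<noteq> {}" "card (K i) = p (Suc i) - p i"
      using i by (auto simp: K_def card_image inj_on_def)
    have law: "distr noise (PiM (K i) (\<lambda>_. borel)) (\<lambda>\<omega>. \<lambda>q\<in>K i. noise_row n q \<omega> :: real^'n) = PiM (K i) (\<lambda>_. gauss ((1/2) ^ n))"
    proof -
      have "distr noise (PiM (K i) (\<lambda>_. borel)) (\<lambda>\<omega>. \<lambda>q\<in>K i. noise_row n q \<omega> :: real^'n) = PiM (K i) (\<lambda>q. distr noise borel (noise_row n q))"
        using indep_vars_subset[OF I subset_UNIV] by (intro indep_vars_iff_distr_eq_PiM[THEN iffD1, OF K(2)]) auto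
      also have "\<dots> = PiM (K i) (\<lambda>_. gauss ((1/2) ^ n))"
      proof (rule PiM_cong[OF refl])
        fix q assume "q \<in> K i"
        then have "noise_row n q = (\<lambda>\<omega>. dyadic_increment n \<omega> (snd q) :: real^'n)" by (auto simp: K_def noise_row_def)
        then show "distr noise borel (noise_row n q) = (gauss ((1/2) ^ n) :: (real^'n) measure)" using D by simp
      qed
      finally show ?thesis .
    qed
    have "(\<integral>\<^sup>+\<omega>. ennreal (g i (\<Sum>l\<in>{p i..<p (Suc i)}. dyadic_increment n \<omega> l)) \<partial>noise)
      = (\<integral>\<^sup>+\<omega>. ennreal (g i (\<Sum>q\<in>K i. (\<lambda>q\<in>K i. noise_row n q \<omega>) q)) \<partial>noise)"
      by (simp add: sumK)
    also have "\<dots> = (\<integral>\<^sup>+w. ennreal (g i (\<Sum>q\<in>K i. w q)) \<partial>distr noise (PiM (K i) (\<lambda>_. borel)) (\<lambda>\<omega>. \<lambda>q\<in>K i. noise_row n q \<omega>))"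
    proof -
      have T: "(\<lambda>\<omega>. \<lambda>q\<in>K i. noise_row n q \<omega> :: real^'n) \<in> measurable noise (PiM (K i) (\<lambda>_. borel))"
        by (intro measurable_restrict noise_row_measurable)
      have "(\<lambda>u. \<Sum>q\<in>K i. u q) \<in> borel_measurable (PiM (K i) (\<lambda>_. borel :: (real^'n) measure))"
        by (intro borel_measurable_sum measurable_component_singleton)
      from measurable_compose[OF this gm] have "(\<lambda>w. ennreal (g i (\<Sum>q\<in>K i. w q))) \<in> borel_measurable (PiM (K i) (\<lambda>_. borel))"
        by simp
      then show ?thesis by (intro nn_integral_distr[symmetric] T) simp
    qed
    also have "\<dots> = (\<integral>\<^sup>+z. ennreal (g i z) \<partial>gauss (real (card (K i)) * (1/2) ^ n))"
      unfolding law by (rule gauss_sum_PiM) (use K in auto)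
    finally have "enn2real (\<integral>\<^sup>+\<omega>. ennreal (g i (\<Sum>l\<in>{p i..<p (Suc i)}. dyadic_increment n \<omega> l)) \<partial>noise)
       = enn2real (\<integral>\<^sup>+z. ennreal (g i z) \<partial>gauss (real (p (Suc i) - p i) * (1/2) ^ n))"
      using K(3) by simp
    then show "(\<integral>\<omega>. g i (\<Sum>l\<in>{p i..<p (Suc i)}. dyadic_increment n \<omega> l) \<partial>noise) = (\<integral>z. g i z \<partial>gauss (real (p (Suc i) - p i) * (1/2) ^ n))"
      using g(2) m[of i] gmg[of i] by (subst (1 2) integral_eq_nn_integral) auto
  qed
  finally show ?thesis .
qed

section \<open>Polygonal approximations and their refinement\<close>

definition polygon :: "(nat \<Rightarrow> 'a::real_normed_vector) \<Rightarrow> real \<Rightarrow> 'a" where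
  "polygon a s = (\<Sum>k<nat \<lfloor>s\<rfloor>. a k) + (s - real (nat \<lfloor>s\<rfloor>)) *\<^sub>R a (nat \<lfloor>s\<rfloor>)"

lemma polygon_of_nat [simp]: "polygon a (real j) = (\<Sum>k<j. a k)"
  by (simp add: polygon_def)

text \<open>A formula free of the floor function, from which continuity can be read off: each
  increment is multiplied by its clamped share of elapsed time.\<close>

lemma polygon_eq_clamp_sum:
  assumes s: "0 \<le> s" "s \<le> real N"
  shows "polygon a s = (\<Sum>k<N. max 0 (min 1 (s - real k)) *\<^sub>R a k)"
proof -
  define j where "j = nat \<lfloor>s\<rfloor>"
  have j: "real j \<le> s" "s < real j + 1" using s by (auto simp: j_def)
  have c: "(\<Sum>k<j. max 0 (min 1 (s - real k)) *\<^sub>R a k) = (\<Sum>k<j. a k)"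
  proof (intro sum.cong refl)
    fix k assume "k \<in> {..<j}"
    then have "real k + 1 \<le> real j" by simp
    then have "1 \<le> s - real k" using j by linarith
    then show "max 0 (min 1 (s - real k)) *\<^sub>R a k = a k" by simp
  qed
  show ?thesis
  proof (cases "j < N")
    case True
    have "(\<Sum>k<N. max 0 (min 1 (s - real k)) *\<^sub>R a k) = (\<Sum>k<Suc j. max 0 (min 1 (s - real k)) *\<^sub>R a k)"
    proof (rule sum.mono_neutral_right)
      show "\<forall>i\<in>{..<N} - {..<Suc j}. max 0 (min 1 (s - real i)) *\<^sub>R a i = 0"
      proof
        fix i assume "i \<in> {..<N} - {..<Suc j}"
        then have "real j + 1 \<le> real i" by simp
        then have "s - real i \<le> 0" using j by linarith
        then show "max 0 (min 1 (s - real i)) *\<^sub>R a i = 0" by simp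
      qed
    qed (use True in auto)
    also have "\<dots> = (\<Sum>k<j. a k) + (s - real j) *\<^sub>R a j"
      using c j by simp
    finally show ?thesis by (simp add: polygon_def j_def)
  next
    case False
    then have "j = N" "s = real N" using j s by auto
    then show ?thesis using c by simp
  qed
qed

lemma continuous_on_polygon: "continuous_on {0..real N} (polygon a)"
proof -
  have "continuous_on {0..real N} (\<lambda>s. \<Sum>k<N. max 0 (min 1 (s - real k)) *\<^sub>R a k)"
    by (intro continuous_intros)
  then show ?thesis
    by (rule continuous_on_eq) (rule polygon_eq_clamp_sum[symmetric], auto)
qed

text \<open>The noise cancels between siblings, so refinement keeps the values on the coarser
  grid.\<close>

lemma dyadic_increment_sum: "(\<Sum>k<2 * j. dyadic_increment (Suc n) \<omega> k) = (\<Sum>k<j. dyadic_increment n \<omega> k)"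
proof (induction j)
  case (Suc j)
  have "dyadic_increment (Suc n) \<omega> (2 * j) + dyadic_increment (Suc n) \<omega> (Suc (2 * j)) = dyadic_increment n \<omega> j"
    by (simp add: scaleR_add_right[symmetric] scaleR_2[symmetric])
  then show ?case using Suc by (simp add: add.assoc del: dyadic_increment.simps)
qed simp

text \<open>Two successive polygons agree at the coarse grid points; on an interval between them
  they differ by a tent function times the displacement at its midpoint.\<close>

lemma polygon_refinement:
  assumes s: "0 \<le> s"
  shows "norm (polygon (dyadic_increment (Suc n) \<omega>) (2 * s) - polygon (dyadic_increment n \<omega>) s)
    \<le> sqrt ((1/2) ^ n) * norm (\<omega> (Suc n, nat \<lfloor>s\<rfloor>))"
proof -
  define j where "j = nat \<lfloor>s\<rfloor>"
  define \<theta> where "\<theta> = s - real j"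
  define z where "z = sqrt ((1/2) ^ n) *\<^sub>R \<omega> (Suc n, j)"
  have "real j = of_int \<lfloor>s\<rfloor>" using s by (simp add: j_def)
  then have th: "0 \<le> \<theta>" "\<theta> < 1" unfolding \<theta>_def by linarith+
  have s': "s = real j + \<theta>" by (simp add: \<theta>_def)
  have P: "polygon (dyadic_increment n \<omega>) s = (\<Sum>k<j. dyadic_increment n \<omega> k) + \<theta> *\<^sub>R dyadic_increment n \<omega> j"
    by (simp add: polygon_def j_def \<theta>_def)
  have d: "dyadic_increment (Suc n) \<omega> (2 * j) = (1/2) *\<^sub>R (dyadic_increment n \<omega> j + z)"
    "dyadic_increment (Suc n) \<omega> (Suc (2 * j)) = (1/2) *\<^sub>R (dyadic_increment n \<omega> j - z)"
    by (simp_all add: z_def)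
  \<comment> \<open>The tent function: \<open>c = \<theta>\<close> on the first half of the interval
    and \<open>c = 1 - \<theta>\<close> on the second.\<close>
  have "\<exists>c. 0 \<le> c \<and> c \<le> 1 \<and> polygon (dyadic_increment (Suc n) \<omega>) (2 * s) - polygon (dyadic_increment n \<omega>) s = c *\<^sub>R z"
  proof (cases "\<theta> < 1/2")
    case True
    have f: "nat \<lfloor>2 * s\<rfloor> = 2 * j"
    proof -
      have "\<lfloor>2 * s\<rfloor> = int (2 * j)" using th True by (intro floor_unique) (auto simp: s')
      then show ?thesis by simp
    qed
    have "polygon (dyadic_increment (Suc n) \<omega>) (2 * s) = (\<Sum>k<j. dyadic_increment n \<omega> k) + (2 * \<theta>) *\<^sub>R ((1/2) *\<^sub>R (dyadic_increment n \<omega> j + z))"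
      unfolding polygon_def f dyadic_increment_sum d by (simp add: s')
    then have "polygon (dyadic_increment (Suc n) \<omega>) (2 * s) - polygon (dyadic_increment n \<omega>) s = \<theta> *\<^sub>R z"
      unfolding P by (simp add: algebra_simps)
    then show ?thesis using th by (intro exI[of _ \<theta>]) auto
  next
    case False
    have f: "nat \<lfloor>2 * s\<rfloor> = Suc (2 * j)"
    proof -
      have "\<lfloor>2 * s\<rfloor> = int (Suc (2 * j))" using th False by (intro floor_unique) (auto simp: s')
      then show ?thesis by simp
    qed
    have "polygon (dyadic_increment (Suc n) \<omega>) (2 * s) = (\<Sum>k<j. dyadic_increment n \<omega> k) + (1/2) *\<^sub>R (dyadic_increment n \<omega> j + z) + (2 * \<theta> - 1) *\<^sub>R ((1/2) *\<^sub>R (dyadic_increment n \<omega> j - z))"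
      unfolding polygon_def f sum.lessThan_Suc dyadic_increment_sum d by (simp add: s')
    then have "polygon (dyadic_increment (Suc n) \<omega>) (2 * s) - polygon (dyadic_increment n \<omega>) s = (1 - \<theta>) *\<^sub>R z"
      unfolding P by (simp add: vec_eq_iff algebra_simps)
    then show ?thesis using th by (intro exI[of _ "1 - \<theta>"]) auto
  qed
  then obtain c where c: "0 \<le> c" "c \<le> 1" "polygon (dyadic_increment (Suc n) \<omega>) (2 * s) - polygon (dyadic_increment n \<omega>) s = c *\<^sub>R z" by blast
  have "norm (c *\<^sub>R z) \<le> norm z" using c(1,2) by (simp add: mult_left_le_one_le)
  also have "norm z = sqrt ((1/2) ^ n) * norm (\<omega> (Suc n, j))" by (simp add: z_def)
  finally show ?thesis unfolding c(3) j_def .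
qed

section \<open>Almost sure uniform convergence\<close>

text \<open>A substitute for Gaussian tails and Borel-Cantelli: one almost surely finite sum bounds
  all noise variables at once. The exponent 8 is large enough: for \<open>k\<close> of order
  \<open>2 ^ n\<close> finiteness gives \<open>norm (\<omega> (n, k)) ^ 8\<close> of order
  \<open>2 ^ n * 4 ^ n = 8 ^ n\<close>, while the eighth power of the scale
  \<open>sqrt ((1/2) ^ n)\<close> is \<open>(1/2) ^ (4 * n)\<close>, which leaves a decay of
  \<open>(1/2) ^ n\<close>.\<close>

definition noise_size :: "(nat \<times> nat \<Rightarrow> real^'n) \<Rightarrow> ennreal" where
  "noise_size \<omega> = (\<Sum>n. \<Sum>k. ennreal ((1/2) ^ n * (1 / real (Suc k) ^ 2)) * ennreal (norm (\<omega> (n, k)) ^ 8))"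

lemma noise_size_measurable [measurable]: "noise_size \<in> borel_measurable noise"
  unfolding noise_size_def by measurable

lemma noise_size_finite: "AE \<omega> in noise. noise_size (\<omega> :: nat \<times> nat \<Rightarrow> real^'n) \<noteq> \<infinity>"
proof (rule nn_integral_PInf_AE)
  define m where "m = (\<integral>\<^sup>+z. ennreal (norm (z::real^'n) ^ 8) \<partial>gauss 1)"
  have "integrable (gauss 1) (\<lambda>z::real^'n. (1 + norm z) ^ 8)" by (rule gauss_poly_integrable) simp
  then have fin: "(\<integral>\<^sup>+z. ennreal ((1 + norm z) ^ 8) \<partial>(gauss 1 :: (real^'n) measure)) < \<infinity>"
    by (subst nn_integral_eq_integral) auto
  have "m \<le> (\<integral>\<^sup>+z. ennreal ((1 + norm z) ^ 8) \<partial>(gauss 1 :: (real^'n) measure))"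
    unfolding m_def by (intro nn_integral_mono ennreal_leI power_mono) auto
  with fin have m: "m < \<infinity>" by (rule order.strict_trans1[rotated])
  have c: "(\<integral>\<^sup>+\<omega>. ennreal (norm (\<omega> (n, k) :: real^'n) ^ 8) \<partial>noise) = m" for n k
  proof -
    have "m = (\<integral>\<^sup>+z. ennreal (norm z ^ 8) \<partial>distr noise borel (\<lambda>\<omega>. \<omega> (n, k) :: real^'n))"
      by (simp only: m_def noise_component)
    also have "\<dots> = (\<integral>\<^sup>+\<omega>. ennreal (norm (\<omega> (n, k) :: real^'n) ^ 8) \<partial>noise)"
      by (rule nn_integral_distr[OF noise_component_measurable]) simp
    finally show ?thesis ..
  qed
  have sq: "(\<Sum>k. ennreal (1 / real (Suc k) ^ 2)) < \<infinity>"
  proof -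
    have "summable (\<lambda>k. 1 / real (Suc k) ^ 2)"
    proof -
      have "summable (\<lambda>k. inverse (real k ^ 2))" by (rule inverse_power_summable) simp
      then have "summable (\<lambda>k. inverse (real (Suc k) ^ 2))"
        by (subst summable_Suc_iff)
      then show ?thesis by (simp only: inverse_eq_divide)
    qed
    then show ?thesis by (simp add: suminf_ennreal2 del: of_nat_Suc)
  qed
  have ge: "(\<Sum>n. ennreal ((1/2) ^ n)) < \<infinity>"
    by (subst suminf_ennreal2) auto
  have "(\<integral>\<^sup>+\<omega>. noise_size (\<omega> :: nat \<times> nat \<Rightarrow> real^'n) \<partial>noise) = (\<Sum>n. \<Sum>k. ennreal ((1/2) ^ n * (1 / real (Suc k) ^ 2)) * m)"
    unfolding noise_size_def by (simp add: nn_integral_suminf nn_integral_cmult c del: of_nat_Suc)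
  also have "\<dots> = (\<Sum>n. ennreal ((1/2) ^ n)) * ((\<Sum>k. ennreal (1 / real (Suc k) ^ 2)) * m)"
  proof -
    have "ennreal ((1/2) ^ n * (1 / real (Suc k) ^ 2)) * m = ennreal ((1/2) ^ n) * (ennreal (1 / real (Suc k) ^ 2) * m)" for n k
      by (subst ennreal_mult) (auto simp: mult.assoc)
    then show ?thesis by (simp only: ennreal_suminf_cmult ennreal_suminf_multc)
  qed
  also have "\<dots> < \<infinity>" using m sq ge by (simp add: ennreal_mult_less_top)
  finally show "(\<integral>\<^sup>+\<omega>. noise_size (\<omega> :: nat \<times> nat \<Rightarrow> real^'n) \<partial>noise) \<noteq> \<infinity>" by simp
qed simp

lemma noise_size_bound:
  assumes "noise_size \<omega> \<noteq> \<infinity>"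
  obtains C where "C \<ge> 0" "\<And>n k. norm (\<omega> (n, k)) ^ 8 \<le> C * 2 ^ n * real (Suc k) ^ 2"
proof
  define C where "C = enn2real (noise_size \<omega>)"
  have C: "noise_size \<omega> = ennreal C" using assms by (simp add: C_def less_top)
  show C0: "C \<ge> 0" by (simp add: C_def)
  fix n k
  let ?t = "\<lambda>n k. ennreal ((1/2) ^ n * (1 / real (Suc k) ^ 2)) * ennreal (norm (\<omega> (n, k)) ^ 8)"
  have "?t n k \<le> (\<Sum>k. ?t n k)"
    using sum_le_suminf[of "?t n" "{k}"] by (simp add: summableI)
  also have "\<dots> \<le> noise_size \<omega>"
    unfolding noise_size_def using sum_le_suminf[of "\<lambda>n. \<Sum>k. ?t n k" "{n}"] by (simp add: summableI)
  finally have le: "?t n k \<le> ennreal C" unfolding C .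
  have "0 \<le> (1/2) ^ n * (1 / real (Suc k) ^ 2)" "0 \<le> norm (\<omega> (n, k)) ^ 8" by auto
  then have "ennreal ((1/2) ^ n * (1 / real (Suc k) ^ 2) * norm (\<omega> (n, k)) ^ 8) \<le> ennreal C"
    using le by (simp only: ennreal_mult)
  then have "(1/2) ^ n * (1 / real (Suc k) ^ 2) * norm (\<omega> (n, k)) ^ 8 \<le> C"
    using C0 by (simp del: of_nat_Suc)
  then show "norm (\<omega> (n, k)) ^ 8 \<le> C * 2 ^ n * real (Suc k) ^ 2"
    by (simp add: power_one_over field_simps del: of_nat_Suc)
qed

definition levy_polygon :: "(nat \<times> nat \<Rightarrow> real^'n) \<Rightarrow> nat \<Rightarrow> real \<Rightarrow> real^'n" where
  "levy_polygon \<omega> n t = polygon (dyadic_increment n \<omega>) (2 ^ n * t)"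

definition levy_limit :: "(nat \<times> nat \<Rightarrow> real^'n) \<Rightarrow> real \<Rightarrow> real^'n" where
  "levy_limit \<omega> t = lim (\<lambda>n. levy_polygon \<omega> n t)"

text \<open>The Weierstrass test for the series of successive differences, whose sup norms on a
  bounded interval decay geometrically with ratio \<open>root 8 (1/2)\<close>.\<close>

lemma levy_uniform_limit:
  assumes "noise_size \<omega> \<noteq> \<infinity>"
  shows "uniform_limit {0..real N} (levy_polygon \<omega>) (levy_limit \<omega>) sequentially"
proof -
  obtain C where C: "C \<ge> 0" "\<And>n k. norm (\<omega> (n, k)) ^ 8 \<le> C * 2 ^ n * real (Suc k) ^ 2"
    using noise_size_bound[OF assms] by blast
  define f where "f n t = levy_polygon \<omega> (Suc n) t - levy_polygon \<omega> n t" for n t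
  define B where "B = 2 * C * (real N + 1) ^ 2"
  have B: "B \<ge> 0" using C by (simp add: B_def)
  have "norm (f n t) \<le> root 8 B * root 8 (1/2) ^ n" if t: "t \<in> {0..real N}" for n t
  proof -
    define s where "s = 2 ^ n * t"
    define k where "k = nat \<lfloor>s\<rfloor>"
    have s: "0 \<le> s" "s \<le> 2 ^ n * real N" using t by (auto simp: s_def)
    have "real k \<le> s" using s by (simp add: k_def)
    then have k: "real (Suc k) \<le> 2 ^ n * (real N + 1)"
    proof -
      have "(1::real) \<le> 2 ^ n" by simp
      with \<open>real k \<le> s\<close> s(2) show ?thesis unfolding distrib_left of_nat_Suc by linarith
    qed
    have "norm (f n t) \<le> sqrt ((1/2) ^ n) * norm (\<omega> (Suc n, k))"
      using polygon_refinement[OF s(1), of n \<omega>] by (simp add: f_def levy_polygon_def s_def k_def mult.assoc)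
    also have "\<dots> \<le> root 8 B * root 8 (1/2) ^ n"
    \<comment> \<open>Comparison of eighth powers: the rule speaks of the power
      \<open>Suc 7\<close>.\<close>
    proof (rule power_le_imp_le_base[where n=7])
      have r: "root 8 x ^ 8 = x" if "x \<ge> 0" for x using that by (intro real_root_pow_pos2) auto
      have sq: "sqrt ((1/2) ^ n) ^ 8 = ((1/2) ^ n) ^ 4"
        using power_mult[of "sqrt ((1/2) ^ n)" 2 4] by simp
      have "(sqrt ((1/2) ^ n) * norm (\<omega> (Suc n, k))) ^ 8 = ((1/2) ^ n) ^ 4 * norm (\<omega> (Suc n, k)) ^ 8"
        by (simp add: power_mult_distrib sq)
      also have "\<dots> \<le> ((1/2) ^ n) ^ 4 * (C * 2 ^ Suc n * real (Suc k) ^ 2)"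
        by (intro mult_left_mono C) simp
      also have "\<dots> \<le> ((1/2) ^ n) ^ 4 * (C * 2 ^ Suc n * (2 ^ n * (real N + 1)) ^ 2)"
        using k C by (intro mult_left_mono power_mono) auto
      also have "\<dots> = B * (1/2) ^ n"
      proof -
        have "((1/2::real) ^ n) * 2 ^ n = 1" by (simp add: power_mult_distrib[symmetric])
        then have q: "((1/2::real) ^ n) ^ 4 * (2 ^ n * (2 ^ n) ^ 2) = (1/2) ^ n"
        proof -
          have "h ^ 4 * (t * t ^ 2) = h * (h * t) ^ 3" for h t :: real by (simp add: eval_nat_numeral)
          from this[of "(1/2) ^ n" "2 ^ n"] \<open>((1/2::real) ^ n) * 2 ^ n = 1\<close> show ?thesis by (simp only: power_one mult_1_right)
        qed
        have "((1/2) ^ n) ^ 4 * (C * 2 ^ Suc n * (2 ^ n * (real N + 1)) ^ 2) = (((1/2::real) ^ n) ^ 4 * (2 ^ n * (2 ^ n) ^ 2)) * B"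
          by (simp add: B_def power_mult_distrib ac_simps)
        then show ?thesis unfolding q by simp
      qed
      also have "\<dots> = (root 8 B * root 8 (1/2) ^ n) ^ 8"
        using B by (simp add: power_mult_distrib r power_mult[symmetric] mult.commute[of n]) (simp add: power_mult r)
      finally show "(sqrt ((1/2) ^ n) * norm (\<omega> (Suc n, k))) ^ Suc 7 \<le> (root 8 B * root 8 (1/2) ^ n) ^ Suc 7" by simp
      show "0 \<le> root 8 B * root 8 (1/2) ^ n" using B by simp
    qed
    finally show ?thesis .
  qed
  moreover have "summable (\<lambda>n. root 8 B * root 8 (1/2) ^ n)"
    by (intro summable_mult summable_geometric) simp
  ultimately have u: "uniform_limit {0..real N} (\<lambda>n t. \<Sum>i<n. f i t) (\<lambda>t. suminf (\<lambda>i. f i t)) sequentially"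
    by (rule Weierstrass_m_test)
  have "uniform_limit {0..real N} (\<lambda>n t. levy_polygon \<omega> 0 t + (\<Sum>i<n. f i t)) (\<lambda>t. levy_polygon \<omega> 0 t + suminf (\<lambda>i. f i t)) sequentially"
    by (intro uniform_limit_intros u)
  moreover have "levy_polygon \<omega> 0 t + (\<Sum>i<n. f i t) = levy_polygon \<omega> n t" for n t
    using sum_lessThan_telescope[of "\<lambda>i. levy_polygon \<omega> i t" n] by (simp add: f_def)
  ultimately have u2: "uniform_limit {0..real N} (levy_polygon \<omega>) (\<lambda>t. levy_polygon \<omega> 0 t + suminf (\<lambda>i. f i t)) sequentially"
    by simp
  have "levy_limit \<omega> t = levy_polygon \<omega> 0 t + suminf (\<lambda>i. f i t)" if "t \<in> {0..real N}" for t
    unfolding levy_limit_def using tendsto_uniform_limitI[OF u2 that] by (rule limI)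
  then show ?thesis
    using u2 by (subst uniform_limit_cong'[where g="levy_polygon \<omega>" and i="\<lambda>t. levy_polygon \<omega> 0 t + suminf (\<lambda>i. f i t)"]) auto
qed

lemma levy_continuous:
  assumes "noise_size \<omega> \<noteq> \<infinity>"
  shows "continuous_on {0..real N} (levy_limit \<omega>)"
proof (rule uniform_limit_theorem[OF _ levy_uniform_limit[OF assms]])
  have "continuous_on {0..real N} (levy_polygon \<omega> n)" for n
    unfolding levy_polygon_def
    by (rule continuous_on_compose2[OF continuous_on_polygon[of "2 ^ n * N"]]) (auto intro!: continuous_intros)
  then show "\<forall>\<^sub>F n in sequentially. continuous_on {0..real N} (levy_polygon \<omega> n)" by simp
qed simp

text \<open>Needed because a time \<open>t\<close> is approached by dyadic times that move with the
  level.\<close>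

lemma tendsto_uniform_limit_compose:
  fixes f :: "nat \<Rightarrow> real \<Rightarrow> 'a::real_normed_vector"
  assumes u: "uniform_limit S f l sequentially" and c: "continuous_on S l"
    and t: "\<And>n. \<tau> n \<in> S" "\<tau> \<longlonglongrightarrow> t" "t \<in> S"
  shows "(\<lambda>n. f n (\<tau> n)) \<longlonglongrightarrow> l t"
proof -
  have "(\<lambda>n. l (\<tau> n)) \<longlonglongrightarrow> l t"
    by (rule continuous_on_tendsto_compose[OF c t(2,3)]) (use t(1) in auto)
  moreover have "(\<lambda>n. f n (\<tau> n) - l (\<tau> n)) \<longlonglongrightarrow> 0"
  proof (rule LIMSEQ_I)
    fix e :: real assume "e > 0"
    from uniform_limitD[OF u this] obtain N where "\<And>n x. n \<ge> N \<Longrightarrow> x \<in> S \<Longrightarrow> dist (f n x) (l x) < e"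
      by (auto simp: eventually_sequentially)
    then show "\<exists>no. \<forall>n\<ge>no. norm (f n (\<tau> n) - l (\<tau> n) - 0) < e"
      using t(1) by (auto simp: dist_norm)
  qed
  ultimately have "(\<lambda>n. (f n (\<tau> n) - l (\<tau> n)) + l (\<tau> n)) \<longlonglongrightarrow> 0 + l t" by (rule tendsto_add[rotated])
  then show ?thesis by simp
qed

definition dyadic_floor :: "nat \<Rightarrow> real \<Rightarrow> nat" where
  "dyadic_floor n t = nat \<lfloor>2 ^ n * t\<rfloor>"

lemma dyadic_floor_tendsto:
  assumes t: "t \<ge> 0"
  shows "(\<lambda>n. real (dyadic_floor n t) * (1/2) ^ n) \<longlonglongrightarrow> t" "real (dyadic_floor n t) * (1/2) ^ n \<le> t"
proof -
  have p: "(2::real) ^ n * (1/2) ^ n = 1" for n by (simp add: power_mult_distrib[symmetric])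
  have d: "real (dyadic_floor n t) = of_int \<lfloor>2 ^ n * t\<rfloor>" for n using t by (simp add: dyadic_floor_def)
  have up: "real (dyadic_floor n t) * (1/2) ^ n \<le> t" for n
  proof -
    have "real (dyadic_floor n t) \<le> 2 ^ n * t" unfolding d by (rule of_int_floor_le)
    then have "real (dyadic_floor n t) * (1/2) ^ n \<le> (2 ^ n * t) * (1/2) ^ n" by (intro mult_right_mono) auto
    also have "(2 ^ n * t) * (1/2) ^ n = t" using p[of n] by (simp add: ac_simps)
    finally show ?thesis .
  qed
  show "real (dyadic_floor n t) * (1/2) ^ n \<le> t" by (rule up)
  have lo: "t - (1/2) ^ n \<le> real (dyadic_floor n t) * (1/2) ^ n" for n
  proof -
    have "2 ^ n * t - 1 \<le> real (dyadic_floor n t)" unfolding d by linarith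
    then have "(2 ^ n * t - 1) * (1/2) ^ n \<le> real (dyadic_floor n t) * (1/2) ^ n" by (intro mult_right_mono) auto
    also have "(2 ^ n * t - 1) * (1/2) ^ n = t * (2 ^ n * (1/2) ^ n) - (1/2) ^ n" by (simp add: algebra_simps)
    finally show ?thesis unfolding p by simp
  qed
  show "(\<lambda>n. real (dyadic_floor n t) * (1/2) ^ n) \<longlonglongrightarrow> t"
  proof (rule tendsto_sandwich)
    show "\<forall>\<^sub>F n in sequentially. t - (1/2) ^ n \<le> real (dyadic_floor n t) * (1/2) ^ n"
      "\<forall>\<^sub>F n in sequentially. real (dyadic_floor n t) * (1/2) ^ n \<le> t"
      using lo up by auto
    have "(\<lambda>n. t - (1/2) ^ n) \<longlonglongrightarrow> t - 0"
      by (intro tendsto_intros LIMSEQ_realpow_zero) auto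
    then show "(\<lambda>n. t - (1/2) ^ n) \<longlonglongrightarrow> t" by simp
  qed simp
qed

text \<open>At grid times the polygon is a plain partial sum of increments, whose law is known; this
  links the limit path with the finite levels.\<close>

lemma levy_limit_dyadic:
  assumes g: "noise_size \<omega> \<noteq> \<infinity>" and t: "t \<ge> 0"
  shows "(\<lambda>n. \<Sum>l<dyadic_floor n t. dyadic_increment n \<omega> l) \<longlonglongrightarrow> levy_limit \<omega> t"
proof -
  obtain N :: nat where N: "t \<le> real N" using real_arch_simple by blast
  have "(\<lambda>n. levy_polygon \<omega> n (real (dyadic_floor n t) * (1/2) ^ n)) \<longlonglongrightarrow> levy_limit \<omega> t"
  proof (rule tendsto_uniform_limit_compose[OF levy_uniform_limit[OF g, of N] levy_continuous[OF g]])
    show "real (dyadic_floor n t) * (1/2) ^ n \<in> {0..real N}" for n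
      using dyadic_floor_tendsto(2)[OF t, of n] N by auto
  qed (use dyadic_floor_tendsto(1)[OF t] t N in auto)
  moreover have "levy_polygon \<omega> n (real (dyadic_floor n t) * (1/2) ^ n) = (\<Sum>l<dyadic_floor n t. dyadic_increment n \<omega> l)" for n
  proof -
    have "2 ^ n * (real (dyadic_floor n t) * (1/2) ^ n) = real (dyadic_floor n t)"
      by (simp add: power_one_over)
    then show ?thesis by (simp only: levy_polygon_def polygon_of_nat)
  qed
  ultimately show ?thesis by simp
qed

text \<open>Scaling moves the dependence on the variance into the continuous integrand, where
  dominated convergence applies.\<close>

lemma gauss_integral_tendsto:
  fixes g :: "real^'n \<Rightarrow> real"
  assumes g: "continuous_on UNIV g" "\<And>z. 0 \<le> g z \<and> g z \<le> 1"
    and s: "\<sigma> \<longlonglongrightarrow> s" "s > 0"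
  shows "(\<lambda>n. \<integral>z. g z \<partial>gauss (\<sigma> n)) \<longlonglongrightarrow> (\<integral>z. g z \<partial>gauss s)"
proof -
  interpret prob_space "gauss 1 :: (real^'n) measure" by (rule prob_space_gauss) simp
  have gm [measurable]: "g \<in> borel_measurable borel" using g(1) by (intro borel_measurable_continuous_onI)
  have eq: "(\<integral>z. g z \<partial>gauss r) = (\<integral>z. g (sqrt r *\<^sub>R z) \<partial>gauss 1)" if "r > 0" for r
  proof -
    have "(\<lambda>z::real^'n. sqrt r *\<^sub>R z) \<in> borel_measurable (gauss 1)"
      by (subst measurable_cong_sets[OF sets_gauss refl]) simp
    then show ?thesis unfolding gauss_scale[OF that] by (rule integral_distr[OF _ gm])
  qed
  have mm: "(\<lambda>z. g (sqrt r *\<^sub>R z)) \<in> borel_measurable (gauss 1)" for r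
  proof (subst measurable_cong_sets[OF sets_gauss refl], rule measurable_compose[OF _ gm])
    show "(\<lambda>z::real^'n. sqrt r *\<^sub>R z) \<in> borel_measurable borel" by simp
  qed
  have "(\<lambda>n. \<integral>z. g (sqrt (\<sigma> n) *\<^sub>R z) \<partial>gauss 1) \<longlonglongrightarrow> (\<integral>z. g (sqrt s *\<^sub>R z) \<partial>gauss 1)"
  proof (rule integral_dominated_convergence[where w="\<lambda>_. 1"])
    show "AE z in gauss 1. (\<lambda>n. g (sqrt (\<sigma> n) *\<^sub>R z)) \<longlonglongrightarrow> g (sqrt s *\<^sub>R z)"
    proof (rule AE_I2)
      fix z :: "real^'n"
      have "(\<lambda>n. sqrt (\<sigma> n) *\<^sub>R z) \<longlonglongrightarrow> sqrt s *\<^sub>R z" by (intro tendsto_intros s)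
      then show "(\<lambda>n. g (sqrt (\<sigma> n) *\<^sub>R z)) \<longlonglongrightarrow> g (sqrt s *\<^sub>R z)"
        by (rule continuous_on_tendsto_compose[OF g(1)]) auto
    qed
  qed (use g(2) mm in auto)
  moreover have "\<forall>\<^sub>F n in sequentially. \<sigma> n > 0" using s by (rule order_tendstoD(1))
  then have "\<forall>\<^sub>F n in sequentially. (\<integral>z. g (sqrt (\<sigma> n) *\<^sub>R z) \<partial>gauss 1) = (\<integral>z. g z \<partial>gauss (\<sigma> n))"
    by eventually_elim (simp add: eq)
  ultimately show ?thesis unfolding eq[OF s(2)] by (rule Lim_transform_eventually)
qed

section \<open>The limit path and its law\<close>

text \<open>On the exceptional event the constant path is used, so that every outcome, and not only
  almost every one, lies in \<open>paths x\<close>. This is required for the law to live on the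
  restricted space.\<close>

definition levy_path :: "real^'n \<Rightarrow> (nat \<times> nat \<Rightarrow> real^'n) \<Rightarrow> real \<Rightarrow> real^'n" where
  "levy_path x \<omega> t = (if noise_size \<omega> \<noteq> \<infinity> \<and> 0 \<le> t then x + levy_limit \<omega> t else x)"

lemma levy_path_in_paths: "levy_path x \<omega> \<in> paths x"
proof (cases "noise_size \<omega> \<noteq> \<infinity>")
  case True
  have "continuous_on {0..} (levy_limit \<omega>)"
    unfolding continuous_on_eq_continuous_within
  proof
    fix t :: real assume t: "t \<in> {0..}"
    obtain N :: nat where N: "t < real N" using reals_Archimedean2 by blast
    have "continuous (at t within {0..real N}) (levy_limit \<omega>)"
      using levy_continuous[OF True, of N] t N by (simp add: continuous_on_eq_continuous_within)
    moreover have "at t within {0..real N} = at t within {0..}"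
      by (rule at_within_nhd[where S="{..<real N}"]) (use N in auto)
    ultimately show "continuous (at t within {0..}) (levy_limit \<omega>)" by simp
  qed
  then have "continuous_on {0..} (\<lambda>t. x + levy_limit \<omega> t)" by (intro continuous_intros)
  then have "continuous_on {0..} (levy_path x \<omega>)"
    by (rule continuous_on_eq) (use True in \<open>simp add: levy_path_def\<close>)
  moreover have "levy_limit \<omega> 0 = 0"
  proof -
    have "levy_polygon \<omega> n 0 = 0" for n by (simp add: levy_polygon_def polygon_def)
    then show ?thesis by (simp add: levy_limit_def)
  qed
  ultimately show ?thesis by (simp add: paths_def levy_path_def)
next
  case False
  then have "levy_path x \<omega> = (\<lambda>_. x)" by (auto simp: levy_path_def)
  then show ?thesis by (simp add: paths_def)
qed

lemma levy_path_component_measurable [measurable]: "(\<lambda>\<omega>. levy_path x \<omega> t) \<in> borel_measurable noise"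
proof -
  have "(\<lambda>\<omega>. levy_polygon \<omega> n t) \<in> borel_measurable noise" for n
    unfolding levy_polygon_def polygon_def by measurable
  then have [measurable]: "(\<lambda>\<omega>. levy_limit \<omega> t) \<in> borel_measurable noise"
    unfolding levy_limit_def by (rule borel_measurable_lim_metric)
  show ?thesis unfolding levy_path_def by measurable
qed

text \<open>The times \<open>ts i\<close> are replaced by dyadic times from below. There the
  increments are block sums with a known joint law, and the integrals of continuous test functions
  converge on both sides.\<close>

lemma BM_exists: "\<exists>M. is_BM (x::real^'n) M"
proof
  let ?R = "restrict_space (PiM UNIV (\<lambda>_. borel)) (paths x)"
  let ?M = "distr noise ?R (levy_path x)"
  interpret prob_space "noise :: (nat \<times> nat \<Rightarrow> real^'n) measure" by (rule prob_space_noise)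
  have "(\<lambda>\<omega> t. levy_path x \<omega> t) \<in> measurable noise (PiM UNIV (\<lambda>_. borel))"
    by (rule measurable_abs_UNIV) (rule levy_path_component_measurable)
  then have T: "levy_path x \<in> measurable noise ?R"
    by (intro measurable_restrict_space2) (auto simp: levy_path_in_paths)
  show "is_BM x ?M"
  proof (rule is_BM_I)
    show "prob_space ?M" by (rule prob_space_distr[OF T])
    show "sets ?M = sets ?R" by simp
    fix ts :: "nat \<Rightarrow> real" and k and g :: "nat \<Rightarrow> real^'n \<Rightarrow> real"
    assume ts0: "ts 0 = 0" and ts: "\<And>i. i < k \<Longrightarrow> ts i < ts (Suc i)"
      and g: "\<And>i. continuous_on UNIV (g i)" "\<And>i z. 0 \<le> g i z \<and> g i z \<le> 1"
    have gm [measurable]: "g i \<in> borel_measurable borel" for i using g(1) by (intro borel_measurable_continuous_onI)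
    have pos: "0 \<le> ts i" if "i \<le> k" for i
      using that
    proof (induction i)
      case (Suc i)
      then show ?case using ts[of i] by simp
    qed (simp add: ts0)
    define p where "p n i = dyadic_floor n (ts i)" for n i
    have lim: "(\<lambda>n. real (p n i) * (1/2) ^ n) \<longlonglongrightarrow> ts i" if "i \<le> k" for i
      unfolding p_def by (rule dyadic_floor_tendsto[OF pos[OF that]])
    have dlim: "(\<lambda>n. (real (p n (Suc i)) - real (p n i)) * (1/2) ^ n) \<longlonglongrightarrow> ts (Suc i) - ts i" if "i < k" for i
      using tendsto_diff[OF lim[of "Suc i"] lim[of i]] that by (simp add: left_diff_distrib)
    \<comment> \<open>Distinct times occupy distinct grid cells only at fine levels, so the block
      formula holds eventually in \<open>n\<close>.\<close>
    have ev: "\<forall>\<^sub>F n in sequentially. \<forall>i\<in>{..<k}. p n i < p n (Suc i)"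
    proof (rule eventually_ball_finite)
      show "\<forall>i\<in>{..<k}. \<forall>\<^sub>F n in sequentially. p n i < p n (Suc i)"
      proof
        fix i assume "i \<in> {..<k}"
        then have i: "i < k" by simp
        have "\<forall>\<^sub>F n in sequentially. 0 < (real (p n (Suc i)) - real (p n i)) * (1/2) ^ n"
          using dlim[OF i] ts[OF i] by (intro order_tendstoD(1)) auto
        then show "\<forall>\<^sub>F n in sequentially. p n i < p n (Suc i)"
          by eventually_elim (simp add: zero_less_mult_iff)
      qed
    qed simp
    let ?Y = "\<lambda>n \<omega>. \<Prod>i<k. g i (\<Sum>l\<in>{p n i..<p n (Suc i)}. dyadic_increment n \<omega> l)"
    let ?W = "\<lambda>\<omega>. \<Prod>i<k. g i (levy_path x \<omega> (ts (Suc i)) - levy_path x \<omega> (ts i))"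
    have "(\<lambda>n. \<integral>\<omega>. ?Y n \<omega> \<partial>noise) \<longlonglongrightarrow> (\<integral>\<omega>. ?W \<omega> \<partial>noise)"
    proof (rule integral_dominated_convergence[where w="\<lambda>_. 1"])
      show "?W \<in> borel_measurable noise" "\<And>n. ?Y n \<in> borel_measurable noise" by measurable
      show "AE \<omega> in noise. norm (?Y n \<omega>) \<le> 1" for n
        using g(2) by (intro AE_I2) (simp add: prod_nonneg prod_le_1 abs_of_nonneg)
      show "AE \<omega> in noise. (\<lambda>n. ?Y n \<omega>) \<longlonglongrightarrow> ?W \<omega>"
        using noise_size_finite
      proof eventually_elim
        case (elim \<omega>)
        show ?case
        proof (rule tendsto_prod)
          fix i assume "i \<in> {..<k}"
          then have i: "i < k" by simp
          have "(\<lambda>n. (\<Sum>l<p n (Suc i). dyadic_increment n \<omega> l) - (\<Sum>l<p n i. dyadic_increment n \<omega> l)) \<longlonglongrightarrow> levy_limit \<omega> (ts (Suc i)) - levy_limit \<omega> (ts i)"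
            unfolding p_def using i by (intro tendsto_diff levy_limit_dyadic elim pos) auto
          moreover have "\<forall>\<^sub>F n in sequentially. (\<Sum>l<p n (Suc i). dyadic_increment n \<omega> l) - (\<Sum>l<p n i. dyadic_increment n \<omega> l) = (\<Sum>l\<in>{p n i..<p n (Suc i)}. dyadic_increment n \<omega> l)"
            using ev
          proof eventually_elim
            case (elim n)
            then have "p n i \<le> p n (Suc i)" using i by (simp add: less_imp_le)
            then show ?case
              using sum_diff_nat_ivl[of 0 "p n i" "p n (Suc i)" "dyadic_increment n \<omega>"] by (simp add: lessThan_atLeast0)
          qed
          ultimately have "(\<lambda>n. \<Sum>l\<in>{p n i..<p n (Suc i)}. dyadic_increment n \<omega> l) \<longlonglongrightarrow> levy_limit \<omega> (ts (Suc i)) - levy_limit \<omega> (ts i)"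
            by (rule Lim_transform_eventually)
          then have "(\<lambda>n. g i (\<Sum>l\<in>{p n i..<p n (Suc i)}. dyadic_increment n \<omega> l)) \<longlonglongrightarrow> g i (levy_limit \<omega> (ts (Suc i)) - levy_limit \<omega> (ts i))"
            by (rule continuous_on_tendsto_compose[OF g(1)]) auto
          moreover have "levy_path x \<omega> (ts (Suc i)) - levy_path x \<omega> (ts i) = levy_limit \<omega> (ts (Suc i)) - levy_limit \<omega> (ts i)"
            using elim pos[of i] pos[of "Suc i"] i by (simp add: levy_path_def)
          ultimately show "(\<lambda>n. g i (\<Sum>l\<in>{p n i..<p n (Suc i)}. dyadic_increment n \<omega> l)) \<longlonglongrightarrow> g i (levy_path x \<omega> (ts (Suc i)) - levy_path x \<omega> (ts i))"
            by simp
        qed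
      qed
    qed simp
    moreover have "(\<lambda>n. \<integral>\<omega>. ?Y n \<omega> \<partial>noise) \<longlonglongrightarrow> (\<Prod>i<k. \<integral>z. g i z \<partial>gauss (ts (Suc i) - ts i))"
    proof (rule Lim_transform_eventually)
      show "(\<lambda>n. \<Prod>i<k. \<integral>z. g i z \<partial>gauss ((real (p n (Suc i)) - real (p n i)) * (1/2) ^ n)) \<longlonglongrightarrow> (\<Prod>i<k. \<integral>z. g i z \<partial>gauss (ts (Suc i) - ts i))"
        by (intro tendsto_prod gauss_integral_tendsto g dlim) (use ts in auto)
      show "\<forall>\<^sub>F n in sequentially. (\<Prod>i<k. \<integral>z. g i z \<partial>gauss ((real (p n (Suc i)) - real (p n i)) * (1/2) ^ n)) = (\<integral>\<omega>. ?Y n \<omega> \<partial>noise)"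
        using ev
      proof eventually_elim
        case (elim n)
        have "(\<integral>\<omega>. ?Y n \<omega> \<partial>noise) = (\<Prod>i<k. \<integral>z. g i z \<partial>gauss (real (p n (Suc i) - p n i) * (1/2) ^ n))"
          by (rule dyadic_block_integral) (use elim g in auto)
        also have "\<dots> = (\<Prod>i<k. \<integral>z. g i z \<partial>gauss ((real (p n (Suc i)) - real (p n i)) * (1/2) ^ n))"
          by (intro prod.cong refl) (use elim in \<open>simp add: of_nat_diff less_imp_le\<close>)
        finally show ?case ..
      qed
    qed
    ultimately have "(\<integral>\<omega>. ?W \<omega> \<partial>noise) = (\<Prod>i<k. \<integral>z. g i z \<partial>gauss (ts (Suc i) - ts i))"
      by (rule LIMSEQ_unique)
    moreover have "(\<integral>w. (\<Prod>i<k. g i (w (ts (Suc i)) - w (ts i))) \<partial>?M) = (\<integral>\<omega>. ?W \<omega> \<partial>noise)"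
    proof (rule integral_distr[OF T])
      have [measurable]: "(\<lambda>w. w t) \<in> borel_measurable ?R" for t
        by (intro measurable_restrict_space1 measurable_component_singleton) simp
      show "(\<lambda>w. \<Prod>i<k. g i (w (ts (Suc i)) - w (ts i))) \<in> borel_measurable ?R" by measurable
    qed
    ultimately show "(\<integral>w. (\<Prod>i<k. g i (w (ts (Suc i)) - w (ts i))) \<partial>?M) = (\<Prod>i<k. \<integral>z. g i z \<partial>gauss (ts (Suc i) - ts i))"
      by simp
  qed
qed

declare noise_component_measurable [measurable del]

section \<open>The kernel near the singularity\<close>

lemma Wiener_BM: "is_BM x (Wiener x)"
  unfolding Wiener_def by (rule someI_ex[OF BM_exists])

text \<open>The continuous stand-in for \<open>V\<close>, with \<open>\<sigma> = - C\<close> in part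
  (i) and \<open>\<sigma> = C\<close> in part (ii).\<close>

definition singular_potential :: "real \<Rightarrow> real \<Rightarrow> real \<Rightarrow> real^'n \<Rightarrow> real" where
  "singular_potential \<beta> \<kappa> \<sigma> x = \<kappa> / norm x powr (2 + 2 * \<beta>) + \<sigma> / norm x powr (2 + \<beta>)"

lemma singular_potential_measurable [measurable]: "singular_potential \<beta> \<kappa> \<sigma> \<in> borel_measurable borel"
  unfolding singular_potential_def by measurable

lemma singular_potential_continuous: "continuous_on (- {0}) (singular_potential \<beta> \<kappa> \<sigma>)"
  unfolding singular_potential_def by (intro continuous_intros) auto

lemma singular_potential_bounded:
  assumes "compact K" "0 \<notin> K"
  shows "bounded (singular_potential \<beta> \<kappa> \<sigma> ` K)"
  using assms by (intro compact_imp_bounded compact_continuous_image continuous_on_subset[OF singular_potential_continuous]) auto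

lemma sq_powr: "x \<noteq> 0 \<Longrightarrow> ((norm (x::real^'n))\<^sup>2) powr a = norm x powr (2 * a)"
  by (simp add: powr_powr flip: powr_numeral)

lemma singular_potential_sq:
  assumes "x \<noteq> 0"
  shows "singular_potential \<beta> \<kappa> \<sigma> x = \<kappa> * ((norm x)\<^sup>2) powr (- 2 * (\<beta>/2) - 1) + \<sigma> * ((norm x)\<^sup>2) powr (- (\<beta>/2) - 1)"
proof -
  have "2 * (- 2 * (\<beta>/2) - 1) = - (2 + 2 * \<beta>)" "2 * (- (\<beta>/2) - 1) = - (2 + \<beta>)" by auto
  then show ?thesis
    unfolding singular_potential_def sq_powr[OF assms] by (simp only: powr_minus divide_inverse)
qed

text \<open>The exponent is parametrised by the coefficient \<open>t\<close> of the middle power: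
  since that coefficient is affine in the exponent with slope \<open>8 * c * g\<close>, any
  prescribed \<open>t\<close> is attained. The value \<open>t = 0\<close> gives the exponent of
  \<open>h\<close>.\<close>

lemma wkb_critical_coefficients:
  fixes c g d t :: real
  assumes "c > 0" "g > 0"
  defines "a \<equiv> (2 + 2 * g - d) / 4 + t / (8 * c * g)"
  shows "wkbQ d c g a r = 4 * (c * g)\<^sup>2 * r powr (- 2 * g - 1) + t * r powr (- g - 1) + a * (2 * d + 4 * (a - 1)) * r powr (- 1)"
proof -
  have "c * g * (2 * d + 4 * (2 * a - g - 1)) = t"
    using assms(1,2) by (simp add: a_def field_simps)
  then show ?thesis by (simp add: wkbQ_def)
qed

text \<open>The second summand serves the cut-off in part (i); part (ii) takes
  \<open>k = 0\<close>.\<close>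

lemma wkb_generator:
  assumes c: "c > 0" and g: "g > 0"
  obtains K where "K \<ge> 0"
    "\<And>(x::real^'n) s. x \<noteq> 0 \<Longrightarrow> 0 < s \<Longrightarrow> s \<le> 1 \<Longrightarrow>
       integrable (gauss s) (\<lambda>z. wkb c g a ((norm (x + z))\<^sup>2) + k * wkb c g b ((norm (x + z))\<^sup>2)) \<and>
       \<bar>(\<integral>z. wkb c g a ((norm (x + z))\<^sup>2) + k * wkb c g b ((norm (x + z))\<^sup>2) \<partial>gauss s)
          - (wkb c g a ((norm x)\<^sup>2) + k * wkb c g b ((norm x)\<^sup>2)
          + s * (wkbQ (real CARD('n)) c g a ((norm x)\<^sup>2) * wkb c g a ((norm x)\<^sup>2)
              + k * (wkbQ (real CARD('n)) c g b ((norm x)\<^sup>2) * wkb c g b ((norm x)\<^sup>2))))\<bar> \<le> K * s powr (3/2) * lyap x"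
proof -
  let ?d = "real CARD('n)"
  have eq: "2 * ?d * (wkb1 c g a r + k * wkb1 c g b r) + 4 * r * (wkb2 c g a r + k * wkb2 c g b r)
     = wkbQ ?d c g a r * wkb c g a r + k * (wkbQ ?d c g b r * wkb c g b r)" if "r > 0" for r
    unfolding wkb_radial_laplacian[OF that, symmetric] by (simp add: algebra_simps)
  obtain K where K: "K \<ge> 0"
    "\<And>(x::real^'n) s. x \<noteq> 0 \<Longrightarrow> 0 < s \<Longrightarrow> s \<le> 1 \<Longrightarrow>
       integrable (gauss s) (\<lambda>z. wkb c g a ((norm (x + z))\<^sup>2) + k * wkb c g b ((norm (x + z))\<^sup>2)) \<and>
       \<bar>(\<integral>z. wkb c g a ((norm (x + z))\<^sup>2) + k * wkb c g b ((norm (x + z))\<^sup>2) \<partial>gauss s)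
          - (wkb c g a ((norm x)\<^sup>2) + k * wkb c g b ((norm x)\<^sup>2)
          + s * (2 * ?d * (wkb1 c g a ((norm x)\<^sup>2) + k * wkb1 c g b ((norm x)\<^sup>2))
              + 4 * (norm x)\<^sup>2 * (wkb2 c g a ((norm x)\<^sup>2) + k * wkb2 c g b ((norm x)\<^sup>2))))\<bar> \<le> K * s powr (3/2) * lyap x"
    by (rule tame_generator[OF tame_wkb_combination[OF c g, of a k b], where 'n='n]) blast
  show thesis
    by (rule that[OF K(1)]) (use K(2) eq in auto)
qed

lemma hfun_eq_wkb:
  assumes "x \<noteq> 0" "norm x \<le> 1" "\<beta> > 0"
  shows "hfun TYPE('n) \<beta> \<kappa> (norm (x::real^'n)) = wkb (sqrt \<kappa> / \<beta>) (\<beta>/2) ((2 + 2 * (\<beta>/2) - real CARD('n)) / 4) ((norm x)\<^sup>2)"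
proof -
  have 1: "2 * ((2 + 2 * (\<beta>/2) - real CARD('n)) / 4) = - (real CARD('n) - 2 - \<beta>) / 2" "2 * - (\<beta>/2) = - \<beta>" by auto
  have "- (sqrt \<kappa> / \<beta>) * norm x powr - \<beta> = - sqrt \<kappa> / (\<beta> * norm x powr \<beta>)"
    by (simp add: powr_minus divide_inverse)
  then show ?thesis
    unfolding hfun_def wkb_def sq_powr[OF assms(1)] 1 using assms by (simp add: min_def)
qed

lemma wkb_lyap_bound:
  assumes c: "c > 0" and g: "g > 0"
  obtains K where "K > 0" "\<And>x::real^'n. wkb c g a ((norm x)\<^sup>2) \<le> K * lyap x"
proof -
  obtain C N where C: "C \<ge> 0" "\<And>r. r > 0 \<Longrightarrow> wkb c g a r \<le> C * (1 + r) ^ N"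
    using wkb_poly_bound[OF c g, of a] by blast
  obtain K where K: "K > 0" "\<And>x::real^'n. (1 + norm x) ^ (2 * N) \<le> K * lyap x" using lyap_poly[of "2 * N"] by blast
  have "wkb c g a ((norm x)\<^sup>2) \<le> ((C + 1) * K) * lyap x" for x :: "real^'n"
  proof (cases "x = 0")
    case True
    have "0 \<le> (C + 1) * K * lyap x" using C K by simp
    then show ?thesis using True by (simp add: wkb_def)
  next
    case False
    then have "wkb c g a ((norm x)\<^sup>2) \<le> C * (1 + (norm x)\<^sup>2) ^ N" by (intro C) simp
    also have "\<dots> \<le> C * ((1 + norm x)\<^sup>2) ^ N"
      using C by (intro mult_left_mono power_mono) (auto simp: power2_sum)
    also have "\<dots> = C * (1 + norm x) ^ (2 * N)" by (simp add: power_mult)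
    also have "\<dots> \<le> (C + 1) * (K * lyap x)"
      using C K by (intro mult_mono K) auto
    finally show ?thesis by (simp add: mult.assoc)
  qed
  with C K show thesis by (intro that[of "(C + 1) * K"]) auto
qed

text \<open>All coordinates are made positive so that, in dimension one, \<open>x\<close> lies on
  the same side of the origin as the test region for \<open>y\<close>.\<close>

lemma vec_with_norm:
  assumes "\<rho> > 0"
  obtains x :: "real^'n" where "x \<noteq> 0" "(norm x)\<^sup>2 = \<rho>" "\<And>i. x $ i > 0"
proof
  let ?x = "(\<chi> i. sqrt (\<rho> / real CARD('n))) :: real^'n"
  show "?x $ i > 0" for i using assms by simp
  show n: "(norm ?x)\<^sup>2 = \<rho>"
    using assms by (simp add: norm_vec_def L2_set_def sum_nonneg)
  show "?x \<noteq> 0" using n assms by auto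
qed

lemma powr_unbounded:
  fixes E e :: real
  assumes "e < 0"
  obtains r where "0 < r" "r \<le> 1" "E < r powr e"
proof
  define r where "r = (\<bar>E\<bar> + 1) powr (1 / e)"
  show "0 < r" by (simp add: r_def)
  have "\<bar>E\<bar> + 1 > 0" by simp
  then show "r \<le> 1" unfolding r_def using assms powr_mono[of "1/e" 0 "\<bar>E\<bar> + 1"] by simp
  show "E < r powr e" using assms by (simp add: r_def powr_powr)
qed

lemma lyap_bound_unit:
  assumes "norm x \<le> 1"
  shows "lyap (x::real^'n) \<le> 2 * real CARD('n) * exp 1"
proof -
  have "lyap x \<le> (\<Sum>b\<in>(Basis::(real^'n) set). exp 1 + exp 1)"
    unfolding lyap_def
  proof (intro sum_mono add_mono)
    fix b :: "real^'n" assume b: "b \<in> Basis"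
    have "\<bar>b \<bullet> x\<bar> \<le> 1" using Cauchy_Schwarz_ineq2[of b x] b assms by simp
    then show "exp (b \<bullet> x) \<le> exp 1" "exp (- b \<bullet> x) \<le> exp 1" by auto
  qed
  then show ?thesis by simp
qed

section \<open>Slow decay of the kernel under a weaker potential\<close>

text \<open>Integrating the assumed bound against \<open>U\<close> in \<open>y\<close> gives at most
  a constant times \<open>h(|x|)\<close>, whereas the subsolution gives at least a constant times
  \<open>U(|x|^2)\<close>, which is larger than \<open>h\<close> by the unbounded factor
  \<open>r powr e\<close>.\<close>

lemma no_upper_bound:
  fixes V :: "real^'n \<Rightarrow> real"
  assumes b: "\<beta> > 0" and k: "\<kappa> > 0" and C: "C > 0"
    and V: "V \<in> borel_measurable borel" "\<And>x. x \<noteq> 0 \<Longrightarrow> V x \<ge> 0"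
      "\<And>K. compact K \<Longrightarrow> 0 \<notin> K \<Longrightarrow> bounded (V ` K)"
    and far: "\<And>x. norm x \<ge> 1 \<Longrightarrow> V x \<le> M"
    and le: "\<And>x. x \<noteq> 0 \<Longrightarrow> norm x \<le> 1 \<Longrightarrow> V x \<le> \<kappa> / norm x powr (2 + 2 * \<beta>) - C / norm x powr (2 + \<beta>)"
    and c: "c1 > 0" "c2 > 0" "c3 > 0"
    and ub: "\<And>x. x \<noteq> 0 \<Longrightarrow> AE y in lborel. y \<noteq> 0 \<longrightarrow> FK_density V 1 x y \<le> bound \<beta> \<kappa> c1 c2 c3 1 x y"
  shows False
proof -
  define d where "d = real CARD('n)"
  define cc where "cc = sqrt \<kappa> / \<beta>"
  define g where "g = \<beta> / 2"
  have cg: "cc > 0" "g > 0" using b k by (auto simp: cc_def g_def)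
  have k4: "4 * (cc * g)\<^sup>2 = \<kappa>" using b k by (simp add: cc_def g_def power_divide power_mult_distrib)
  define a0 where "a0 = (2 + 2 * g - d) / 4"
  \<comment> \<open>The shift that produces the middle coefficient \<open>- C / 2\<close>, halfway
    between the critical value 0 and the coefficient \<open>- C\<close> of the potential. The spare
    \<open>C / 2\<close> absorbs the term with \<open>r powr (- 1)\<close>.\<close>
  define e where "e = - (C / 2) / (8 * cc * g)"
  have e: "e < 0" using C cg by (simp add: e_def)
  define a where "a = a0 + e"
  \<comment> \<open>Lowering the exponent by 1 divides by \<open>r\<close>, so
    \<open>U - \<epsilon> * U' = U * (1 - \<epsilon> / r)\<close> changes sign exactly at
    \<open>r = \<epsilon>\<close> and remains within the differentiable family.\<close>
  define a' where "a' = a - 1"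
  define U where "U = wkb cc g a"
  define U' where "U' = wkb cc g a'"
  define phi :: "real^'n \<Rightarrow> real" where "phi = singular_potential \<beta> \<kappa> (- C)"
  define E1 where "E1 = a * (2 * d + 4 * (a - 1))"
  define E2 where "E2 = a' * (2 * d + 4 * (a' - 1))"
  have Qa: "wkbQ d cc g a r = \<kappa> * r powr (- 2 * g - 1) + (- (C / 2)) * r powr (- g - 1) + E1 * r powr (- 1)" for r
    unfolding a_def a0_def e_def E1_def by (subst wkb_critical_coefficients[OF cg]) (simp add: k4)
  have Qa': "wkbQ d cc g a' r = \<kappa> * r powr (- 2 * g - 1) + (- (C / 2) - 8 * cc * g) * r powr (- g - 1) + E2 * r powr (- 1)" for r
  proof -
    have "a' = (2 + 2 * g - d) / 4 + (- (C / 2) - 8 * cc * g) / (8 * cc * g)"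
      using cg by (simp add: a'_def a_def a0_def e_def diff_divide_distrib)
    then show ?thesis unfolding E2_def using wkb_critical_coefficients[OF cg, of d "- (C / 2) - 8 * cc * g" r] k4 by simp
  qed
  have "C / 2 > 0" "8 * cc * g > 0" using C cg by auto
  note pos = this
  obtain l1 r1 where l1: "l1 \<ge> 0" "r1 > 0" "\<And>r. r > 0 \<Longrightarrow> - l1 \<le> (C / 2) * r powr (- g - 1) + E1 * r powr (- 1)"
    "\<And>r. 0 < r \<Longrightarrow> r \<le> r1 \<Longrightarrow> 0 \<le> (C / 2) * r powr (- g - 1) + E1 * r powr (- 1)"
    by (rule singular_lower_bound[OF pos(1) cg(2), of E1]) (rule that)
  \<comment> \<open>This concerns the difference of the quotients for \<open>a\<close> and
    \<open>a'\<close>, which is positive near 0: there the cut-off term helps the subsolution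
    inequality.\<close>
  obtain l2 r2 where l2: "l2 \<ge> 0" "r2 > 0" "\<And>r. r > 0 \<Longrightarrow> - l2 \<le> (8 * cc * g) * r powr (- g - 1) + (E1 - E2) * r powr (- 1)"
    "\<And>r. 0 < r \<Longrightarrow> r \<le> r2 \<Longrightarrow> 0 \<le> (8 * cc * g) * r powr (- g - 1) + (E1 - E2) * r powr (- 1)"
    by (rule singular_lower_bound[OF pos(2) cg(2), of "E1 - E2"]) (rule that)
  define l where "l = l1 + l2"
  have l: "l \<ge> 0" using l1 l2 by (simp add: l_def)
  obtain Kp where Kp: "Kp > 0" "\<And>x::real^'n. U ((norm x)\<^sup>2) \<le> Kp * lyap x"
    unfolding U_def using wkb_lyap_bound[OF cg, of a] by blast
  \<comment> \<open>In the unit ball \<open>V \<le> phi\<close> by assumption; outside it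
    \<open>V \<le> |M|\<close> and \<open>phi \<ge> - C\<close>.\<close>
  define K' where "K' = \<bar>M\<bar> + C"
  have Vphi: "V y \<le> phi y + K'" if "y \<noteq> 0" for y
  proof (cases "norm y \<le> 1")
    case True
    then show ?thesis using le[OF that True] C by (simp add: phi_def singular_potential_def K'_def)
  next
    case False
    have "C / norm y powr (2 + \<beta>) \<le> C / 1"
      using False C b by (intro divide_left_mono) (auto intro!: ge_one_powr_ge_zero)
    moreover have "0 \<le> \<kappa> / norm y powr (2 + 2 * \<beta>)" using k by simp
    ultimately have "- C \<le> phi y" by (simp add: phi_def singular_potential_def)
    then show ?thesis using far[of y] False by (simp add: K'_def)
  qed
  have lower: "ennreal (exp (- l) * (U ((norm x)\<^sup>2) / 2)) \<le>
      (\<integral>\<^sup>+w. ennreal (indicator nohit w * exp (- (LINT s:{0..1}|lborel. phi (w s))) * U ((norm (w 1))\<^sup>2)) \<partial>Wiener x)"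
    if x: "x \<noteq> 0" for x :: "real^'n"
  proof -
    \<comment> \<open>Half of \<open>|x|^2\<close>, so that the cut-off costs at most a factor 2 at
      the starting point; half of \<open>r2\<close>, so that beyond \<open>r2\<close> the factor
      \<open>1 - \<epsilon> / r\<close> is at least 1/2. The constants \<open>l1\<close>,
      \<open>l2\<close>, \<open>r2\<close> were fixed before \<open>\<epsilon>\<close>.\<close>
    define \<epsilon> where "\<epsilon> = min ((norm x)\<^sup>2) r2 / 2"
    have \<epsilon>: "\<epsilon> > 0" "2 * \<epsilon> \<le> r2" "2 * \<epsilon> \<le> (norm x)\<^sup>2" using x l2 by (auto simp: \<epsilon>_def)
    define F where "F r = U r + (- \<epsilon>) * U' r" for r
    have U': "U' r = U r / r" if "r > 0" for r
      using wkb_shift[OF that, of cc g a "-1"] that by (simp add: U_def U'_def a'_def)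
    have F: "F r = U r * (1 - \<epsilon> / r)" if "r > 0" for r
      using that by (simp add: F_def U' algebra_simps)
    have U0: "U r \<ge> 0" "U' r \<ge> 0" for r by (simp_all add: U_def U'_def)
    define v where "v y = max 0 (F ((norm y)\<^sup>2))" for y :: "real^'n"
    obtain K where K: "K \<ge> 0"
      "\<And>(x::real^'n) s. x \<noteq> 0 \<Longrightarrow> 0 < s \<Longrightarrow> s \<le> 1 \<Longrightarrow>
       integrable (gauss s) (\<lambda>z. F ((norm (x + z))\<^sup>2)) \<and>
       \<bar>(\<integral>z. F ((norm (x + z))\<^sup>2) \<partial>gauss s) - (F ((norm x)\<^sup>2)
          + s * (wkbQ d cc g a ((norm x)\<^sup>2) * U ((norm x)\<^sup>2) + (- \<epsilon>) * (wkbQ d cc g a' ((norm x)\<^sup>2) * U' ((norm x)\<^sup>2))))\<bar> \<le> K * s powr (3/2) * lyap x"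
      unfolding F_def U_def U'_def d_def using wkb_generator[OF cg, of a "- \<epsilon>" a', where 'n='n] by blast
    \<comment> \<open>The left side of the generator equals
      \<open>wkbQ d cc g a r * F r + q * (\<epsilon> * U' r)\<close>, where \<open>q\<close> is the
      difference of the two quotients. The second term has to be bounded below by
      \<open>- l2 * F r\<close> although \<open>F\<close> vanishes at
      \<open>\<epsilon>\<close>.\<close>
    have lap: "F r * (\<kappa> * r powr (- 2 * g - 1) + (- C) * r powr (- g - 1) - l)
        \<le> wkbQ d cc g a r * U r + (- \<epsilon>) * (wkbQ d cc g a' r * U' r)" if r: "r > \<epsilon>" for r
    proof -
      have r0: "r > 0" using r \<epsilon> by linarith
      have F0: "F r \<ge> 0" unfolding F[OF r0] using U0[of r] r r0 by simp
      define q where "q = (8 * cc * g) * r powr (- g - 1) + (E1 - E2) * r powr (- 1)"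
      have "wkbQ d cc g a r * U r + (- \<epsilon>) * (wkbQ d cc g a' r * U' r) = wkbQ d cc g a r * F r + q * (\<epsilon> * U' r)"
      proof -
        have alg: "(kp + (- c2) * p + E1 * v) * u + (- \<epsilon>) * ((kp + (- c2 - t) * p + E2 * v) * u')
            = (kp + (- c2) * p + E1 * v) * (u + (- \<epsilon>) * u') + (t * p + (E1 - E2) * v) * (\<epsilon> * u')"
          for kp c2 p v u t u' :: real by (simp add: algebra_simps)
        show ?thesis unfolding F_def Qa Qa' q_def by (rule alg)
      qed
      moreover have "(\<kappa> * r powr (- 2 * g - 1) + (- C) * r powr (- g - 1) - l1) * F r \<le> wkbQ d cc g a r * F r"
        unfolding Qa using l1(3)[OF r0] F0 by (intro mult_right_mono) auto
      moreover have "- l2 * F r \<le> q * (\<epsilon> * U' r)"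
      \<comment> \<open>Near 0 the ratio of \<open>\<epsilon> * U'\<close> to \<open>F\<close> is
        unbounded, but there \<open>q \<ge> 0\<close>. Beyond \<open>r2\<close> the choice of
        \<open>\<epsilon>\<close> gives \<open>\<epsilon> * U' \<le> F\<close>, so the global bound
        on \<open>q\<close> suffices.\<close>
      proof (cases "r \<le> r2")
        case True
        have "- l2 * F r \<le> 0" using l2(1) F0 by simp
        also have "0 \<le> q * (\<epsilon> * U' r)" using l2(4)[OF r0 True] \<epsilon> U0 by (simp add: q_def)
        finally show ?thesis .
      next
        case False
        have "\<epsilon> / r \<le> 1 / 2" using False \<epsilon> r0 by (simp add: field_simps)
        then have "\<epsilon> / r \<le> 1 - \<epsilon> / r" by linarith
        then have "U r * (\<epsilon> / r) \<le> U r * (1 - \<epsilon> / r)" by (rule mult_left_mono[OF _ U0(1)])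
        then have le: "\<epsilon> * U' r \<le> F r" unfolding F[OF r0] using r0 by (simp add: U' mult.commute)
        have "- l2 * F r \<le> - l2 * (\<epsilon> * U' r)" using le l2(1) by (intro mult_left_mono_neg) auto
        also have "\<dots> \<le> q * (\<epsilon> * U' r)" using l2(3)[OF r0] \<epsilon> U0 by (intro mult_right_mono) (auto simp: q_def)
        finally show ?thesis .
      qed
      ultimately show ?thesis by (simp add: l_def algebra_simps)
    qed
    have pphi: "phi y = \<kappa> * ((norm y)\<^sup>2) powr (- 2 * g - 1) + (- C) * ((norm y)\<^sup>2) powr (- g - 1)" if "y \<noteq> 0" for y
      unfolding phi_def g_def by (rule singular_potential_sq[OF that])
    define B where "B = \<kappa> * \<epsilon> powr (- 2 * g - 1) + C * \<epsilon> powr (- g - 1)"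
    have sq: "(norm y)\<^sup>2 > \<epsilon>" if "norm y > sqrt \<epsilon>" for y :: "real^'n"
      using that \<epsilon> by (metis real_sqrt_less_iff real_sqrt_abs abs_norm_cancel)
    have "ennreal (exp (- l) * v x) \<le>
      (\<integral>\<^sup>+w. ennreal (indicator nohit w * exp (- (LINT s:{0..1}|lborel. phi (w s))) * v (w 1)) \<partial>Wiener x)"
    proof (rule FK_subsolution[OF Wiener_BM, where rho="sqrt \<epsilon>" and B=B and Kp=Kp and K=K])
      show "continuous_on (- {0}) phi" "phi \<in> borel_measurable borel"
        unfolding phi_def by (rule singular_potential_continuous, measurable)
      show "0 < sqrt \<epsilon>" using \<epsilon> by simp
      show "0 \<le> B" using k C by (simp add: B_def)
      show "v \<in> borel_measurable borel" unfolding v_def F_def U_def U'_def by measurable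
      show "0 \<le> Kp" "0 \<le> K" "0 \<le> l" "0 \<le> v y" for y using Kp K l by (auto simp: v_def)
      show "\<bar>phi y\<bar> \<le> B" if "sqrt \<epsilon> < norm y" for y
      proof -
        have y: "y \<noteq> 0" "(norm y)\<^sup>2 > \<epsilon>" using sq[OF that] \<epsilon> by auto
        have "((norm y)\<^sup>2) powr (- 2 * g - 1) \<le> \<epsilon> powr (- 2 * g - 1)" "((norm y)\<^sup>2) powr (- g - 1) \<le> \<epsilon> powr (- g - 1)"
          using y \<epsilon> cg by (auto intro!: powr_mono2')
        then have "\<kappa> * ((norm y)\<^sup>2) powr (- 2 * g - 1) \<le> \<kappa> * \<epsilon> powr (- 2 * g - 1)" "C * ((norm y)\<^sup>2) powr (- g - 1) \<le> C * \<epsilon> powr (- g - 1)"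
          using k C by (auto intro!: mult_left_mono)
        moreover have "0 \<le> \<kappa> * ((norm y)\<^sup>2) powr (- 2 * g - 1)" "0 \<le> C * ((norm y)\<^sup>2) powr (- g - 1)" using k C by auto
        ultimately show ?thesis unfolding pphi[OF y(1)] B_def by (simp add: abs_le_iff)
      qed
      show "v y = 0" if "norm y \<le> sqrt \<epsilon>" for y
      proof (cases "y = 0")
        case True
        then show ?thesis by (simp add: v_def F_def U_def U'_def wkb_def)
      next
        case False
        have "(norm y)\<^sup>2 \<le> \<epsilon>" using power_mono[OF that, of 2] \<epsilon> by simp
        then have "F ((norm y)\<^sup>2) \<le> 0"
          using False U0[of "(norm y)\<^sup>2"] by (subst F) (auto intro!: mult_nonneg_nonpos)
        then show ?thesis by (simp add: v_def)
      qed
      show "v y \<le> Kp * lyap y" for y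
      proof -
        have "F ((norm y)\<^sup>2) \<le> U ((norm y)\<^sup>2)" using \<epsilon> U0 by (simp add: F_def)
        also have "\<dots> \<le> Kp * lyap y" by (rule Kp)
        finally show ?thesis using Kp(1) by (simp add: v_def)
      qed
      show "integrable (gauss s) (\<lambda>z. v (y + z)) \<and> v y * (1 + s * (phi y - l)) \<le> (\<integral>z. v (y + z) \<partial>gauss s) + K * s powr (3/2) * lyap y"
        if "sqrt \<epsilon> < norm y" and s: "0 < s" "s \<le> 1" for y s
      proof -
        have y: "y \<noteq> 0" "(norm y)\<^sup>2 > \<epsilon>" using sq[OF that(1)] \<epsilon> by auto
        note KK = K(2)[OF y(1) s]
        have int: "integrable (gauss s) (\<lambda>z. v (y + z))"
          unfolding v_def using KK by (intro integrable_max) auto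
        have r0: "(norm y)\<^sup>2 > 0" using y by simp
        have F0: "F ((norm y)\<^sup>2) \<ge> 0" unfolding F[OF r0] using U0 y r0 by simp
        then have "v y * (1 + s * (phi y - l)) = F ((norm y)\<^sup>2) + s * (F ((norm y)\<^sup>2) * (phi y - l))"
          by (simp add: v_def algebra_simps)
        also have "\<dots> \<le> F ((norm y)\<^sup>2) + s * (wkbQ d cc g a ((norm y)\<^sup>2) * U ((norm y)\<^sup>2) + (- \<epsilon>) * (wkbQ d cc g a' ((norm y)\<^sup>2) * U' ((norm y)\<^sup>2)))"
          using lap[OF y(2)] s unfolding pphi[OF y(1)] by (intro add_left_mono mult_left_mono) auto
        also have "\<dots> \<le> (\<integral>z. F ((norm (y + z))\<^sup>2) \<partial>gauss s) + K * s powr (3/2) * lyap y"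
          using KK by linarith
        also have "\<dots> \<le> (\<integral>z. v (y + z) \<partial>gauss s) + K * s powr (3/2) * lyap y"
          using KK int by (intro add_right_mono integral_mono) (auto simp: v_def)
        finally show ?thesis using int by simp
      qed
    qed
    also have "\<dots> \<le> (\<integral>\<^sup>+w. ennreal (indicator nohit w * exp (- (LINT s:{0..1}|lborel. phi (w s))) * U ((norm (w 1))\<^sup>2)) \<partial>Wiener x)"
    proof (intro nn_integral_mono ennreal_leI mult_left_mono)
      fix w :: "real \<Rightarrow> real^'n"
      have "F ((norm (w 1))\<^sup>2) \<le> U ((norm (w 1))\<^sup>2)" using \<epsilon> U0 by (simp add: F_def)
      then show "v (w 1) \<le> U ((norm (w 1))\<^sup>2)" using U0 by (simp add: v_def)
    qed simp
    finally have "ennreal (exp (- l) * v x) \<le> \<dots>" .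
    moreover have "U ((norm x)\<^sup>2) / 2 \<le> v x"
    proof -
      have x2: "(norm x)\<^sup>2 > 0" using x by simp
      then have "\<epsilon> / (norm x)\<^sup>2 \<le> 1 / 2" using \<epsilon> by (simp add: field_simps)
      then have "1 / 2 \<le> 1 - \<epsilon> / (norm x)\<^sup>2" by linarith
      then have "U ((norm x)\<^sup>2) * (1 / 2) \<le> F ((norm x)\<^sup>2)" unfolding F[OF x2] by (rule mult_left_mono[OF _ U0(1)])
      then show ?thesis by (simp add: v_def)
    qed
    ultimately show ?thesis
      by (meson ennreal_leI exp_ge_zero mult_left_mono order_trans)
  qed
  define h where "h = hfun TYPE('n) \<beta> \<kappa>"
  define he where "he = h (eta1 \<beta> \<kappa>)"
  have he: "he > 0"
  proof -
    have "eta1 \<beta> \<kappa> > 0" using b k by (simp add: eta1_def eta0_def)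
    then show ?thesis by (simp add: he_def h_def hfun_def)
  qed
  \<comment> \<open>Collects every factor met in \<open>key\<close>; none of them depends on
    \<open>x\<close> or \<open>\<epsilon>\<close>.\<close>
  define E where "E = 2 * exp l * exp K' * (c1 / he) * (Kp * (exp c3 * (2 * d * exp 1)))"
  have key: "U ((norm x)\<^sup>2) \<le> E * h (norm x)" if x: "x \<noteq> 0" "norm x \<le> 1" for x :: "real^'n"
  proof -
    have h0: "h r \<ge> 0" for r by (simp add: h_def hfun_def)
    note [measurable] = FK_density_1(1)[OF Wiener_BM V(1,2), of x]
    have Um [measurable]: "U \<in> borel_measurable borel" unfolding U_def by measurable
    have U0: "U r \<ge> 0" for r by (simp add: U_def)
    have "ennreal (exp (- l) * (U ((norm x)\<^sup>2) / 2)) \<le>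
      (\<integral>\<^sup>+w. ennreal (indicator nohit w * exp (- (LINT s:{0..1}|lborel. phi (w s))) * U ((norm (w 1))\<^sup>2)) \<partial>Wiener x)"
      by (rule lower[OF x(1)])
    also have "\<dots> \<le> (\<integral>\<^sup>+w. ennreal (indicator nohit w * exp (- (LINT s:{0..1}|lborel. V (w s)))) * ennreal (exp K' * U ((norm (w 1))\<^sup>2)) \<partial>Wiener x)"
    proof (rule nn_integral_mono)
      fix w assume w: "w \<in> space (Wiener x)"
      have "indicator nohit w * exp (- (LINT s:{0..1}|lborel. phi (w s))) \<le> exp K' * (indicator nohit w * exp (- (LINT s:{0..1}|lborel. V (w s))))"
        by (rule FK_functional_mono[OF Wiener_BM w V(1,3)]) (auto simp: phi_def Vphi[unfolded phi_def] singular_potential_bounded)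
      then have "(indicator nohit w * exp (- (LINT s:{0..1}|lborel. phi (w s)))) * U ((norm (w 1))\<^sup>2)
         \<le> (exp K' * (indicator nohit w * exp (- (LINT s:{0..1}|lborel. V (w s))))) * U ((norm (w 1))\<^sup>2)"
        using U0 by (rule mult_right_mono)
      then show "ennreal (indicator nohit w * exp (- (LINT s:{0..1}|lborel. phi (w s))) * U ((norm (w 1))\<^sup>2))
        \<le> ennreal (indicator nohit w * exp (- (LINT s:{0..1}|lborel. V (w s)))) * ennreal (exp K' * U ((norm (w 1))\<^sup>2))"
        using U0 by (subst ennreal_mult[symmetric]) (auto intro!: ennreal_leI simp: ac_simps)
    qed
    also have "\<dots> = (\<integral>\<^sup>+y. ennreal (FK_density V 1 x y) * ennreal (exp K' * U ((norm y)\<^sup>2)) \<partial>lborel)"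
      by (rule FK_density_1(3)[OF Wiener_BM V(1,2), where u="\<lambda>y. ennreal (exp K' * U ((norm y)\<^sup>2))"]) (auto)
    also have "\<dots> \<le> (\<integral>\<^sup>+y. ennreal (heat c3 x y) * ennreal ((c1 / he * h (norm x) * exp K' * Kp) * lyap y) \<partial>lborel)"
    proof (rule nn_integral_mono_AE)
      have "AE y in lborel. y \<noteq> (0::real^'n)" by (rule AE_lborel_singleton)
      with ub[OF x(1)] show "AE y in lborel. ennreal (FK_density V 1 x y) * ennreal (exp K' * U ((norm y)\<^sup>2)) \<le> ennreal (heat c3 x y) * ennreal ((c1 / he * h (norm x) * exp K' * Kp) * lyap y)"
      proof eventually_elim
        case (elim y)
        \<comment> \<open>At time 1 the reference radius is \<open>eta1 \<beta> \<kappa>\<close>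
          itself, hence \<open>he\<close>. Only the factor in \<open>|x|\<close> is exploited; the
          factor in \<open>|y|\<close> and the exponential are bounded by 1.\<close>
        define A where "A = c1 * min 1 (h (norm x) / he) * min 1 (h (norm y) / he) * exp (- c2 * 1 / (max (max (norm x) (norm y)) (1 powr (1 / (2 + \<beta>)))) powr (2 + 2 * \<beta>))"
        have "A \<le> c1 * (h (norm x) / he) * 1 * 1"
          unfolding A_def using c h0 he by (intro mult_mono) auto
        then have "A * heat c3 x y \<le> (c1 * (h (norm x) / he) * 1 * 1) * heat c3 x y"
          by (intro mult_right_mono) auto
        moreover have "bound \<beta> \<kappa> c1 c2 c3 1 x y = A * heat c3 x y"
          by (simp add: bound_def Let_def A_def h_def he_def)
        ultimately have "FK_density V 1 x y \<le> (c1 / he * h (norm x)) * heat c3 x y"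
          using elim by simp
        then have "FK_density V 1 x y * (exp K' * U ((norm y)\<^sup>2)) \<le> ((c1 / he * h (norm x)) * heat c3 x y) * (exp K' * (Kp * lyap y))"
          using U0 Kp c he h0 by (intro mult_mono) auto
        then have "ennreal (FK_density V 1 x y * (exp K' * U ((norm y)\<^sup>2))) \<le> ennreal (heat c3 x y * ((c1 / he * h (norm x) * exp K' * Kp) * lyap y))"
          by (intro ennreal_leI) (simp add: ac_simps)
        then show ?case
          using U0 Kp c he h0 FK_density_1(2)[OF Wiener_BM V(1,2), of x y]
          by (subst (1 2) ennreal_mult[symmetric]) (auto intro!: mult_nonneg_nonneg)
      qed
    qed
    also have "\<dots> = (\<integral>\<^sup>+z. ennreal ((c1 / he * h (norm x) * exp K' * Kp) * lyap (x + z)) \<partial>gauss c3)"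
      by (rule nn_integral_gauss_translate[symmetric]) measurable
    also have "\<dots> = ennreal ((c1 / he * h (norm x) * exp K' * Kp) * (exp c3 * lyap x))"
      using lyap_gauss[OF c(3), of x] c he h0 Kp by (subst nn_integral_eq_integral) (auto simp: has_bochner_integral_iff)
    finally have "exp (- l) * (U ((norm x)\<^sup>2) / 2) \<le> (c1 / he * h (norm x) * exp K' * Kp) * (exp c3 * lyap x)"
      using c he h0 Kp by (subst (asm) ennreal_le_iff) auto
    also have "\<dots> \<le> (c1 / he * h (norm x) * exp K' * Kp) * (exp c3 * (2 * d * exp 1))"
      using c he h0 Kp lyap_bound_unit[OF x(2)] by (intro mult_left_mono) (auto simp: d_def)
    finally have "2 * exp l * (exp (- l) * (U ((norm x)\<^sup>2) / 2)) \<le> 2 * exp l * ((c1 / he * h (norm x) * exp K' * Kp) * (exp c3 * (2 * d * exp 1)))"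
      by (intro mult_left_mono) auto
    moreover have "2 * exp l * (exp (- l) * (U ((norm x)\<^sup>2) / 2)) = U ((norm x)\<^sup>2)"
      by (simp add: exp_minus)
    ultimately have "U ((norm x)\<^sup>2) \<le> 2 * exp l * ((c1 / he * h (norm x) * exp K' * Kp) * (exp c3 * (2 * d * exp 1)))"
      by (simp only:)
    then show ?thesis by (simp only: E_def ac_simps)
  qed
  \<comment> \<open>By \<open>wkb_shift\<close> the quotient of \<open>U\<close> and
    \<open>h\<close> at radius \<open>sqrt r\<close> is \<open>r powr e\<close> with
    \<open>e < 0\<close>.\<close>
  obtain r where r: "0 < r" "r \<le> 1" "E < r powr e" using powr_unbounded[OF e] by blast
  obtain x :: "real^'n" where x: "x \<noteq> 0" "(norm x)\<^sup>2 = r" using vec_with_norm[OF r(1)] by blast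
  have "norm x \<le> 1" using x r by (metis abs_norm_cancel abs_square_le_1)
  note k1 = key[OF x(1) this]
  have "h (norm x) = wkb cc g a0 r"
    unfolding h_def cc_def g_def a0_def d_def x(2)[symmetric] using hfun_eq_wkb[OF x(1) \<open>norm x \<le> 1\<close> b] .
  with k1 have "r powr e * wkb cc g a0 r \<le> E * wkb cc g a0 r"
    unfolding U_def a_def x(2) wkb_shift[OF r(1)] by simp
  with wkb_pos[OF r(1), of cc g a0] r(3) show False by simp
qed

section \<open>Fast decay of the kernel under a stronger potential\<close>

text \<open>The supersolution bounds the integral of the kernel against \<open>U\<close> by a
  constant times \<open>U(|x|^2)\<close>. The assumed lower bound, integrated over a fixed box away
  from 0, makes it at least a constant times \<open>h(|x|)\<close>, although
  \<open>U / h = r powr e\<close> tends to 0.\<close>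

lemma no_lower_bound:
  fixes V :: "real^'n \<Rightarrow> real"
  assumes b: "\<beta> > 0" and k: "\<kappa> > 0" and C: "C > 0"
    and V: "V \<in> borel_measurable borel" "\<And>x. x \<noteq> 0 \<Longrightarrow> V x \<ge> 0"
      "\<And>K. compact K \<Longrightarrow> 0 \<notin> K \<Longrightarrow> bounded (V ` K)"
    and ge: "\<And>x. x \<noteq> 0 \<Longrightarrow> norm x \<le> 1 \<Longrightarrow> V x \<ge> \<kappa> / norm x powr (2 + 2 * \<beta>) + C / norm x powr (2 + \<beta>)"
    and c: "c4 > 0" "c5 > 0" "c6 > 0"
    and lb: "\<And>x. x \<noteq> 0 \<Longrightarrow> AE y in lborel. y \<noteq> 0 \<and> (CARD('n) = 1 \<longrightarrow> (\<forall>i. x $ i * y $ i > 0)) \<longrightarrow>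
      FK_density V 1 x y \<ge> bound \<beta> \<kappa> c4 c5 c6 1 x y"
  shows False
proof -
  define d where "d = real CARD('n)"
  have d: "d \<ge> 1" by (simp add: d_def)
  define cc where "cc = sqrt \<kappa> / \<beta>"
  define g where "g = \<beta> / 2"
  have cg: "cc > 0" "g > 0" using b k by (auto simp: cc_def g_def)
  have k4: "4 * (cc * g)\<^sup>2 = \<kappa>" using b k by (simp add: cc_def g_def power_divide power_mult_distrib)
  define a0 where "a0 = (2 + 2 * g - d) / 4"
  \<comment> \<open>Now the middle coefficient is \<open>C / 2\<close>, below the coefficient
    \<open>C\<close> of the potential; the spare \<open>C / 2\<close> absorbs the term with
    \<open>r powr (- 1)\<close>.\<close>
  define e where "e = (C / 2) / (8 * cc * g)"
  have e: "- e < 0" using C cg by (simp add: e_def)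
  define a where "a = a0 + e"
  define U where "U = wkb cc g a"
  define phi :: "real^'n \<Rightarrow> real" where "phi = singular_potential \<beta> \<kappa> C"
  define E1 where "E1 = a * (2 * d + 4 * (a - 1))"
  have Qa: "wkbQ d cc g a r = \<kappa> * r powr (- 2 * g - 1) + (C / 2) * r powr (- g - 1) + E1 * r powr (- 1)" for r
    unfolding a_def a0_def e_def E1_def by (subst wkb_critical_coefficients[OF cg]) (simp add: k4)
  have pos: "C / 2 > 0" using C by simp
  obtain l r1 where l: "l \<ge> 0" "r1 > 0" "\<And>r. r > 0 \<Longrightarrow> - l \<le> (C / 2) * r powr (- g - 1) + (- E1) * r powr (- 1)"
    "\<And>r. 0 < r \<Longrightarrow> r \<le> r1 \<Longrightarrow> 0 \<le> (C / 2) * r powr (- g - 1) + (- E1) * r powr (- 1)"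
    by (rule singular_lower_bound[OF pos cg(2), of "- E1"]) (rule that)
  have pphi: "phi y = \<kappa> * ((norm y)\<^sup>2) powr (- 2 * g - 1) + C * ((norm y)\<^sup>2) powr (- g - 1)" if "y \<noteq> 0" for y
    unfolding phi_def g_def by (rule singular_potential_sq[OF that])
  have phi0: "0 \<le> phi y" for y using k C by (simp add: phi_def singular_potential_def)
  \<comment> \<open>Outside the unit ball \<open>phi \<le> \<kappa> + C\<close> while
    \<open>V \<ge> 0\<close>.\<close>
  define K' where "K' = \<kappa> + C"
  have phiV: "phi y \<le> V y + K'" if "y \<noteq> 0" for y
  proof (cases "norm y \<le> 1")
    case True
    then show ?thesis using ge[OF that True] C k by (simp add: phi_def singular_potential_def K'_def)
  next
    case False
    have "C / norm y powr (2 + \<beta>) \<le> C / 1"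
      using False C b by (intro divide_left_mono) (auto intro!: ge_one_powr_ge_zero)
    moreover have "\<kappa> / norm y powr (2 + 2 * \<beta>) \<le> \<kappa> / 1"
      using False k b by (intro divide_left_mono) (auto intro!: ge_one_powr_ge_zero)
    ultimately have "phi y \<le> K'" by (simp add: phi_def singular_potential_def K'_def)
    then show ?thesis using V(2)[OF that] by simp
  qed
  have U0: "U r \<ge> 0" for r by (simp add: U_def)
  have Um [measurable]: "U \<in> borel_measurable borel" unfolding U_def by measurable
  obtain K where K: "K \<ge> 0"
      "\<And>(x::real^'n) s. x \<noteq> 0 \<Longrightarrow> 0 < s \<Longrightarrow> s \<le> 1 \<Longrightarrow>
       integrable (gauss s) (\<lambda>z. U ((norm (x + z))\<^sup>2)) \<and>
       \<bar>(\<integral>z. U ((norm (x + z))\<^sup>2) \<partial>gauss s) - (U ((norm x)\<^sup>2)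
          + s * (wkbQ d cc g a ((norm x)\<^sup>2) * U ((norm x)\<^sup>2)))\<bar> \<le> K * s powr (3/2) * lyap x"
    unfolding U_def d_def using wkb_generator[OF cg, of a 0 a, where 'n='n, simplified] by blast
  have upper: "(\<integral>\<^sup>+w. ennreal (indicator nohit w * exp (- (LINT s:{0..1}|lborel. phi (w s))) * U ((norm (w 1))\<^sup>2)) \<partial>Wiener x)
     \<le> ennreal (exp (l + 0 + 1) * U ((norm x)\<^sup>2))" for x :: "real^'n"
  proof (rule FK_supersolution[OF Wiener_BM, where K=K and u="\<lambda>y. U ((norm y)\<^sup>2)"])
    show "continuous_on (- {0}) phi" "phi \<in> borel_measurable borel"
      unfolding phi_def by (rule singular_potential_continuous, measurable)
    show "- 0 \<le> phi y" for y using phi0 by simp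
    show "integrable (gauss s) (\<lambda>z. U ((norm (y + z))\<^sup>2)) \<and>
       (\<integral>z. U ((norm (y + z))\<^sup>2) \<partial>gauss s) \<le> U ((norm y)\<^sup>2) * (1 + s * (phi y + l)) + K * s powr (3/2) * lyap y"
      if y: "y \<noteq> 0" and s: "0 < s" "s \<le> 1" for y s
    proof -
      note KK = K(2)[OF y s]
      have r0: "(norm y)\<^sup>2 > 0" using y by simp
      have "wkbQ d cc g a ((norm y)\<^sup>2) \<le> phi y + l"
      proof -
        have "C * ((norm y)\<^sup>2) powr (- g - 1) = (C / 2) * ((norm y)\<^sup>2) powr (- g - 1) + (C / 2) * ((norm y)\<^sup>2) powr (- g - 1)"
          "(- E1) * ((norm y)\<^sup>2) powr (- 1) = - (E1 * ((norm y)\<^sup>2) powr (- 1))" by auto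
        with l(3)[OF r0] show ?thesis unfolding Qa pphi[OF y] by linarith
      qed
      then have "s * (wkbQ d cc g a ((norm y)\<^sup>2) * U ((norm y)\<^sup>2)) \<le> s * ((phi y + l) * U ((norm y)\<^sup>2))"
        using s U0 by (intro mult_left_mono mult_right_mono) auto
      then have "(\<integral>z. U ((norm (y + z))\<^sup>2) \<partial>gauss s) \<le> U ((norm y)\<^sup>2) + s * ((phi y + l) * U ((norm y)\<^sup>2)) + K * s powr (3/2) * lyap y"
        using KK by linarith
      then show ?thesis using KK by (simp add: algebra_simps)
    qed
  qed (use K l U0 in auto)
  define h where "h = hfun TYPE('n) \<beta> \<kappa>"
  define he where "he = h (eta1 \<beta> \<kappa>)"
  have he: "he > 0"
  proof -
    have "eta1 \<beta> \<kappa> > 0" using b k by (simp add: eta1_def eta0_def)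
    then show ?thesis by (simp add: he_def h_def hfun_def)
  qed
  have h0: "h r \<ge> 0" for r by (simp add: h_def hfun_def)
  have hx: "h (norm x) = wkb cc g a0 ((norm x)\<^sup>2)" if "x \<noteq> 0" "norm x \<le> 1" for x :: "real^'n"
    unfolding h_def cc_def g_def a0_def d_def using hfun_eq_wkb[OF that b] .
  obtain H where H: "H > 0" "\<And>x::real^'n. x \<noteq> 0 \<Longrightarrow> norm x \<le> 1 \<Longrightarrow> h (norm x) \<le> H"
  proof -
    obtain D N where D: "D \<ge> 0" "\<And>r. r > 0 \<Longrightarrow> wkb cc g a0 r \<le> D * (1 + r) ^ N"
      by (rule wkb_poly_bound[OF cg, of a0]) (rule that)
    have "h (norm x) \<le> D * 2 ^ N + 1" if x: "x \<noteq> 0" "norm x \<le> 1" for x :: "real^'n"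
    proof -
      have "h (norm x) \<le> D * (1 + (norm x)\<^sup>2) ^ N" unfolding hx[OF x] using x by (intro D) simp
      also have "\<dots> \<le> D * 2 ^ N" using x D power_le_one[of "norm x" 2] by (intro mult_left_mono power_mono) auto
      finally show ?thesis by simp
    qed
    then show thesis using D by (intro that[of "D * 2 ^ N + 1"]) (auto intro: add_nonneg_pos)
  qed
  \<comment> \<open>Ensures both \<open>h / H' \<le> 1\<close> and
    \<open>h / H' \<le> h / he\<close>, so the minimum in \<open>bound\<close> can be replaced from
    below by a multiple of \<open>h(|x|)\<close>.\<close>
  define H' where "H' = max he H"
  have H': "H' > 0" "he \<le> H'" "H \<le> H'" using he by (auto simp: H'_def)
  \<comment> \<open>A lower bound for the other factors of \<open>bound\<close> when
    \<open>y\<close> is in the box: \<open>h\<close> is constant beyond radius 1, the maximum in the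
    exponential is at least 1, and \<open>norm (x - y) \<le> 1 + 2 * d\<close>.\<close>
  define m where "m = c4 * (1 / H') * min 1 (h 1 / he) * exp (- c5) * ((4 * pi * c6) powr (- d / 2) * exp (- (1 + 2 * d)\<^sup>2 / (4 * c6)))"
  have h1: "h 1 > 0" by (simp add: h_def hfun_def)
  have m: "m > 0" using c H' h1 he by (simp add: m_def)
  \<comment> \<open>The box has volume 1, avoids the unit ball's interior, and has positive
    coordinates, as the sign condition in dimension one demands.\<close>
  define A :: "(real^'n) set" where "A = cbox (\<chi> i. 1) (\<chi> i. 2)"
  have A: "y \<in> A \<longleftrightarrow> (\<forall>i. 1 \<le> y $ i \<and> y $ i \<le> 2)" for y
    by (simp add: A_def mem_box_cart)
  have Am [measurable]: "A \<in> sets borel" by (simp add: A_def)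
  have Ay: "1 \<le> norm y" "norm y \<le> 2 * d" "y \<noteq> 0" if "y \<in> A" for y
  proof -
    have yi: "1 \<le> \<bar>y $ i\<bar>" "\<bar>y $ i\<bar> \<le> 2" for i
    proof -
      have "1 \<le> y $ i" "y $ i \<le> 2" using that unfolding A by auto
      then show "1 \<le> \<bar>y $ i\<bar>" "\<bar>y $ i\<bar> \<le> 2" by linarith+
    qed
    show n1: "1 \<le> norm y" using component_le_norm_cart[of y undefined] yi(1)[of undefined] by simp
    have "norm y \<le> (\<Sum>i\<in>UNIV. \<bar>y $ i\<bar>)" by (rule norm_le_l1_cart)
    also have "\<dots> \<le> (\<Sum>i\<in>(UNIV::'n set). 2)" by (intro sum_mono yi)
    finally show "norm y \<le> 2 * d" by (simp add: d_def)
    show "y \<noteq> 0" using n1 by auto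
  qed
  define I where "I = (\<integral>\<^sup>+y\<in>A. ennreal (U ((norm y)\<^sup>2)) \<partial>lborel)"
  have I: "I \<noteq> 0"
  proof
    assume "I = 0"
    then have "AE y in lborel. ennreal (U ((norm y)\<^sup>2)) * indicator A y = 0"
      unfolding I_def by (subst (asm) nn_integral_0_iff_AE) auto
    then have "AE y in lborel. y \<notin> A"
    proof eventually_elim
      case (elim y)
      show ?case
      proof
        assume y: "y \<in> A"
        then have "U ((norm y)\<^sup>2) > 0" unfolding U_def using Ay[OF y] by (intro wkb_pos) simp
        then show False using elim y by simp
      qed
    qed
    then have "emeasure lborel A = 0" using Am by (subst (asm) AE_iff_measurable[where N=A]) auto
    moreover have "emeasure lborel A = ennreal (\<Prod>b\<in>Basis. (((\<chi> i. 2) :: real^'n) - (\<chi> i. 1)) \<bullet> b)"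
      unfolding A_def by (rule emeasure_lborel_cbox) (auto simp: Basis_vec_def inner_axis)
    moreover have "(\<Prod>b\<in>Basis. (((\<chi> i. 2) :: real^'n) - (\<chi> i. 1)) \<bullet> b) = 1"
      by (intro prod.neutral) (auto simp: Basis_vec_def inner_axis)
    ultimately show False by simp
  qed
  define i0 where "i0 = (if I = \<infinity> then 1 else enn2real I)"
  have i0: "i0 > 0" "ennreal i0 \<le> I"
    using I by (auto simp: i0_def enn2real_positive_iff less_top zero_less_iff_neq_zero)
  define E where "E = exp K' * exp (l + 0 + 1)"
  have key: "m * h (norm x) * i0 \<le> E * U ((norm x)\<^sup>2)" if x: "x \<noteq> 0" "norm x \<le> 1" "\<And>i. x $ i > 0" for x :: "real^'n"
  proof -
    note [measurable] = FK_density_1(1)[OF Wiener_BM V(1,2), of x]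
    have "ennreal (m * h (norm x)) * ennreal i0 \<le> ennreal (m * h (norm x)) * I"
      by (intro mult_left_mono i0) simp
    also have "\<dots> = (\<integral>\<^sup>+y. ennreal (m * h (norm x)) * (ennreal (U ((norm y)\<^sup>2)) * indicator A y) \<partial>lborel)"
      unfolding I_def by (rule nn_integral_cmult[symmetric]) measurable
    also have "\<dots> \<le> (\<integral>\<^sup>+y. ennreal (FK_density V 1 x y) * ennreal (U ((norm y)\<^sup>2)) \<partial>lborel)"
    proof (rule nn_integral_mono_AE)
      show "AE y in lborel. ennreal (m * h (norm x)) * (ennreal (U ((norm y)\<^sup>2)) * indicator A y) \<le> ennreal (FK_density V 1 x y) * ennreal (U ((norm y)\<^sup>2))"
        using lb[OF x(1)]
      proof eventually_elim
        case (elim y)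
        show ?case
        proof (cases "y \<in> A")
          case True
          have "x $ i * y $ i > 0" for i using x(3)[of i] True unfolding A by (smt (verit) mult_pos_pos)
          with elim Ay(3)[OF True] have f: "bound \<beta> \<kappa> c4 c5 c6 1 x y \<le> FK_density V 1 x y" by blast
          have b1: "h (norm x) / H' \<le> min 1 (h (norm x) / he)"
          proof -
            have "h (norm x) / H' \<le> 1" using H(2)[OF x(1,2)] H' by simp
            moreover have "h (norm x) / H' \<le> h (norm x) / he" using H' he h0 by (intro divide_left_mono) auto
            ultimately show ?thesis by simp
          qed
          have hy: "h (norm y) = h 1" using Ay(1)[OF True] by (simp add: h_def hfun_def)
          define R where "R = max (max (norm x) (norm y)) (1 powr (1 / (2 + \<beta>)))"
          have "R \<ge> 1" by (simp add: R_def)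
          then have "R powr (2 + 2 * \<beta>) \<ge> 1" using b by (intro ge_one_powr_ge_zero) auto
          then have "c5 / R powr (2 + 2 * \<beta>) \<le> c5 / 1" using c by (intro divide_left_mono) auto
          then have b2: "exp (- c5) \<le> exp (- c5 * 1 / R powr (2 + 2 * \<beta>))" by simp
          have "norm (x - y) \<le> 1 + 2 * d" using norm_triangle_ineq4[of x y] x(2) Ay(2)[OF True] by linarith
          then have "(norm (x - y))\<^sup>2 / (4 * c6) \<le> (1 + 2 * d)\<^sup>2 / (4 * c6)"
            using c by (intro divide_right_mono power_mono) auto
          then have b3: "(4 * pi * c6) powr (- d / 2) * exp (- (1 + 2 * d)\<^sup>2 / (4 * c6)) \<le> heat (c6 * 1) x y"
            unfolding heat_def d_def by (intro mult_mono) auto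
          have "(c4 * (h (norm x) / H') * min 1 (h 1 / he) * exp (- c5)) * ((4 * pi * c6) powr (- d / 2) * exp (- (1 + 2 * d)\<^sup>2 / (4 * c6)))
            \<le> (c4 * min 1 (h (norm x) / he) * min 1 (h (norm y) / he) * exp (- c5 * 1 / R powr (2 + 2 * \<beta>))) * heat (c6 * 1) x y"
            unfolding hy using c he h0 H' h1 b1 b2 b3 by (intro mult_mono order_refl mult_nonneg_nonneg) auto
          also have "\<dots> = bound \<beta> \<kappa> c4 c5 c6 1 x y"
            by (simp add: bound_def Let_def h_def he_def R_def)
          finally have "m * h (norm x) \<le> FK_density V 1 x y"
            using f by (simp add: m_def ac_simps)
          then have "ennreal (m * h (norm x)) * ennreal (U ((norm y)\<^sup>2)) \<le> ennreal (FK_density V 1 x y) * ennreal (U ((norm y)\<^sup>2))"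
            by (intro mult_right_mono ennreal_leI) auto
          then show ?thesis using True by simp
        qed simp
      qed
    qed
    also have "\<dots> = (\<integral>\<^sup>+w. ennreal (indicator nohit w * exp (- (LINT s:{0..1}|lborel. V (w s)))) * ennreal (U ((norm (w 1))\<^sup>2)) \<partial>Wiener x)"
      by (rule FK_density_1(3)[OF Wiener_BM V(1,2), symmetric, where u="\<lambda>y. ennreal (U ((norm y)\<^sup>2))"]) auto
    also have "\<dots> \<le> (\<integral>\<^sup>+w. ennreal (exp K') * ennreal (indicator nohit w * exp (- (LINT s:{0..1}|lborel. phi (w s))) * U ((norm (w 1))\<^sup>2)) \<partial>Wiener x)"
    proof (rule nn_integral_mono)
      fix w assume w: "w \<in> space (Wiener x)"
      have "indicator nohit w * exp (- (LINT s:{0..1}|lborel. V (w s))) \<le> exp K' * (indicator nohit w * exp (- (LINT s:{0..1}|lborel. phi (w s))))"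
        by (rule FK_functional_mono[OF Wiener_BM w _ _ V(1,3)]) (auto simp: phi_def phiV[unfolded phi_def] singular_potential_bounded)
      then have "(indicator nohit w * exp (- (LINT s:{0..1}|lborel. V (w s)))) * U ((norm (w 1))\<^sup>2)
         \<le> (exp K' * (indicator nohit w * exp (- (LINT s:{0..1}|lborel. phi (w s))))) * U ((norm (w 1))\<^sup>2)"
        using U0 by (rule mult_right_mono)
      then show "ennreal (indicator nohit w * exp (- (LINT s:{0..1}|lborel. V (w s)))) * ennreal (U ((norm (w 1))\<^sup>2))
        \<le> ennreal (exp K') * ennreal (indicator nohit w * exp (- (LINT s:{0..1}|lborel. phi (w s))) * U ((norm (w 1))\<^sup>2))"
        using U0 by (subst (1 2) ennreal_mult[symmetric]) (auto intro!: ennreal_leI simp: ac_simps)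
    qed
    also have "\<dots> = ennreal (exp K') * (\<integral>\<^sup>+w. ennreal (indicator nohit w * exp (- (LINT s:{0..1}|lborel. phi (w s))) * U ((norm (w 1))\<^sup>2)) \<partial>Wiener x)"
    proof (rule nn_integral_cmult)
      note [measurable] = BM_component_measurable[OF Wiener_BM]
      have [measurable]: "(\<lambda>w. indicator nohit w * exp (- (LINT s:{0..1}|lborel. phi (w s)))) \<in> borel_measurable (Wiener x)"
        by (rule FK_functional_measurable[OF Wiener_BM]) (simp add: phi_def)
      show "(\<lambda>w. ennreal (indicator nohit w * exp (- (LINT s:{0..1}|lborel. phi (w s))) * U ((norm (w 1))\<^sup>2))) \<in> borel_measurable (Wiener x)"
        by measurable
    qed
    also have "\<dots> \<le> ennreal (exp K') * ennreal (exp (l + 0 + 1) * U ((norm x)\<^sup>2))"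
      by (intro mult_left_mono upper) simp
    finally have "ennreal (m * h (norm x) * i0) \<le> ennreal (E * U ((norm x)\<^sup>2))"
      using m h0 i0 U0 by (simp add: ennreal_mult E_def mult.assoc)
    then show ?thesis using U0 by (subst (asm) ennreal_le_iff) (auto simp: E_def)
  qed
  \<comment> \<open>Here \<open>U\<close> is \<open>r powr e\<close> times \<open>h\<close> with
    \<open>e > 0\<close>, so \<open>key\<close> would bound \<open>r powr (- e)\<close> by
    \<open>E / (m * i0)\<close> for all small \<open>r\<close>.\<close>
  obtain r where r: "0 < r" "r \<le> 1" "E / (m * i0) < r powr (- e)" using powr_unbounded[OF e] by blast
  obtain x :: "real^'n" where x: "x \<noteq> 0" "(norm x)\<^sup>2 = r" "\<And>i. x $ i > 0" using vec_with_norm[OF r(1)] by blast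
  have x1: "norm x \<le> 1" using x r by (metis abs_norm_cancel abs_square_le_1)
  have "m * wkb cc g a0 r * i0 \<le> E * (r powr e * wkb cc g a0 r)"
    using key[OF x(1) x1 x(3)] unfolding hx[OF x(1) x1] U_def a_def x(2) wkb_shift[OF r(1)] .
  then have "(m * i0) * wkb cc g a0 r \<le> (E * r powr e) * wkb cc g a0 r" by (simp add: ac_simps)
  then have "m * i0 \<le> E * r powr e" using wkb_pos[OF r(1), of cc g a0] by simp
  then have "(m * i0) * r powr (- e) \<le> (E * r powr e) * r powr (- e)" by (intro mult_right_mono) auto
  also have "\<dots> = E" using r by (simp add: powr_minus)
  finally have "r powr (- e) \<le> E / (m * i0)" using m i0 by (simp add: field_simps)
  with r(3) show False by simp
qed

theorem theorem5p6:
  fixes V :: "real^'n \<Rightarrow> real" and \<beta> \<kappa> :: real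
  assumes "\<beta> > 0" and "\<kappa> > 0"
    and V_meas: "V \<in> borel_measurable borel"
    and V_nonneg: "\<And>x. x \<noteq> 0 \<Longrightarrow> V x \<ge> 0"
    and V_locbdd: "\<And>K. compact K \<Longrightarrow> 0 \<notin> K \<Longrightarrow> bounded (V ` K)"
    and V_far: "\<exists>M. \<forall>x. norm x \<ge> 1 \<longrightarrow> V x \<le> M"
    and V_sing: "(\<integral>\<^sup>+ x\<in>ball 0 1 - {0}. ennreal (V x) \<partial>lborel) = \<infinity>"
  shows
    "((\<exists>C>0. \<forall>x. x \<noteq> 0 \<and> norm x \<le> 1 \<longrightarrow>
          V x \<le> \<kappa> / norm x powr (2 + 2 * \<beta>) - C / norm x powr (2 + \<beta>)) \<longrightarrow>
      \<not> (\<exists>c1>0. \<exists>c2>0. \<exists>c3>0. \<forall>t\<in>{0<..1}. \<forall>x. x \<noteq> 0 \<longrightarrow>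
          (AE y in lborel. y \<noteq> 0 \<longrightarrow>
             FK_density V t x y \<le> bound \<beta> \<kappa> c1 c2 c3 t x y)))
     \<and>
     ((\<exists>C>0. \<forall>x. x \<noteq> 0 \<and> norm x \<le> 1 \<longrightarrow>
          V x \<ge> \<kappa> / norm x powr (2 + 2 * \<beta>) + C / norm x powr (2 + \<beta>)) \<longrightarrow>
      \<not> (\<exists>c4>0. \<exists>c5>0. \<exists>c6>0. \<forall>t\<in>{0<..1}. \<forall>x. x \<noteq> 0 \<longrightarrow>
          (AE y in lborel. y \<noteq> 0 \<and> (CARD('n) = 1 \<longrightarrow> (\<forall>i. x $ i * y $ i > 0)) \<longrightarrow>
             FK_density V t x y \<ge> bound \<beta> \<kappa> c4 c5 c6 t x y)))"
proof (intro conjI impI notI)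
  obtain M where M: "\<And>x. norm x \<ge> 1 \<Longrightarrow> V x \<le> M" using V_far by blast
  assume "\<exists>C>0. \<forall>x. x \<noteq> 0 \<and> norm x \<le> 1 \<longrightarrow>
          V x \<le> \<kappa> / norm x powr (2 + 2 * \<beta>) - C / norm x powr (2 + \<beta>)"
  then obtain C where C: "C > 0" "\<And>x. x \<noteq> 0 \<Longrightarrow> norm x \<le> 1 \<Longrightarrow>
      V x \<le> \<kappa> / norm x powr (2 + 2 * \<beta>) - C / norm x powr (2 + \<beta>)" by blast
  assume "\<exists>c1>0. \<exists>c2>0. \<exists>c3>0. \<forall>t\<in>{0<..1}. \<forall>x. x \<noteq> 0 \<longrightarrow>
          (AE y in lborel. y \<noteq> 0 \<longrightarrow> FK_density V t x y \<le> bound \<beta> \<kappa> c1 c2 c3 t x y)"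
  then obtain c1 c2 c3 where c: "c1 > 0" "c2 > 0" "c3 > 0" and ub: "\<forall>t\<in>{0<..1}. \<forall>x. x \<noteq> 0 \<longrightarrow>
          (AE y in lborel. y \<noteq> 0 \<longrightarrow> FK_density V t x y \<le> bound \<beta> \<kappa> c1 c2 c3 t x y)" by blast
  have "(1::real) \<in> {0<..1}" by simp
  with ub have "\<And>x. x \<noteq> 0 \<Longrightarrow> AE y in lborel. y \<noteq> 0 \<longrightarrow> FK_density V 1 x y \<le> bound \<beta> \<kappa> c1 c2 c3 1 x y"
    by blast
  then show False
    using no_upper_bound[OF assms(1,2) C(1) V_meas V_nonneg V_locbdd M C(2) c] by blast
next
  assume "\<exists>C>0. \<forall>x. x \<noteq> 0 \<and> norm x \<le> 1 \<longrightarrow>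
          V x \<ge> \<kappa> / norm x powr (2 + 2 * \<beta>) + C / norm x powr (2 + \<beta>)"
  then obtain C where C: "C > 0" "\<And>x. x \<noteq> 0 \<Longrightarrow> norm x \<le> 1 \<Longrightarrow>
      V x \<ge> \<kappa> / norm x powr (2 + 2 * \<beta>) + C / norm x powr (2 + \<beta>)" by blast
  assume "\<exists>c4>0. \<exists>c5>0. \<exists>c6>0. \<forall>t\<in>{0<..1}. \<forall>x. x \<noteq> 0 \<longrightarrow>
          (AE y in lborel. y \<noteq> 0 \<and> (CARD('n) = 1 \<longrightarrow> (\<forall>i. x $ i * y $ i > 0)) \<longrightarrow>
             FK_density V t x y \<ge> bound \<beta> \<kappa> c4 c5 c6 t x y)"
  then obtain c4 c5 c6 where c: "c4 > 0" "c5 > 0" "c6 > 0" and lb: "\<forall>t\<in>{0<..1}. \<forall>x. x \<noteq> 0 \<longrightarrow>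
          (AE y in lborel. y \<noteq> 0 \<and> (CARD('n) = 1 \<longrightarrow> (\<forall>i. x $ i * y $ i > 0)) \<longrightarrow>
             FK_density V t x y \<ge> bound \<beta> \<kappa> c4 c5 c6 t x y)" by blast
  have "(1::real) \<in> {0<..1}" by simp
  with lb have "\<And>x. x \<noteq> 0 \<Longrightarrow> AE y in lborel. y \<noteq> 0 \<and> (CARD('n) = 1 \<longrightarrow> (\<forall>i. x $ i * y $ i > 0)) \<longrightarrow>
             FK_density V 1 x y \<ge> bound \<beta> \<kappa> c4 c5 c6 1 x y"
    by blast
  then show False
    using no_lower_bound[OF assms(1,2) C(1) V_meas V_nonneg V_locbdd C(2) c] by blast
qed

end
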